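(* Let $\Sigma$ be a finite set of primes, $k$ a positive integer, and $a_1,\ldots,a_k,b_1,\ldots,b_k\in\mathbb{Z}$ with $a_i\neq0$, $\gcd(a_i,b_i)=1$, $a_ib_j-a_jb_i\neq0$ ($i<j$), such that $(2k)!\prod_i a_i\prod_{i<j}(a_ib_j-a_jb_i)$ is a $\Sigma$-unit. Assume moreover that every $a_i$ is divisible by every prime of $\Sigma$. Then there exist $\eta,c_1,\varepsilon\in(0,1/2]$, depending only on $k$ and $\#\Sigma$, such that: (a) there is $z_1\ge2$ depending on the $a_i,b_i$ with $\#\Omega_1(x,z)\ge c_1x/(\log z)^k$ whenever $x^\eta\ge z\ge z_1$; and (b) for every set $\mathcal P$ of primes with $\bar\delta(\mathcal P)\le\varepsilon$ there exists $x_0\ge2$, depending on $a_1,\ldots,a_k,b_1,\ldots,b_k$ and on $\mathcal P$, such that for all $x\ge x_0$ at least half of the elements $n$ of $\Omega_1(x,x^\eta)$ satisfy $p\nmid L_1(n)\cdots L_k(n)$ for every $p\in\mathcal P$.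
   Context: An integer is a $\Sigma$-unit if all its prime divisors lie in $\Sigma$; it is $\Sigma$-square-free if it is a product of a $\Sigma$-unit and a square-free integer. $P_\Sigma(z)=\prod_{p<z,\,p\notin\Sigma}p$. $L_i(n)=a_in+b_i$. $\Omega(x,z)=\{n\in\mathbb{Z}:1\le n\le x,\ \gcd(L_1(n)\cdots L_k(n),P_\Sigma(z))=1\}$ and $\Omega_1(x,z)=\{n\in\Omega(x,z): L_1(n),\ldots,L_k(n)\text{ are all }\Sigma\text{-square-free composite numbers}\}$. For a set $\mathcal P$ of primes, its relative upper density is $\bar\delta(\mathcal P)=\limsup_{x\to\infty}\#(\mathcal P\cap[1,x])/\pi(x)$. (In the paper, $\eta$ is the number provided by the preceding sieving theorem, whose conclusion is part (a).) *)

theory Defs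
  imports "HOL-Analysis.Analysis" "HOL-Computational_Algebra.Squarefree"
begin

definition sigma_unit :: "int set \<Rightarrow> int \<Rightarrow> bool" where
  "sigma_unit S n \<longleftrightarrow> (\<forall>p::int. prime p \<longrightarrow> p dvd n \<longrightarrow> p \<in> S)"

definition sigma_squarefree :: "int set \<Rightarrow> int \<Rightarrow> bool" where
  "sigma_squarefree S n \<longleftrightarrow> (\<exists>u s. sigma_unit S u \<and> squarefree s \<and> n = u * s)"

definition composite :: "int \<Rightarrow> bool" where
  "composite n \<longleftrightarrow> \<bar>n\<bar> > 1 \<and> \<not> prime \<bar>n\<bar>"

definition P_Sigma :: "int set \<Rightarrow> real \<Rightarrow> int" where
  "P_Sigma S z = (\<Prod>p\<in>{p::int. prime p \<and> real_of_int p < z \<and> p \<notin> S}. p)"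

definition linform :: "(nat \<Rightarrow> int) \<Rightarrow> (nat \<Rightarrow> int) \<Rightarrow> nat \<Rightarrow> int \<Rightarrow> int" where
  "linform a b i n = a i * n + b i"

definition Omega :: "int set \<Rightarrow> nat \<Rightarrow> (nat \<Rightarrow> int) \<Rightarrow> (nat \<Rightarrow> int) \<Rightarrow> real \<Rightarrow> real \<Rightarrow> int set" where
  "Omega S k a b x z = {n::int. 1 \<le> n \<and> real_of_int n \<le> x \<and>
      coprime (\<Prod>i\<in>{1..k}. linform a b i n) (P_Sigma S z)}"

definition Omega1 :: "int set \<Rightarrow> nat \<Rightarrow> (nat \<Rightarrow> int) \<Rightarrow> (nat \<Rightarrow> int) \<Rightarrow> real \<Rightarrow> real \<Rightarrow> int set" where
  "Omega1 S k a b x z = {n \<in> Omega S k a b x z.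
      \<forall>i\<in>{1..k}. sigma_squarefree S (linform a b i n) \<and> composite (linform a b i n)}"

text \<open>Relative upper density of a set of primes: limsup of #(P \<inter> [1,x]) / \<pi>(x);
  the counting functions are step functions, so x may range over the naturals.\<close>
definition rel_upper_density :: "int set \<Rightarrow> ereal" where
  "rel_upper_density P = limsup (\<lambda>x::nat.
      ereal (real (card {p \<in> P. 1 \<le> p \<and> p \<le> int x}) /
             real (card {p::nat. prime p \<and> p \<le> x})))"

end

theory Submission
  imports Defs "HOL-Real_Asymp.Real_Asymp" "HOL-Number_Theory.Cong"
begin

text \<open>
  Since every \<open>a i\<close> is divisible by all primes of \<open>S\<close>, no prime of \<open>S\<close> divides \<open>L i n\<close>, while each
  prime outside \<open>S\<close> exceeds \<open>2k\<close> and excludes exactly \<open>k\<close> residue classes. A Brun-Hooley sieve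
  therefore sieves by the primes up to a small power of \<open>x\<close> with loss of a constant factor, and
  Mertens' product gives the order \<open>x / (ln z)^k\<close>.

  For (a), the \<open>n\<close> with a non-square-free \<open>L i n\<close> are negligible since \<open>p\<^sup>2\<close> divides \<open>L i n\<close> for some
  \<open>p \<ge> z\<close>. If \<open>L i n\<close> is prime up to sign, then it even survives sieving up to
  \<open>y = x powr (1/(2K))\<close>, which costs a further factor of order \<open>ln z / ln y\<close>, at most a multiple of \<open>\<eta>\<close>.

  For (b), if \<open>p \<in> P\<close> divides the composite number \<open>L i n\<close>, then the cofactor also has a prime factor
  \<open>\<ge> x powr \<eta>\<close>, so \<open>x powr \<eta> \<le> p \<le> A x powr (1 - \<eta>)\<close>. This leaves room for an upper bound sieve in the
  progression \<open>p | L i n\<close>, and the sum of \<open>1/p\<close> over such \<open>p \<in> P\<close> is at most a multiple of \<open>\<epsilon>/\<eta>\<close>.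
\<close>

section \<open>Truncated inclusion-exclusion and the Brun-Hooley sieve\<close>

text \<open>The order in which the constants are fixed shapes the proof. The sieve exponent
  \<open>K\<close> and the Mertens constants depend on \<open>k\<close> at most;
  \<open>\<eta>\<close> is then taken so small that noncomposite values cost at most half of the
  lower bound for \<open>Omega\<close>; \<open>\<epsilon>\<close> comes last and absorbs the powers
  of \<open>1/\<eta>\<close>. The coefficients and the set \<open>P\<close> may influence only the
  thresholds, so the sieve is proved abstractly, with a remainder \<open>y ^ K\<close> that knows
  nothing of them. The size of \<open>S\<close> is felt only in the upper bound for the sifting
  density, hence only in \<open>\<epsilon>\<close>. A single truncation of inclusion-exclusion over
  all primes below a power of \<open>x\<close> fails, because the sum of \<open>k/p\<close> over
  them grows like \<open>k\<close> times \<open>ln (ln x)\<close>. Truncating separately in blocks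
  on which this sum is bounded avoids the growth, at the price of a product of truncated sums whose
  lower bound needs its own argument. In (b) the sieve remainders are added over up to a multiple of
  \<open>x powr (1 - \<eta>)\<close> progressions, which is why the sifting level there is only
  \<open>x powr (\<eta> / (2 * K))\<close>.\<close>

definition esym :: "nat \<Rightarrow> ('p \<Rightarrow> real) \<Rightarrow> 'p set \<Rightarrow> real" where
  "esym m g Q = (\<Sum>U\<in>Pow Q. if card U = m then prod g U else 0)"

text \<open>\<open>esym\<close> is the elementary symmetric polynomial of degree \<open>m\<close>,
  and \<open>trunc_sum\<close> is the expansion of the product of \<open>1 - g p\<close> cut off
  after degree \<open>b\<close>. Placing the size condition inside a sum over all of
  \<open>Pow Q\<close> gives both a simple recursion under \<open>insert\<close>.\<close>

definition trunc_sum :: "nat \<Rightarrow> ('p \<Rightarrow> real) \<Rightarrow> 'p set \<Rightarrow> real" where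
  "trunc_sum b g Q = (\<Sum>U\<in>Pow Q. if card U \<le> b then (-1) ^ card U * prod g U else 0)"

section \<open>Sums over power sets, elementary symmetric sums and Bonferroni inequalities\<close>

lemma sum_Pow_insert:
  fixes f :: "'p set \<Rightarrow> 'a::comm_monoid_add"
  assumes "finite Q" "p \<notin> Q"
  shows "sum f (Pow (insert p Q)) = sum f (Pow Q) + (\<Sum>U\<in>Pow Q. f (insert p U))"
proof -
  have "inj_on (insert p) (Pow Q)"
    using assms(2) by (auto simp: inj_on_def)
  moreover have "Pow Q \<inter> insert p ` Pow Q = {}"
    using assms(2) by auto
  ultimately show ?thesis
    using assms(1) by (simp add: Pow_insert sum.union_disjoint sum.reindex)
qed

lemma sum_Pow_Un:
  fixes f :: "'p set \<Rightarrow> 'a::comm_monoid_add"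
  assumes "finite A" "finite B" "A \<inter> B = {}"
  shows "sum f (Pow (A \<union> B)) = (\<Sum>U\<in>Pow A. \<Sum>V\<in>Pow B. f (U \<union> V))"
proof -
  have "(\<Sum>U\<in>Pow A. \<Sum>V\<in>Pow B. f (U \<union> V)) = (\<Sum>(U,V)\<in>Pow A \<times> Pow B. f (U \<union> V))"
    using assms by (simp add: sum.cartesian_product)
  also have "\<dots> = sum f (Pow (A \<union> B))"
    by (rule sum.reindex_bij_witness[of _ "\<lambda>T. (T \<inter> A, T \<inter> B)" "\<lambda>(U, V). U \<union> V"])
      (use assms in auto)
  finally show ?thesis by simp
qed

text \<open>A subset of a disjoint union is the same as one subset of each block, so this is
  distributivity. It turns a product of blockwise sums into a single sum over sets of primes, to
  which a counting hypothesis can be applied.\<close>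

lemma sum_Pow_UN_prod:
  fixes f :: "nat \<Rightarrow> 'p set \<Rightarrow> 'a::comm_semiring_1"
  assumes "\<And>j. j < J \<Longrightarrow> finite (Q j)" "\<And>i j. i < j \<Longrightarrow> j < J \<Longrightarrow> Q i \<inter> Q j = {}"
  shows "(\<Sum>T\<in>Pow (\<Union>j<J. Q j). \<Prod>j<J. f j (T \<inter> Q j)) = (\<Prod>j<J. \<Sum>U\<in>Pow (Q j). f j U)"
  using assms
proof (induction J)
  case (Suc J)
  let ?A = "\<Union>j<J. Q j"
  have disj: "?A \<inter> Q J = {}" using Suc.prems(2) by fastforce
  have "(\<Sum>T\<in>Pow (\<Union>j<Suc J. Q j). \<Prod>j<Suc J. f j (T \<inter> Q j))
      = (\<Sum>U\<in>Pow ?A. \<Sum>V\<in>Pow (Q J). \<Prod>j<Suc J. f j ((U \<union> V) \<inter> Q j))"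
    using Suc.prems(1) disj by (subst sum_Pow_Un[symmetric]) (auto simp: lessThan_Suc Un_commute)
  also have "\<dots> = (\<Sum>U\<in>Pow ?A. \<Sum>V\<in>Pow (Q J). (\<Prod>j<J. f j (U \<inter> Q j)) * f J V)"
  proof (intro sum.cong refl)
    fix U V assume UV: "U \<in> Pow ?A" "V \<in> Pow (Q J)"
    have 1: "(U \<union> V) \<inter> Q J = V" using UV disj by auto
    have 2: "(U \<union> V) \<inter> Q j = U \<inter> Q j" if "j < J" for j
      using UV Suc.prems(2)[of j J] that by auto
    have "(\<Prod>j<J. f j ((U \<union> V) \<inter> Q j)) = (\<Prod>j<J. f j (U \<inter> Q j))"
      by (rule prod.cong) (use 2 in auto)
    then show "(\<Prod>j<Suc J. f j ((U \<union> V) \<inter> Q j)) = (\<Prod>j<J. f j (U \<inter> Q j)) * f J V"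
      by (simp add: 1)
  qed
  also have "\<dots> = (\<Sum>U\<in>Pow ?A. \<Prod>j<J. f j (U \<inter> Q j)) * (\<Sum>V\<in>Pow (Q J). f J V)"
    by (simp add: sum_product)
  finally show ?case using Suc by simp
qed simp

lemma esym_nonneg: "(\<And>p. p \<in> Q \<Longrightarrow> 0 \<le> g p) \<Longrightarrow> 0 \<le> esym m g Q"
  unfolding esym_def by (intro sum_nonneg) (auto intro!: prod_nonneg)

lemma esym_insert:
  assumes "finite Q" "p \<notin> Q"
  shows "esym (Suc m) g (insert p Q) = esym (Suc m) g Q + g p * esym m g Q"
proof -
  have "(\<Sum>U\<in>Pow Q. if card (insert p U) = Suc m then prod g (insert p U) else 0)
      = (\<Sum>U\<in>Pow Q. g p * (if card U = m then prod g U else 0))"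
  proof (intro sum.cong refl)
    fix U assume "U \<in> Pow Q"
    then have "finite U" "p \<notin> U" using assms finite_subset by auto
    then show "(if card (insert p U) = Suc m then prod g (insert p U) else 0)
      = g p * (if card U = m then prod g U else 0)" by simp
  qed
  then show ?thesis
    using assms by (simp add: esym_def sum_Pow_insert sum_distrib_left)
qed

lemma trunc_sum_insert:
  assumes "finite Q" "p \<notin> Q"
  shows "trunc_sum (Suc m) g (insert p Q) = trunc_sum (Suc m) g Q - g p * trunc_sum m g Q"
proof -
  have "(\<Sum>U\<in>Pow Q. if card (insert p U) \<le> Suc m then (-1) ^ card (insert p U) * prod g (insert p U) else 0)
      = (\<Sum>U\<in>Pow Q. - (g p * (if card U \<le> m then (-1) ^ card U * prod g U else 0)))"
  proof (intro sum.cong refl)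
    fix U assume "U \<in> Pow Q"
    then have "finite U" "p \<notin> U" using assms finite_subset by auto
    then show "(if card (insert p U) \<le> Suc m then (-1) ^ card (insert p U) * prod g (insert p U) else 0)
      = - (g p * (if card U \<le> m then (-1) ^ card U * prod g U else 0))" by simp
  qed
  then show ?thesis
    using assms by (simp add: trunc_sum_def sum_Pow_insert sum_distrib_left sum_negf)
qed

lemma esym_0: "finite Q \<Longrightarrow> esym 0 g Q = 1"
proof -
  assume "finite Q"
  then have "esym 0 g Q = (\<Sum>U\<in>Pow Q. if U = {} then 1 else 0)"
    unfolding esym_def by (intro sum.cong refl) (auto dest: finite_subset)
  with \<open>finite Q\<close> show ?thesis by (simp add: sum.delta)
qed

lemma trunc_sum_0: "finite Q \<Longrightarrow> trunc_sum 0 g Q = 1"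
proof -
  assume "finite Q"
  then have "trunc_sum 0 g Q = (\<Sum>U\<in>Pow Q. if U = {} then 1 else 0)"
    unfolding trunc_sum_def by (intro sum.cong refl) (auto dest: finite_subset)
  with \<open>finite Q\<close> show ?thesis by (simp add: sum.delta)
qed

text \<open>Expanding \<open>sum g Q ^ m\<close> produces every \<open>m\<close>-subset once for
  each of its \<open>m!\<close> orderings, and all other terms are nonnegative. The induction
  reflects this by keeping only the first two terms of the binomial expansion of
  \<open>(s + g p) ^ Suc n\<close>.\<close>

lemma esym_le_power:
  assumes "finite Q" "\<And>p. p \<in> Q \<Longrightarrow> 0 \<le> g p"
  shows "esym m g Q \<le> sum g Q ^ m / fact m"
  using assms
proof (induction Q arbitrary: m rule: finite_induct)
  case empty
  then show ?case by (cases m) (auto simp: esym_def)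
next
  case (insert p Q)
  show ?case
  proof (cases m)
    case 0
    then show ?thesis using insert.hyps by (simp add: esym_0)
  next
    case (Suc n)
    define s where "s = sum g Q"
    have s: "0 \<le> s" "0 \<le> g p" unfolding s_def using insert.prems by (auto intro: sum_nonneg)
    have "esym m g (insert p Q) \<le> s ^ Suc n / fact (Suc n) + g p * (s ^ n / fact n)"
      unfolding Suc esym_insert[OF insert.hyps(1,2)] s_def
      by (intro add_mono mult_left_mono insert.IH) (use insert.prems in auto)
    also have "\<dots> = (s ^ Suc n + real (Suc n) * g p * s ^ n) / fact (Suc n)"
      by (simp add: divide_simps fact_nonzero del: of_nat_Suc)
    also have "s ^ Suc n + real (Suc n) * g p * s ^ n \<le> (s + g p) ^ Suc n"
    proof -
      have "(s + g p) ^ Suc n = (\<Sum>i\<le>Suc n. real (Suc n choose i) * g p ^ i * s ^ (Suc n - i))"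
        by (subst add.commute, subst binomial_ring) simp
      also have "\<dots> \<ge> (\<Sum>i\<in>{0,1}. real (Suc n choose i) * g p ^ i * s ^ (Suc n - i))"
        by (intro sum_mono2) (use s in auto)
      finally show ?thesis by simp
    qed
    finally show ?thesis
      using insert.hyps Suc by (simp add: s_def add.commute divide_right_mono)
  qed
qed

text \<open>For independent events of probabilities \<open>g p\<close> these are the Bonferroni inequalities;
  for \<open>g = 1\<close> they bound the indicator of \<open>Q = {}\<close>.\<close>
lemma bonferroni:
  assumes "finite Q" "\<And>p. p \<in> Q \<Longrightarrow> 0 \<le> g p" "\<And>p. p \<in> Q \<Longrightarrow> g p \<le> 1"
  shows "0 \<le> (-1) ^ b * (trunc_sum b g Q - (\<Prod>p\<in>Q. 1 - g p)) \<and>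
         (-1) ^ b * (trunc_sum b g Q - (\<Prod>p\<in>Q. 1 - g p)) \<le> esym (Suc b) g Q"
  using assms
proof (induction Q arbitrary: b rule: finite_induct)
  case empty
  then show ?case by (simp add: esym_def trunc_sum_def)
next
  case (insert p Q)
  have gp: "0 \<le> g p" "g p \<le> 1" using insert.prems by auto
  have IH: "0 \<le> (-1) ^ b * (trunc_sum b g Q - (\<Prod>p\<in>Q. 1 - g p))"
    "(-1) ^ b * (trunc_sum b g Q - (\<Prod>p\<in>Q. 1 - g p)) \<le> esym (Suc b) g Q" for b
    using insert.IH[of b] insert.prems by auto
  show ?case
  proof (cases b)
    case 0
    let ?V = "\<Prod>p\<in>Q. 1 - g p"
    have V: "?V \<le> 1" using insert.prems by (intro prod_le_1) auto
    from IH[of 0] insert.hyps have "1 - ?V \<le> esym (Suc 0) g Q" by (simp add: trunc_sum_0)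
    moreover have V0: "0 \<le> ?V" using insert.prems by (auto intro!: prod_nonneg)
    moreover have "g p * ?V \<le> g p" using gp V by (simp add: mult_left_le)
    moreover have "0 \<le> g p * ?V" using V0 gp by simp
    moreover have "(1 - g p) * ?V = ?V - g p * ?V" by (simp add: algebra_simps)
    ultimately have "0 \<le> 1 - (1 - g p) * ?V" "1 - (1 - g p) * ?V \<le> esym (Suc 0) g Q + g p"
      using V by linarith+
    then show ?thesis
      using 0 insert.hyps by (simp add: trunc_sum_0 esym_insert esym_0)
  next
    case (Suc c)
    \<comment> \<open>The signed error for \<open>insert p Q\<close> is the error for
      \<open>Q\<close> at the same level plus \<open>g p\<close> times the error one level lower.
      \<open>esym\<close> obeys the same recursion, so both bounds propagate.\<close>
    have eq: "(-1) ^ b * (trunc_sum b g (insert p Q) - (\<Prod>p\<in>insert p Q. 1 - g p))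
      = (-1) ^ Suc c * (trunc_sum (Suc c) g Q - (\<Prod>p\<in>Q. 1 - g p))
        + g p * ((-1) ^ c * (trunc_sum c g Q - (\<Prod>p\<in>Q. 1 - g p)))"
      using insert.hyps Suc by (simp add: trunc_sum_insert algebra_simps)
    have "g p * ((-1) ^ c * (trunc_sum c g Q - (\<Prod>p\<in>Q. 1 - g p))) \<le> g p * esym (Suc c) g Q"
      by (rule mult_left_mono[OF IH(2) gp(1)])
    moreover have "0 \<le> g p * ((-1) ^ c * (trunc_sum c g Q - (\<Prod>p\<in>Q. 1 - g p)))"
      by (rule mult_nonneg_nonneg[OF gp(1) IH(1)])
    ultimately show ?thesis
      unfolding eq unfolding Suc esym_insert[OF insert.hyps(1,2)]
      using IH[of "Suc c"] by (intro conjI) linarith+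
  qed
qed

text \<open>Hooley's inequality. Lower bounds for the individual factors may be negative and cannot
  be multiplied, so the product of the upper bounds \<open>y j\<close> is taken instead and
  corrected by replacing one factor at a time by its error \<open>e j\<close>.\<close>

lemma prod_telescope_bound:
  fixes x y :: "nat \<Rightarrow> real"
  assumes "\<And>j. j < J \<Longrightarrow> 0 \<le> x j" "\<And>j. j < J \<Longrightarrow> x j \<le> y j" "\<And>j. j < J \<Longrightarrow> y j - x j \<le> e j"
  shows "(\<Prod>j<J. y j) - (\<Sum>l<J. \<Prod>j<J. if j = l then e j else y j) \<le> (\<Prod>j<J. x j)"
  using assms
proof (induction J)
  case (Suc J)
  have xy: "0 \<le> x J" "x J \<le> y J" "y J - x J \<le> e J" using Suc.prems by auto
  have IH: "(\<Prod>j<J. y j) - (\<Sum>l<J. \<Prod>j<J. if j = l then e j else y j) \<le> (\<Prod>j<J. x j)"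
    using Suc by simp
  have x0: "0 \<le> (\<Prod>j<J. x j)" using Suc.prems by (intro prod_nonneg) auto
  have xley: "(\<Prod>j<J. x j) \<le> (\<Prod>j<J. y j)" using Suc.prems by (intro prod_mono) auto
  have "(\<Sum>l<Suc J. \<Prod>j<Suc J. if j = l then e j else y j)
    = (\<Sum>l<J. \<Prod>j<J. if j = l then e j else y j) * y J + (\<Prod>j<J. y j) * e J"
  proof -
    have "(\<Sum>l<J. \<Prod>j<Suc J. if j = l then e j else y j)
       = (\<Sum>l<J. (\<Prod>j<J. if j = l then e j else y j) * y J)"
      by (intro sum.cong refl) auto
    moreover have "(\<Prod>j<J. if j = J then e j else y j) = (\<Prod>j<J. y j)"
      by (intro prod.cong) auto
    ultimately show ?thesis by (simp add: sum_distrib_right)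
  qed
  moreover have "(\<Prod>j<J. y j) * y J - ((\<Sum>l<J. \<Prod>j<J. if j = l then e j else y j) * y J) \<le> (\<Prod>j<J. x j) * y J"
    using mult_right_mono[OF IH, of "y J"] xy by (simp add: algebra_simps)
  moreover have "(\<Prod>j<J. x j) * (y J - x J) \<le> (\<Prod>j<J. y j) * e J"
    using xy x0 xley by (intro mult_mono) auto
  ultimately show ?case by (simp add: algebra_simps)
qed simp

lemma prod_UN_split:
  fixes h :: "'p \<Rightarrow> 'a::comm_monoid_mult" and Q :: "nat \<Rightarrow> 'p set"
  assumes "\<And>j. j < J \<Longrightarrow> finite (Q j)" "\<And>i j. i < j \<Longrightarrow> j < J \<Longrightarrow> Q i \<inter> Q j = {}"
    and "T \<subseteq> (\<Union>j<J. Q j)"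
  shows "prod h T = (\<Prod>j<J. prod h (T \<inter> Q j))"
proof -
  have "T = (\<Union>j\<in>{..<J}. T \<inter> Q j)" using assms(3) by auto
  then have "prod h T = prod h (\<Union>j\<in>{..<J}. T \<inter> Q j)" by simp
  also have "\<dots> = (\<Prod>j<J. prod h (T \<inter> Q j))"
  proof (rule prod.UNION_disjoint)
    show "\<forall>i\<in>{..<J}. \<forall>j\<in>{..<J}. i \<noteq> j \<longrightarrow> (T \<inter> Q i) \<inter> (T \<inter> Q j) = {}"
    proof (intro ballI impI)
      fix i j assume "i \<in> {..<J}" "j \<in> {..<J}" "i \<noteq> j"
      then show "(T \<inter> Q i) \<inter> (T \<inter> Q j) = {}"
        using assms(2)[of i j] assms(2)[of j i] by (cases rule: linorder_cases[of i j]) auto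
    qed
  qed (use assms(1) in auto)
  finally show ?thesis .
qed

text \<open>Expand the product into a sum over \<open>T\<close>, interchange with the sum over
  \<open>n\<close>, and insert the count for each \<open>T\<close>; main term and remainder both
  factor over the blocks again. The weights \<open>f\<close> are arbitrary so that the truncated
  product and each correction term of the telescoping inequality can be treated alike.\<close>

lemma weighted_count:
  fixes f :: "nat \<Rightarrow> 'p set \<Rightarrow> real" and bad :: "'n \<Rightarrow> 'p set"
  assumes A: "finite A" and fin: "\<And>j. j < J \<Longrightarrow> finite (Q j)"
    and disj: "\<And>i j. i < j \<Longrightarrow> j < J \<Longrightarrow> Q i \<inter> Q j = {}"
    and count: "\<And>T. T \<subseteq> (\<Union>j<J. Q j) \<Longrightarrow>
      \<bar>real (card {n\<in>A. T \<subseteq> bad n}) - X * prod g T\<bar> \<le> r ^ card T"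
  shows "\<bar>(\<Sum>n\<in>A. \<Prod>j<J. \<Sum>U\<in>Pow (Q j \<inter> bad n). f j U)
      - X * (\<Prod>j<J. \<Sum>U\<in>Pow (Q j). f j U * prod g U)\<bar>
    \<le> (\<Prod>j<J. \<Sum>U\<in>Pow (Q j). \<bar>f j U\<bar> * r ^ card U)"
proof -
  let ?P = "\<Union>j<J. Q j"
  define w where "w T = (\<Prod>j<J. f j (T \<inter> Q j))" for T
  have finP: "finite ?P" using fin by auto
  have 1: "(\<Prod>j<J. \<Sum>U\<in>Pow (Q j \<inter> B). f j U) = (\<Sum>T\<in>Pow ?P. if T \<subseteq> B then w T else 0)" for B
  proof -
    have "(\<Prod>j<J. \<Sum>U\<in>Pow (Q j \<inter> B). f j U)
        = (\<Sum>T\<in>Pow (\<Union>j<J. Q j \<inter> B). \<Prod>j<J. f j (T \<inter> (Q j \<inter> B)))"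
      by (rule sum_Pow_UN_prod[symmetric]) (use fin disj in blast)+
    also have "\<dots> = (\<Sum>T\<in>{T\<in>Pow ?P. T \<subseteq> B}. w T)"
    proof (rule sum.cong)
      fix T assume "T \<in> {T\<in>Pow ?P. T \<subseteq> B}"
      then have "T \<inter> (Q j \<inter> B) = T \<inter> Q j" for j by auto
      then show "(\<Prod>j<J. f j (T \<inter> (Q j \<inter> B))) = w T" by (simp add: w_def)
    qed auto
    also have "\<dots> = (\<Sum>T\<in>Pow ?P. if T \<subseteq> B then w T else 0)"
      by (rule sum.inter_filter) (use finP in auto)
    finally show ?thesis .
  qed
  have "(\<Sum>n\<in>A. \<Prod>j<J. \<Sum>U\<in>Pow (Q j \<inter> bad n). f j U)
      = (\<Sum>T\<in>Pow ?P. \<Sum>n\<in>A. if T \<subseteq> bad n then w T else 0)"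
    unfolding 1 by (rule sum.swap)
  also have "\<dots> = (\<Sum>T\<in>Pow ?P. w T * real (card {n\<in>A. T \<subseteq> bad n}))"
    using A by (simp add: sum.inter_filter[symmetric] mult.commute)
  finally have 2: "(\<Sum>n\<in>A. \<Prod>j<J. \<Sum>U\<in>Pow (Q j \<inter> bad n). f j U)
      = (\<Sum>T\<in>Pow ?P. w T * real (card {n\<in>A. T \<subseteq> bad n}))" .
  have 3: "(\<Prod>j<J. \<Sum>U\<in>Pow (Q j). F j U * prod h U) = (\<Sum>T\<in>Pow ?P. (\<Prod>j<J. F j (T \<inter> Q j)) * prod h T)"
    for F :: "nat \<Rightarrow> 'p set \<Rightarrow> real" and h
  proof -
    have "(\<Prod>j<J. \<Sum>U\<in>Pow (Q j). F j U * prod h U)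
        = (\<Sum>T\<in>Pow ?P. \<Prod>j<J. F j (T \<inter> Q j) * prod h (T \<inter> Q j))"
      by (rule sum_Pow_UN_prod[symmetric]) (use fin disj in auto)
    also have "\<dots> = (\<Sum>T\<in>Pow ?P. (\<Prod>j<J. F j (T \<inter> Q j)) * prod h T)"
      by (intro sum.cong refl) (simp add: prod.distrib prod_UN_split[OF fin disj])
    finally show ?thesis .
  qed
  have 4: "(\<Prod>j<J. \<Sum>U\<in>Pow (Q j). \<bar>f j U\<bar> * r ^ card U) = (\<Sum>T\<in>Pow ?P. \<bar>w T\<bar> * r ^ card T)"
    using 3[of "\<lambda>j U. \<bar>f j U\<bar>" "\<lambda>_. r"] by (simp add: w_def abs_prod)
  have "(\<Sum>n\<in>A. \<Prod>j<J. \<Sum>U\<in>Pow (Q j \<inter> bad n). f j U)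
      - X * (\<Prod>j<J. \<Sum>U\<in>Pow (Q j). f j U * prod g U)
      = (\<Sum>T\<in>Pow ?P. w T * (real (card {n\<in>A. T \<subseteq> bad n}) - X * prod g T))"
    unfolding 2 3[of f g] w_def[symmetric]
    by (simp add: sum_distrib_left sum_subtractf algebra_simps)
  also have "\<bar>\<dots>\<bar> \<le> (\<Sum>T\<in>Pow ?P. \<bar>w T\<bar> * r ^ card T)"
    by (rule order.trans[OF sum_abs], intro sum_mono)
      (auto simp: abs_mult intro!: mult_left_mono count)
  finally show ?thesis unfolding 4 .
qed

lemma trunc_sum_one_bounds:
  assumes "finite Q" "even b"
  shows "(if Q = {} then 1 else 0) \<le> trunc_sum b (\<lambda>_. 1) Q"
    and "trunc_sum b (\<lambda>_. 1) Q - (if Q = {} then 1 else 0) \<le> esym (Suc b) (\<lambda>_. 1) Q"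
proof -
  have "(\<Prod>p\<in>Q. 1 - (1::real)) = (if Q = {} then 1 else 0)"
    using assms(1) by (simp add: power_0_left)
  then show "(if Q = {} then 1 else 0) \<le> trunc_sum b (\<lambda>_. 1) Q"
    "trunc_sum b (\<lambda>_. 1) Q - (if Q = {} then 1 else 0) \<le> esym (Suc b) (\<lambda>_. 1) Q"
    using bonferroni[OF assms(1), of "\<lambda>_. 1" b] assms(2) by auto
qed

text \<open>The indicator of survival is a product over blocks. Even truncations bound each factor
  from above, and their product gives the upper estimate; the lower estimate subtracts the
  corrections of \<open>prod_telescope_bound\<close>. Hypothesis \<open>small\<close> says that the
  relative truncation errors of all blocks together are at most 1/2.\<close>

lemma brun_hooley:
  fixes g :: "'p \<Rightarrow> real" and bad :: "'n \<Rightarrow> 'p set"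
  assumes A: "finite A" and fin: "\<And>j. j < J \<Longrightarrow> finite (Q j)"
    and disj: "\<And>i j. i < j \<Longrightarrow> j < J \<Longrightarrow> Q i \<inter> Q j = {}"
    and g: "\<And>j p. j < J \<Longrightarrow> p \<in> Q j \<Longrightarrow> 0 \<le> g p \<and> g p < 1"
    and count: "\<And>T. T \<subseteq> (\<Union>j<J. Q j) \<Longrightarrow>
      \<bar>real (card {n\<in>A. T \<subseteq> bad n}) - X * prod g T\<bar> \<le> r ^ card T"
    and b: "\<And>j. even (b j)" and X: "X \<ge> 0" and r: "r \<ge> 0"
    and small: "(\<Sum>j<J. esym (Suc (b j)) g (Q j) / (\<Prod>p\<in>Q j. 1 - g p)) \<le> 1 / 2"
  defines "S \<equiv> real (card {n\<in>A. bad n \<inter> (\<Union>j<J. Q j) = {}})"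
    and "V \<equiv> (\<Prod>p\<in>(\<Union>j<J. Q j). 1 - g p)"
    and "R \<equiv> (\<Prod>j<J. \<Sum>U\<in>Pow (Q j). if card U \<le> Suc (b j) then r ^ card U else 0)"
  shows "S \<le> 2 * X * V + R" and "X * V / 2 - real (Suc J) * R \<le> S"
proof -
  \<comment> \<open>\<open>\<alpha>\<close> gives the truncated sum and \<open>\<beta>\<close> the
    first omitted layer. Both are at most 1 in modulus and vanish on sets of more than
    \<open>Suc (b j)\<close> elements, so the single quantity \<open>R\<close> dominates every
    remainder.\<close>
  define \<alpha> where "\<alpha> j U = (if card U \<le> b j then (-1) ^ card U else (0::real))" for j and U :: "'p set"
  define \<beta> where "\<beta> j U = (if card U = Suc (b j) then (1::real) else 0)" for j and U :: "'p set"
  define v where "v j = (\<Prod>p\<in>Q j. 1 - g p)" for j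
  define y where "y j = trunc_sum (b j) g (Q j)" for j
  define e where "e j = esym (Suc (b j)) g (Q j)" for j
  \<comment> \<open>For a fixed \<open>n\<close>, the same sums with \<open>g = 1\<close> over the
    primes that are bad for \<open>n\<close>: \<open>yn\<close> majorises the indicator
    \<open>xn\<close> of surviving block \<open>j\<close>, with excess at most
    \<open>en\<close>.\<close>
  define yn where "yn n j = trunc_sum (b j) (\<lambda>_. 1) (Q j \<inter> bad n)" for n j
  define en where "en n j = esym (Suc (b j)) (\<lambda>_. 1) (Q j \<inter> bad n)" for n j
  define xn :: "'n \<Rightarrow> nat \<Rightarrow> real" where "xn n j = (if Q j \<inter> bad n = {} then 1 else 0)" for n j
  have yeq: "y j = (\<Sum>U\<in>Pow (Q j). \<alpha> j U * prod g U)" for j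
    by (auto simp: y_def trunc_sum_def \<alpha>_def intro!: sum.cong)
  have eeq: "e j = (\<Sum>U\<in>Pow (Q j). \<beta> j U * prod g U)" for j
    by (auto simp: e_def esym_def \<beta>_def intro!: sum.cong)
  have yneq: "yn n j = (\<Sum>U\<in>Pow (Q j \<inter> bad n). \<alpha> j U)" for n j
    by (auto simp: yn_def trunc_sum_def \<alpha>_def intro!: sum.cong)
  have eneq: "en n j = (\<Sum>U\<in>Pow (Q j \<inter> bad n). \<beta> j U)" for n j
    by (auto simp: en_def esym_def \<beta>_def intro!: sum.cong)
  have V: "V = (\<Prod>j<J. v j)"
  proof -
    have "(\<Union>j<J. Q j) \<inter> Q j = Q j" if "j < J" for j using that by auto
    then show ?thesis unfolding V_def v_def by (subst prod_UN_split[OF fin disj]) auto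
  qed
  have vpos: "0 < v j" if "j < J" for j
    unfolding v_def using g[OF that] by (intro prod_pos) (auto simp: less_eq_real_def)
  have e0: "0 \<le> e j" if "j < J" for j unfolding e_def using g[OF that] by (intro esym_nonneg) auto
  have bonf: "v j \<le> y j" "y j \<le> v j + e j" if "j < J" for j
    using bonferroni[OF fin[OF that], of g "b j"] g[OF that] b[of j]
    by (auto simp: v_def y_def e_def less_imp_le)
  have S: "S = (\<Sum>n\<in>A. \<Prod>j<J. xn n j)"
  proof -
    have "(\<Prod>j<J. xn n j) = (if bad n \<inter> (\<Union>j<J. Q j) = {} then 1 else 0)" for n
    proof (cases "bad n \<inter> (\<Union>j<J. Q j) = {}")
      case True
      then have "xn n j = 1" if "j < J" for j using that by (auto simp: xn_def)
      then show ?thesis using True by simp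
    next
      case False
      then obtain j where "j < J" "Q j \<inter> bad n \<noteq> {}" by auto
      then have "j < J" "xn n j = 0" by (auto simp: xn_def)
      then show ?thesis using False by (auto intro!: prod_zero)
    qed
    then show ?thesis using A by (simp add: S_def sum.If_cases Int_def)
  qed
  have xn: "0 \<le> xn n j" "xn n j \<le> yn n j" "yn n j - xn n j \<le> en n j" if "j < J" for n j
    using trunc_sum_one_bounds[of "Q j \<inter> bad n" "b j"] fin[OF that] b
    by (auto simp: xn_def yn_def en_def)
  have R_le: "(\<Prod>j<J. \<Sum>U\<in>Pow (Q j). \<bar>f j U\<bar> * r ^ card U) \<le> R"
    if "\<And>j. f j = \<alpha> j \<or> f j = \<beta> j" for f
    unfolding R_def
  proof (intro prod_mono conjI sum_nonneg sum_mono)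
    fix j U
    show "\<bar>f j U\<bar> * r ^ card U \<le> (if card U \<le> Suc (b j) then r ^ card U else 0)"
      using that[of j] r by (auto simp: \<alpha>_def \<beta>_def power_abs)
  qed (use r in auto)
  have R0: "0 \<le> R" unfolding R_def using r by (intro prod_nonneg sum_nonneg) auto

  have main: "\<bar>(\<Sum>n\<in>A. \<Prod>j<J. yn n j) - X * (\<Prod>j<J. y j)\<bar> \<le> R"
    using weighted_count[where Q = Q and J = J and f = \<alpha>, OF A fin disj count] R_le[of \<alpha>] unfolding yneq yeq by force
  have err: "\<bar>(\<Sum>n\<in>A. \<Prod>j<J. if j = l then en n j else yn n j)
      - X * (\<Prod>j<J. if j = l then e j else y j)\<bar> \<le> R" for l
  proof -
    define f where "f j = (if j = l then \<beta> j else \<alpha> j)" for j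
    have "(if j = l then en n j else yn n j) = (\<Sum>U\<in>Pow (Q j \<inter> bad n). f j U)" for n j
      by (simp add: f_def eneq yneq)
    moreover have "(if j = l then e j else y j) = (\<Sum>U\<in>Pow (Q j). f j U * prod g U)" for j
      by (simp add: f_def eeq yeq)
    ultimately show ?thesis
      using weighted_count[where Q = Q and J = J and f = f, OF A fin disj count] R_le[of f]
      by (force simp: f_def)
  qed

  have ratio: "(\<Sum>j<J. e j / v j) \<le> 1 / 2" using small by (simp add: e_def v_def)
  have V0: "0 \<le> V" unfolding V using vpos by (intro prod_nonneg) (auto simp: less_imp_le)
  \<comment> \<open>Each \<open>y j\<close> is at most \<open>v j * (1 + e j / v j)\<close>, so the
    relative errors accumulate to at most \<open>exp (1/2)\<close>, which is below 2.\<close>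
  have y_le: "(\<Prod>j<J. y j) \<le> 2 * V"
  proof -
    have "(\<Prod>j<J. y j) \<le> (\<Prod>j<J. v j * exp (e j / v j))"
    proof (intro prod_mono conjI)
      fix j assume "j \<in> {..<J}"
      then have j: "j < J" by simp
      show "0 \<le> y j" using bonf(1)[OF j] vpos[OF j] by linarith
      have "y j \<le> v j * (1 + e j / v j)" using bonf(2)[OF j] vpos[OF j] by (simp add: distrib_left)
      also have "\<dots> \<le> v j * exp (e j / v j)"
        using vpos[OF j] by (intro mult_left_mono) auto
      finally show "y j \<le> v j * exp (e j / v j)" .
    qed
    also have "\<dots> = V * exp (\<Sum>j<J. e j / v j)" by (simp add: prod.distrib V exp_sum)
    also have "\<dots> \<le> V * 2"
    proof (intro mult_left_mono V0)
      have "exp (\<Sum>j<J. e j / v j) \<le> exp (1 / 2)" using ratio by simp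
      also have "\<dots> \<le> 2" using exp_bound_half[of "1/2::real"] by simp
      finally show "exp (\<Sum>j<J. e j / v j) \<le> 2" .
    qed
    finally show ?thesis by simp
  qed
  have y_ge: "V \<le> (\<Prod>j<J. y j)"
    unfolding V using vpos bonf(1) by (intro prod_mono) (auto simp: less_imp_le)
  \<comment> \<open>Replacing factor \<open>l\<close> by its error multiplies the product by at most
    \<open>e l / v l\<close>; summing over \<open>l\<close> costs at most half of the main
    term.\<close>
  have err_le: "(\<Sum>l<J. \<Prod>j<J. if j = l then e j else y j) \<le> (\<Prod>j<J. y j) / 2"
  proof -
    have "(\<Prod>j<J. if j = l then e j else y j) \<le> (\<Prod>j<J. y j) * (e l / v l)" if l: "l < J" for l
    proof -
      have "(\<Prod>j<J. if j = l then e j else y j) = e l * (\<Prod>j\<in>{..<J}-{l}. y j)"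
        using l by (subst prod.remove[of _ l]) (auto intro!: prod.cong)
      also have "\<dots> \<le> (y l * (e l / v l)) * (\<Prod>j\<in>{..<J}-{l}. y j)"
      proof (intro mult_right_mono prod_nonneg)
        show "e l \<le> y l * (e l / v l)"
          using mult_right_mono[OF bonf(1)[OF l] e0[OF l]] vpos[OF l] by (simp add: field_simps)
      qed (use bonf(1) vpos in \<open>force simp: less_imp_le\<close>)
      also have "\<dots> = (\<Prod>j<J. y j) * (e l / v l)"
        using l by (subst (2) prod.remove[of _ l]) auto
      finally show ?thesis .
    qed
    then have "(\<Sum>l<J. \<Prod>j<J. if j = l then e j else y j) \<le> (\<Sum>l<J. (\<Prod>j<J. y j) * (e l / v l))"
      by (intro sum_mono) auto
    also have "\<dots> = (\<Prod>j<J. y j) * (\<Sum>l<J. e l / v l)" by (simp add: sum_distrib_left)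
    also have "\<dots> \<le> (\<Prod>j<J. y j) * (1 / 2)"
      using ratio y_ge V0 by (intro mult_left_mono) auto
    finally show ?thesis by simp
  qed

  show "S \<le> 2 * X * V + R"
  proof -
    have "S \<le> (\<Sum>n\<in>A. \<Prod>j<J. yn n j)"
      unfolding S using xn by (intro sum_mono prod_mono) auto
    also have "\<dots> \<le> X * (\<Prod>j<J. y j) + R" using main by linarith
    also have "X * (\<Prod>j<J. y j) \<le> X * (2 * V)" using y_le X by (intro mult_left_mono) auto
    finally show ?thesis by simp
  qed
  \<comment> \<open>One remainder \<open>R\<close> comes from the main term and one from each of the
    \<open>J\<close> corrections.\<close>
  show "X * V / 2 - real (Suc J) * R \<le> S"
  proof -
    have "S \<ge> (\<Sum>n\<in>A. (\<Prod>j<J. yn n j) - (\<Sum>l<J. \<Prod>j<J. if j = l then en n j else yn n j))"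
      unfolding S by (intro sum_mono prod_telescope_bound) (use xn in auto)
    also have "(\<Sum>n\<in>A. (\<Prod>j<J. yn n j) - (\<Sum>l<J. \<Prod>j<J. if j = l then en n j else yn n j))
       = (\<Sum>n\<in>A. \<Prod>j<J. yn n j) - (\<Sum>l<J. \<Sum>n\<in>A. \<Prod>j<J. if j = l then en n j else yn n j)"
      unfolding sum_subtractf by (subst (2) sum.swap) simp
    finally have 1: "(\<Sum>n\<in>A. \<Prod>j<J. yn n j) - (\<Sum>l<J. \<Sum>n\<in>A. \<Prod>j<J. if j = l then en n j else yn n j) \<le> S" .
    have "(\<Sum>l<J. \<Sum>n\<in>A. \<Prod>j<J. if j = l then en n j else yn n j)
      \<le> (\<Sum>l<J. X * (\<Prod>j<J. if j = l then e j else y j) + R)"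
      using err by (intro sum_mono) (simp add: abs_le_iff algebra_simps)
    also have "\<dots> = X * (\<Sum>l<J. \<Prod>j<J. if j = l then e j else y j) + real J * R"
      by (simp add: sum.distrib sum_distrib_left)
    also have "\<dots> \<le> X * ((\<Prod>j<J. y j) / 2) + real J * R"
      using err_le X by (intro add_mono mult_left_mono) auto
    finally have "X * (\<Prod>j<J. y j) / 2 - real (Suc J) * R \<le> S"
      using 1 main by (simp add: algebra_simps abs_le_iff)
    moreover have "X * V / 2 \<le> X * (\<Prod>j<J. y j) / 2"
      using y_ge X by (simp add: mult_left_mono)
    ultimately show ?thesis by linarith
  qed
qed

section \<open>Chebyshev and Mertens estimates\<close>

definition primes_upto :: "nat \<Rightarrow> nat set" where
  "primes_upto n = {p. prime p \<and> p \<le> n}"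

lemma finite_primes_upto [simp]: "finite (primes_upto n)"
  by (rule finite_subset[of _ "{..n}"]) (auto simp: primes_upto_def)

lemma primes_upto_Suc:
  "primes_upto (Suc n) = (if prime (Suc n) then insert (Suc n) (primes_upto n) else primes_upto n)"
  by (auto simp: primes_upto_def le_Suc_eq)

lemma prod_primes_dvd:
  fixes N :: nat
  assumes "finite Q" "\<And>p. p \<in> Q \<Longrightarrow> prime p \<and> p dvd N"
  shows "\<Prod>Q dvd N"
  using assms
proof (induction Q rule: finite_induct)
  case (insert p Q)
  have "coprime p (\<Prod>Q)"
    by (rule prod_coprime_right) (metis insert.prems insert.hyps(2) insertCI primes_coprime)
  then show ?case using insert by (simp add: divides_mult)
qed simp

text \<open>The two middle coefficients of row \<open>2 * m + 1\<close> are equal and together at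
  most the row sum \<open>2 ^ (2 * m + 1)\<close>.\<close>

lemma binomial_mid_le: "(2 * m + 1) choose m \<le> 4 ^ m"
proof -
  have eq: "(2 * m + 1) choose m = (2 * m + 1) choose (m + 1)"
    by (subst binomial_symmetric) (auto simp: mult_2)
  have "(\<Sum>k\<in>{m, m + 1}. (2 * m + 1) choose k) \<le> (\<Sum>k\<le>2 * m + 1. (2 * m + 1) choose k)"
    by (intro sum_mono2) auto
  then have "2 * ((2 * m + 1) choose m) \<le> 2 ^ (2 * m + 1)"
    using eq by (simp only: choose_row_sum) simp
  then show ?thesis by (simp add: power_mult)
qed

text \<open>Erdos' argument by strong induction. An even \<open>n > 2\<close> adds no prime; for
  \<open>n = 2 * m + 1\<close> the primes in \<open>(m + 1, n]\<close> all divide the middle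
  binomial coefficient, hence multiply to at most \<open>4 ^ m\<close>.\<close>

lemma primorial_le: "\<Prod>(primes_upto n) \<le> 4 ^ n"
proof (induction n rule: less_induct)
  case (less n)
  consider "n \<le> 2" | "n > 2" "even n" | "n > 2" "odd n" by linarith
  then show ?case
  proof cases
    case 1
    then consider "n = 0" | "n = 1" | "n = 2" by linarith
    then show ?thesis
    proof cases
      case 3
      have "primes_upto 2 = {2}"
        by (auto simp: primes_upto_def intro: antisym prime_ge_2_nat)
      then show ?thesis using 3 by simp
    next
      case 2
      have "primes_upto 1 = {}" by (auto simp: primes_upto_def dest: prime_ge_2_nat)
      then show ?thesis using 2 by simp
    next
      case 1
      have "primes_upto 0 = {}" by (auto simp: primes_upto_def)
      then show ?thesis using 1 by simp
    qed
  next
    case 2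
    then have "\<not> prime n" using prime_odd_nat by auto
    moreover obtain m where "n = Suc m" using 2 by (cases n) auto
    ultimately have "primes_upto n = primes_upto m" by (simp add: primes_upto_Suc)
    then have "\<Prod>(primes_upto n) \<le> 4 ^ m" using less.IH[of m] \<open>n = Suc m\<close> by simp
    also have "\<dots> \<le> 4 ^ n" using \<open>n = Suc m\<close> by simp
    finally show ?thesis .
  next
    case 3
    then obtain m where n: "n = 2 * m + 1" using oddE by blast
    with 3 have m: "m \<ge> 1" by simp
    define Q where "Q = {p. prime p \<and> m + 1 < p \<and> p \<le> n}"
    have finQ: "finite Q" by (rule finite_subset[of _ "{..n}"]) (auto simp: Q_def)
    have un: "primes_upto n = primes_upto (m + 1) \<union> Q" "primes_upto (m + 1) \<inter> Q = {}"
      by (auto simp: primes_upto_def Q_def n)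
    have "\<Prod>Q dvd (2 * m + 1) choose m"
    proof (rule prod_primes_dvd[OF finQ])
      fix p assume "p \<in> Q"
      then have p: "prime p" "m + 1 < p" "p \<le> 2 * m + 1" by (auto simp: Q_def n)
      have "fact m * fact (m + 1) * ((2 * m + 1) choose m) = fact (2 * m + 1)"
        using binomial_fact_lemma[of m "2 * m + 1"] by (simp add: mult_2)
      moreover have "p dvd fact (2 * m + 1)" using p by (simp only: prime_dvd_fact_iff)
      moreover have "\<not> p dvd fact m" "\<not> p dvd fact (m + 1)"
        using p by (simp_all only: prime_dvd_fact_iff)
      ultimately show "prime p \<and> p dvd (2 * m + 1) choose m"
        using p(1) by (metis prime_dvd_mult_iff)
    qed
    then have "\<Prod>Q \<le> (2 * m + 1) choose m" by (intro dvd_imp_le) auto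
    also have "\<dots> \<le> 4 ^ m" by (rule binomial_mid_le)
    finally have Q: "\<Prod>Q \<le> 4 ^ m" .
    have "\<Prod>(primes_upto n) = \<Prod>(primes_upto (m + 1)) * \<Prod>Q"
      unfolding un(1) using un(2) finQ by (intro prod.union_disjoint) auto
    also have "\<dots> \<le> 4 ^ (m + 1) * 4 ^ m"
      using less.IH[of "m + 1"] n m Q by (intro mult_mono) auto
    also have "\<dots> = 4 ^ n" by (simp add: n power_add mult_2)
    finally show ?thesis .
  qed
qed

lemma primes_upto_pos: "p \<in> primes_upto n \<Longrightarrow> 0 < p"
  by (auto simp: primes_upto_def prime_gt_0_nat)

lemma sum_ln_primes_le: "(\<Sum>p\<in>primes_upto n. ln (real p)) \<le> real n * ln 4"
proof -
  have "(\<Sum>p\<in>primes_upto n. ln (real p)) = ln (real (\<Prod>(primes_upto n)))"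
    by (simp add: ln_prod primes_upto_pos)
  also have "\<dots> \<le> ln (real (4 ^ n))"
  proof (intro ln_mono)
    show "0 < real (\<Prod>(primes_upto n))" by (simp add: prod_pos primes_upto_pos)
    show "real (\<Prod>(primes_upto n)) \<le> real (4 ^ n)" using primorial_le[of n] by (rule of_nat_mono)
  qed
  also have "\<dots> = real n * ln 4" by (simp add: ln_realpow)
  finally show ?thesis .
qed

text \<open>Count pairs of a prime \<open>p\<close> and a multiple \<open>m <= n\<close> with weight
  \<open>ln p\<close>. The distinct primes dividing \<open>m\<close> multiply to at most
  \<open>n\<close>, so the total is at most \<open>n * ln n\<close>. Replacing
  \<open>n div p\<close> by \<open>n / p - 1\<close> costs the sum of \<open>ln p\<close>, which the
  primorial bound controls.\<close>

lemma sum_ln_prime_div_le: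
  assumes "n \<ge> 1"
  shows "(\<Sum>p\<in>primes_upto n. ln (real p) / real p) \<le> ln (real n) + ln 4"
proof -
  let ?P = "primes_upto n"
  have "(\<Sum>p\<in>?P. ln (real p) * real (n div p)) = (\<Sum>p\<in>?P. \<Sum>m\<in>{1..n}. if p dvd m then ln (real p) else 0)"
  proof (intro sum.cong refl)
    fix p assume "p \<in> ?P"
    then have p: "p > 0" by (rule primes_upto_pos)
    have "{m\<in>{1..n}. p dvd m} = (\<lambda>i. p * i) ` {1..n div p}"
    proof (intro equalityI subsetI)
      fix m assume "m \<in> {m\<in>{1..n}. p dvd m}"
      then obtain i where "m = p * i" "1 \<le> m" "m \<le> n" by auto
      then show "m \<in> (\<lambda>i. p * i) ` {1..n div p}"
        using p by (intro image_eqI[of _ _ i]) (auto simp: less_eq_div_iff_mult_less_eq mult.commute Suc_le_eq)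
    next
      fix m assume "m \<in> (\<lambda>i. p * i) ` {1..n div p}"
      then show "m \<in> {m\<in>{1..n}. p dvd m}"
        using p by (auto simp: less_eq_div_iff_mult_less_eq mult.commute Suc_le_eq)
    qed
    moreover have "inj_on (\<lambda>i. p * i) {1..n div p}" using p by (auto simp: inj_on_def)
    ultimately have "card {m\<in>{1..n}. p dvd m} = n div p" by (simp add: card_image)
    then show "ln (real p) * real (n div p) = (\<Sum>m\<in>{1..n}. if p dvd m then ln (real p) else 0)"
      by (simp add: sum.If_cases Int_def)
  qed
  also have "\<dots> = (\<Sum>m\<in>{1..n}. \<Sum>p\<in>?P. if p dvd m then ln (real p) else 0)"
    by (rule sum.swap)
  also have "\<dots> \<le> (\<Sum>m\<in>{1..n}. ln (real n))"
  proof (rule sum_mono)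
    fix m assume m: "m \<in> {1..n}"
    define Q where "Q = {p\<in>?P. p dvd m}"
    have Q: "finite Q" "\<And>p. p \<in> Q \<Longrightarrow> prime p \<and> p dvd m"
      by (auto simp: Q_def primes_upto_def)
    have pos: "0 < \<Prod>Q" using Q by (intro prod_pos) (auto simp: prime_gt_0_nat)
    have "\<Prod>Q \<le> m" using prod_primes_dvd[OF Q] m by (intro dvd_imp_le) auto
    then have le: "\<Prod>Q \<le> n" using m by simp
    have "(\<Sum>p\<in>?P. if p dvd m then ln (real p) else 0) = (\<Sum>p\<in>Q. ln (real p))"
      by (simp add: sum.If_cases Q_def Int_def)
    also have "\<dots> = ln (real (\<Prod>Q))"
      using Q by (simp add: ln_prod prime_gt_0_nat)
    also have "\<dots> \<le> ln (real n)"
      using pos le by (intro ln_mono) (auto simp del: of_nat_prod)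
    finally show "(\<Sum>p\<in>?P. if p dvd m then ln (real p) else 0) \<le> ln (real n)" .
  qed
  finally have 1: "(\<Sum>p\<in>?P. ln (real p) * real (n div p)) \<le> real n * ln (real n)" by simp
  have "real n * (\<Sum>p\<in>?P. ln (real p) / real p) - (\<Sum>p\<in>?P. ln (real p))
      = (\<Sum>p\<in>?P. ln (real p) * (real n / real p - 1))"
    by (simp add: sum_distrib_left sum_subtractf algebra_simps)
  also have "\<dots> \<le> (\<Sum>p\<in>?P. ln (real p) * real (n div p))"
  proof (intro sum_mono mult_left_mono)
    fix p assume "p \<in> ?P"
    then have p: "p > 0" by (rule primes_upto_pos)
    show "0 \<le> ln (real p)" using p by simp
    show "real n / real p - 1 \<le> real (n div p)"
      using floor_divide_of_nat_eq[of n p, where ?'a = real] by linarith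
  qed
  finally have "real n * (\<Sum>p\<in>?P. ln (real p) / real p) \<le> real n * (ln (real n) + ln 4)"
    using 1 sum_ln_primes_le[of n] by (simp add: algebra_simps)
  then show ?thesis using assms by simp
qed

text \<open>Partial summation as an induction on \<open>?R n - ?A n / ln n\<close>. A new prime
  changes both terms equally, so only the change of the weight \<open>1 / ln n\<close> matters, and
  its increments telescope to \<open>ln (ln n)\<close>. At \<open>n = 2\<close> both sides of the
  inductive claim are 0.\<close>

lemma sum_inverse_primes_le:
  assumes "n \<ge> 2"
  shows "(\<Sum>p\<in>primes_upto n. 1 / real p) \<le> ln (ln (real n)) + (1 - ln (ln 2) + ln 4 / ln 2)"
proof -
  let ?A = "\<lambda>n. (\<Sum>p\<in>primes_upto n. ln (real p) / real p)"
  let ?R = "\<lambda>n. (\<Sum>p\<in>primes_upto n. 1 / real p)"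
  have "?R n - ?A n / ln (real n) \<le> ln (ln (real n)) - ln (ln 2) - ln 4 / ln (real n) + ln 4 / ln 2"
    using assms
  proof (induction n rule: dec_induct)
    case base
    have "primes_upto 2 = {2}"
      by (auto simp: primes_upto_def intro: antisym prime_ge_2_nat)
    then show ?case by simp
  next
    case (step n)
    let ?l = "ln (real n)" and ?m = "ln (real (Suc n))"
    have l: "0 < ?l" "?l < ?m" using step.hyps by auto
    have "?R (Suc n) - ?A (Suc n) / ?m = ?R n - ?A n / ?m"
    proof (cases "prime (Suc n)")
      case True
      have "Suc n \<notin> primes_upto n" by (simp add: primes_upto_def)
      then show ?thesis using True l step.hyps by (simp add: primes_upto_Suc add_divide_distrib)
    qed (simp add: primes_upto_Suc)
    also have "\<dots> = (?R n - ?A n / ?l) + ?A n * (1 / ?l - 1 / ?m)"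
      by (simp add: algebra_simps)
    also have "?A n * (1 / ?l - 1 / ?m) \<le> (?l + ln 4) * (1 / ?l - 1 / ?m)"
      using sum_ln_prime_div_le[of n] step.hyps l
      by (intro mult_right_mono) (auto simp: field_simps)
    also have "\<dots> = ?l * (1 / ?l - 1 / ?m) + ln 4 * (1 / ?l - 1 / ?m)"
      by (rule distrib_right)
    also have "?l * (1 / ?l - 1 / ?m) = 1 - ?l / ?m"
      using l by (simp add: right_diff_distrib)
    also have "1 - ?l / ?m \<le> ln ?m - ln ?l"
    proof -
      have "ln (?l / ?m) \<le> ?l / ?m - 1" using l by (intro ln_le_minus_one divide_pos_pos) linarith+
      moreover have "ln (?l / ?m) = ln ?l - ln ?m" using l by (intro ln_divide_pos) linarith+
      ultimately show ?thesis by linarith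
    qed
    finally show ?case using step.IH by (simp add: algebra_simps)
  qed
  moreover have "?A n / ln (real n) \<le> 1 + ln 4 / ln (real n)"
    using sum_ln_prime_div_le[of n] assms by (simp add: field_simps)
  ultimately show ?thesis by simp
qed

text \<open>Finite form of the Euler product: split \<open>M\<close> according to the exponent of
  \<open>p\<close>. Dividing out that power leaves numbers composed of the other primes, and the
  powers themselves sum to at most a geometric series.\<close>

lemma smooth_harmonic_le:
  fixes Q M :: "nat set"
  assumes "finite Q" "\<And>p. p \<in> Q \<Longrightarrow> prime p"
    and "finite M" "\<And>m. m \<in> M \<Longrightarrow> m > 0" "\<And>m p. m \<in> M \<Longrightarrow> prime p \<Longrightarrow> p dvd m \<Longrightarrow> p \<in> Q"
  shows "(\<Sum>m\<in>M. 1 / real m) \<le> (\<Prod>p\<in>Q. 1 / (1 - 1 / real p))"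
  using assms
proof (induction Q arbitrary: M rule: finite_induct)
  case empty
  have "M \<subseteq> {1}"
  proof
    fix m assume "m \<in> M"
    then show "m \<in> {1}" using empty.prems(4)[of m] prime_factor_nat[of m] by auto
  qed
  then have "(\<Sum>m\<in>M. 1 / real m) \<le> (\<Sum>m\<in>{1}. 1 / real m)"
    by (intro sum_mono2) auto
  then show ?case by simp
next
  case (insert p Q)
  have p: "prime p" "p > 1" using insert.prems(1) prime_gt_1_nat by auto
  let ?F = "\<Prod>p\<in>Q. 1 / (1 - 1 / real p)"
  have F0: "0 \<le> ?F"
    using insert.prems(1) prime_ge_1_nat by (intro prod_nonneg) (auto simp: divide_le_eq_1)
  define E where "E = multiplicity p ` M"
  define N where "N e = (\<lambda>m. m div p ^ e) ` {m\<in>M. multiplicity p m = e}" for e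
  have finE: "finite E" using insert.prems by (simp add: E_def)
  have dvd: "p ^ multiplicity p m dvd m" for m by (rule multiplicity_dvd)
  have "(\<Sum>m\<in>M. 1 / real m) = (\<Sum>e\<in>E. \<Sum>m\<in>{m\<in>M. multiplicity p m = e}. 1 / real m)"
    using insert.prems finE by (intro sum.group[symmetric]) (auto simp: E_def)
  also have "\<dots> \<le> (\<Sum>e\<in>E. (1 / real p) ^ e * ?F)"
  proof (rule sum_mono)
    fix e assume "e \<in> E"
    have inj: "inj_on (\<lambda>m. m div p ^ e) {m\<in>M. multiplicity p m = e}"
    proof (rule inj_onI)
      fix m n assume mn: "m \<in> {m\<in>M. multiplicity p m = e}" "n \<in> {m\<in>M. multiplicity p m = e}"
        and eq: "m div p ^ e = n div p ^ e"
      have "p ^ e dvd m" "p ^ e dvd n" using dvd[of m] dvd[of n] mn by auto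
      then show "m = n" using eq by (metis dvd_div_mult_self)
    qed
    have "(\<Sum>m\<in>{m\<in>M. multiplicity p m = e}. 1 / real m)
        = (\<Sum>m\<in>{m\<in>M. multiplicity p m = e}. (1 / real p) ^ e * (1 / real (m div p ^ e)))"
    proof (intro sum.cong refl)
      fix m assume "m \<in> {m\<in>M. multiplicity p m = e}"
      then have "p ^ e dvd m" using dvd[of m] by auto
      then have "real m = real p ^ e * real (m div p ^ e)"
        by (metis dvd_mult_div_cancel of_nat_mult of_nat_power)
      then show "1 / real m = (1 / real p) ^ e * (1 / real (m div p ^ e))"
        by (simp add: power_one_over)
    qed
    also have "\<dots> = (1 / real p) ^ e * (\<Sum>m\<in>N e. 1 / real m)"
      unfolding N_def using inj by (simp add: sum.reindex sum_distrib_left)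
    also have "\<dots> \<le> (1 / real p) ^ e * ?F"
    proof (intro mult_left_mono insert.IH)
      show "finite (N e)" using insert.prems by (simp add: N_def)
      fix n assume "n \<in> N e"
      then obtain m where m: "m \<in> M" "multiplicity p m = e" "n = m div p ^ e"
        by (auto simp: N_def)
      then have mn: "m = p ^ e * n" using dvd[of m] by auto
      have "m > 0" using m insert.prems by auto
      then show "n > 0" using mn by (cases n) auto
      fix q assume q: "prime q" "q dvd n"
      then have "q \<in> insert p Q" using insert.prems(4)[OF m(1)] mn by auto
      moreover have "\<not> p dvd n"
        using multiplicity_decompose[of m p] m \<open>m > 0\<close> p by auto
      ultimately show "q \<in> Q" using q by auto
    qed (use insert.prems in auto)
    finally show "(\<Sum>m\<in>{m\<in>M. multiplicity p m = e}. 1 / real m) \<le> (1 / real p) ^ e * ?F" .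
  qed
  also have "\<dots> = (\<Sum>e\<in>E. (1 / real p) ^ e) * ?F" by (simp add: sum_distrib_right)
  also have "\<dots> \<le> 1 / (1 - 1 / real p) * ?F"
  proof (intro mult_right_mono F0)
    have "summable (\<lambda>e. (1 / real p) ^ e)" using p by (intro summable_geometric) auto
    then have "(\<Sum>e\<in>E. (1 / real p) ^ e) \<le> (\<Sum>e. (1 / real p) ^ e)"
      using finE by (intro sum_le_suminf) auto
    also have "\<dots> = 1 / (1 - 1 / real p)" using p by (intro suminf_geometric) auto
    finally show "(\<Sum>e\<in>E. (1 / real p) ^ e) \<le> 1 / (1 - 1 / real p)" .
  qed
  finally show ?case using insert.hyps by simp
qed

section \<open>Mertens' product and primes in the block from \<open>sqrt w\<close> to
  \<open>w\<close>\<close>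

definition primes_below :: "real \<Rightarrow> nat set" where
  "primes_below z = {p. prime p \<and> real p < z}"

lemma finite_primes_below [simp]: "finite (primes_below z)"
  by (rule finite_subset[of _ "{..nat \<lceil>z\<rceil>}"]) (auto simp: primes_below_def le_nat_iff, linarith)

lemma primes_below_subset_upto:
  assumes "z > 0" shows "primes_below z \<subseteq> primes_upto (nat \<lfloor>z\<rfloor>)"
  unfolding primes_below_def primes_upto_def using assms by (auto simp: le_nat_floor)

text \<open>Every positive integer below \<open>z\<close> has only prime factors below
  \<open>z\<close>, so the inverse product dominates a harmonic sum. The \<open>n\<close> chosen is
  the largest integer strictly below \<open>z\<close>, so the sum is still at least
  \<open>ln (n + 1) >= ln z\<close>.\<close>

lemma mertens_product_le:
  assumes "z > 1"
  shows "(\<Prod>p\<in>primes_below z. 1 - 1 / real p) \<le> 1 / ln z"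
proof -
  define n where "n = nat (\<lceil>z\<rceil> - 1)"
  have n: "real n < z" "z \<le> real n + 1" using assms unfolding n_def by linarith+
  have "ln z \<le> ln (real n + 1)" using n assms by simp
  also have "\<dots> \<le> (\<Sum>m\<in>{1..n}. 1 / real m)"
    using ln_le_harm[of n] by (simp add: harm_def inverse_eq_divide)
  also have "\<dots> \<le> (\<Prod>p\<in>primes_below z. 1 / (1 - 1 / real p))"
  proof (rule smooth_harmonic_le)
    fix m p assume "m \<in> {1..n}" "prime p" "p dvd m"
    then have "p \<le> n" by (auto dest: dvd_imp_le)
    with n \<open>prime p\<close> show "p \<in> primes_below z" by (auto simp: primes_below_def)
  qed (simp_all, simp add: primes_below_def)
  also have "\<dots> = 1 / (\<Prod>p\<in>primes_below z. 1 - 1 / real p)" by (simp add: prod_dividef)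
  finally have le: "ln z \<le> 1 / (\<Prod>p\<in>primes_below z. 1 - 1 / real p)" .
  have "0 < (\<Prod>p\<in>primes_below z. 1 - 1 / real p)"
    using prime_gt_1_nat by (intro prod_pos) (auto simp: primes_below_def divide_less_eq_1)
  moreover have "ln z > 0" using assms by simp
  ultimately show ?thesis using le by (simp add: field_simps)
qed

lemma sum_inverse_squares_from:
  assumes "n \<ge> 1"
  shows "(\<Sum>m\<in>{n<..N}. 1 / real m ^ 2) \<le> 1 / real n"
proof (cases "n \<le> N")
  case True
  \<comment> \<open>Subtracting \<open>1 / N\<close> makes the claim inductive: each new term is at
    most a difference of consecutive reciprocals.\<close>
  then have "(\<Sum>m\<in>{n<..N}. 1 / real m ^ 2) \<le> 1 / real n - 1 / real N"
  proof (induction N rule: dec_induct)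
    case (step N)
    have "{n<..Suc N} = insert (Suc N) {n<..N}" using step.hyps by auto
    moreover have "1 / real (Suc N) ^ 2 \<le> 1 / real N - 1 / real (Suc N)"
    proof -
      have N: "real N > 0" using step.hyps assms by simp
      have "1 / real (Suc N) ^ 2 \<le> 1 / (real N * real (Suc N))"
        unfolding power2_eq_square using N by (intro divide_left_mono mult_right_mono) auto
      also have "\<dots> = 1 / real N - 1 / real (Suc N)" using N by (simp add: field_simps)
      finally show ?thesis .
    qed
    ultimately show ?case using step.IH by simp
  qed simp
  then show ?thesis by (smt (verit) of_nat_0_le_iff divide_nonneg_nonneg)
qed simp

text \<open>For \<open>p >= 2k\<close> the quotient \<open>t = k/p\<close> is at most 1/2, so
  \<open>ln (1 - t) >= - t - 2 * t^2\<close>; Mertens' sum and the convergent sum of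
  \<open>1/p^2\<close> finish. Allowing any subset \<open>Q\<close> lets the primes of
  \<open>S\<close> be left out without affecting \<open>c\<close>.\<close>

lemma mertens_product_ge:
  assumes "k \<ge> 1"
  obtains c where "0 < c" "\<And>z Q. z \<ge> 2 \<Longrightarrow> Q \<subseteq> primes_below z \<Longrightarrow> (\<And>p. p \<in> Q \<Longrightarrow> 2 * k \<le> p) \<Longrightarrow>
    c / ln z ^ k \<le> (\<Prod>p\<in>Q. 1 - real k / real p)"
proof -
  define M where "M = 1 - ln (ln 2) + ln 4 / ln (2::real)"
  define c where "c = exp (- (real k * M + 2 * real k ^ 2))"
  have "c / ln z ^ k \<le> (\<Prod>p\<in>Q. 1 - real k / real p)"
    if z: "z \<ge> 2" and Q: "Q \<subseteq> primes_below z" and big: "\<And>p. p \<in> Q \<Longrightarrow> 2 * k \<le> p" for z Q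
  proof -
    define n where "n = nat \<lfloor>z\<rfloor>"
    have n: "n \<ge> 2" "real n \<le> z" using z unfolding n_def by linarith+
    have QU: "Q \<subseteq> primes_upto n" using Q primes_below_subset_upto[of z] z by (auto simp: n_def)
    have finQ: "finite Q" using QU finite_primes_upto by (rule finite_subset)
    have "(\<Sum>p\<in>Q. 1 / real p) \<le> (\<Sum>p\<in>primes_upto n. 1 / real p)"
      using QU by (intro sum_mono2) auto
    also have "\<dots> \<le> ln (ln (real n)) + M" using sum_inverse_primes_le[OF n(1)] by (simp add: M_def)
    also have "ln (ln (real n)) \<le> ln (ln z)" using n by simp
    finally have s1: "(\<Sum>p\<in>Q. 1 / real p) \<le> ln (ln z) + M" by simp
    have s2: "(\<Sum>p\<in>Q. 1 / real p ^ 2) \<le> 1"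
    proof -
      have "(\<Sum>p\<in>Q. 1 / real p ^ 2) \<le> (\<Sum>p\<in>{1<..n}. 1 / real p ^ 2)"
        using QU by (intro sum_mono2) (auto simp: primes_upto_def prime_gt_1_nat prime_gt_Suc_0_nat)
      also have "\<dots> \<le> 1" using sum_inverse_squares_from[of 1 n] by simp
      finally show ?thesis .
    qed
    have pos: "0 < 1 - real k / real p \<and> - (real k / real p) - 2 * (real k / real p) ^ 2 \<le> ln (1 - real k / real p)"
      if "p \<in> Q" for p
    proof -
      have "real (2 * k) \<le> real p" using big[OF that] by (rule of_nat_mono)
      then have "real k / real p \<le> 1 / 2" using assms by (simp add: field_simps)
      then show ?thesis
        using ln_one_minus_pos_lower_bound[of "real k / real p"] by (intro conjI) (linarith, simp)
    qed
    have "- (real k * (ln (ln z) + M)) - 2 * real k ^ 2 * 1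
      \<le> - (real k * (\<Sum>p\<in>Q. 1 / real p)) - 2 * real k ^ 2 * (\<Sum>p\<in>Q. 1 / real p ^ 2)"
      using mult_left_mono[OF s1, of "real k"] mult_left_mono[OF s2, of "2 * real k ^ 2"] by simp
    also have "\<dots> = (\<Sum>p\<in>Q. - (real k / real p) - 2 * (real k / real p) ^ 2)"
      by (simp add: sum_subtractf sum_negf sum_distrib_left power_divide)
    also have "\<dots> \<le> (\<Sum>p\<in>Q. ln (1 - real k / real p))"
      using pos by (intro sum_mono) auto
    also have "\<dots> = ln (\<Prod>p\<in>Q. 1 - real k / real p)"
      using conjunct1[OF pos] by (intro ln_prod[symmetric] finQ) (metis less_irrefl)
    finally have "exp (- (real k * (ln (ln z) + M)) - 2 * real k ^ 2 * 1) \<le> (\<Prod>p\<in>Q. 1 - real k / real p)"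
      by (subst ln_ge_iff[symmetric]) (intro prod_pos conjunct1[OF pos])
    moreover have "exp (- (real k * (ln (ln z) + M)) - 2 * real k ^ 2 * 1) = c / ln z ^ k"
    proof -
      have "exp (- (real k * (ln (ln z) + M)) - 2 * real k ^ 2 * 1)
        = c * exp (- (real k * ln (ln z)))"
        unfolding c_def exp_add[symmetric] by (simp add: algebra_simps)
      also have "exp (- (real k * ln (ln z))) = 1 / ln z ^ k"
        using z by (simp add: exp_minus exp_of_nat_mult divide_inverse)
      finally show ?thesis by simp
    qed
    ultimately show ?thesis by simp
  qed
  moreover have "0 < c" by (simp add: c_def)
  ultimately show thesis using that by blast
qed

text \<open>On this block \<open>ln p\<close> is at least half of \<open>ln w\<close>, whereas the
  sum of \<open>ln p / p\<close> is at most \<open>ln w + ln 4 <= 3 * ln w\<close>. A bound free of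
  \<open>w\<close> is what makes repeated square roots the right cutting points for the
  sieve.\<close>

lemma sum_inverse_primes_block_le:
  assumes "w \<ge> 2"
  shows "(\<Sum>p\<in>{p\<in>primes_below w. sqrt w \<le> real p}. 1 / real p) \<le> 6"
proof -
  define n where "n = nat \<lfloor>w\<rfloor>"
  have n: "n \<ge> 2" "real n \<le> w" using assms unfolding n_def by linarith+
  have lw: "ln w > 0" "ln 2 \<le> ln w" using assms by auto
  let ?B = "{p\<in>primes_below w. sqrt w \<le> real p}"
  have "ln w / 2 * (\<Sum>p\<in>?B. 1 / real p) \<le> (\<Sum>p\<in>?B. ln (real p) / real p)"
    unfolding sum_distrib_left
  proof (rule sum_mono)
    fix p assume "p \<in> ?B"
    then have "sqrt w \<le> real p" by simp
    then have "ln (sqrt w) \<le> ln (real p)" using assms by (intro ln_mono) auto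
    then have "ln w / 2 \<le> ln (real p)" using assms by (simp add: ln_sqrt)
    then have "(ln w / 2) / real p \<le> ln (real p) / real p"
      by (rule divide_right_mono) simp
    then show "ln w / 2 * (1 / real p) \<le> ln (real p) / real p" by simp
  qed
  also have "\<dots> \<le> (\<Sum>p\<in>primes_upto n. ln (real p) / real p)"
    using primes_below_subset_upto[of w] assms
    by (intro sum_mono2) (auto simp: n_def primes_upto_def dest!: prime_ge_1_nat intro!: divide_nonneg_nonneg ln_ge_zero)
  also have "\<dots> \<le> ln (real n) + ln 4" using n by (intro sum_ln_prime_div_le) auto
  also have "\<dots> \<le> ln w + 2 * ln w"
  proof -
    have "ln (real n) \<le> ln w" using n by simp
    moreover have "ln (4::real) = 2 * ln 2" using ln_realpow[of 2 2] by simp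
    ultimately show ?thesis using lw by linarith
  qed
  finally show ?thesis using lw by (simp add: field_simps)
qed

text \<open>Primes above \<open>sqrt n\<close> each contribute at least \<open>ln n / 2\<close> to
  the Chebyshev sum, giving the constant 4; the primes up to \<open>sqrt n\<close> are counted
  trivially and give 2.\<close>

lemma prime_count_le:
  assumes "n \<ge> 2"
  shows "real (card (primes_upto n)) \<le> 6 * real n / ln (real n)"
proof -
  define Q where "Q = {p\<in>primes_upto n. sqrt (real n) < real p}"
  define m where "m = nat \<lfloor>sqrt (real n)\<rfloor>"
  have ln0: "ln (real n) > 0" using assms by simp
  have m: "real m \<le> sqrt (real n)" unfolding m_def by simp
  have finQ: "finite Q" by (simp add: Q_def)
  have "primes_upto n \<subseteq> {1..m} \<union> Q"
  proof
    fix p assume p: "p \<in> primes_upto n"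
    then have "prime p" by (simp add: primes_upto_def)
    then have "1 \<le> p" by (rule prime_ge_1_nat)
    with p show "p \<in> {1..m} \<union> Q"
      by (cases "sqrt (real n) < real p") (auto simp: Q_def m_def le_nat_floor)
  qed
  then have "card (primes_upto n) \<le> card ({1..m} \<union> Q)" using finQ by (intro card_mono) auto
  also have "\<dots> \<le> m + card Q" using card_Un_le[of "{1..m}" Q] by simp
  finally have 1: "real (card (primes_upto n)) \<le> real m + real (card Q)"
    by (metis of_nat_add of_nat_mono)
  have "ln (real n) / 2 * real (card Q) = (\<Sum>p\<in>Q. ln (real n) / 2)" by simp
  also have "\<dots> \<le> (\<Sum>p\<in>Q. ln (real p))"
  proof (rule sum_mono)
    fix p assume "p \<in> Q"
    then have "ln (sqrt (real n)) \<le> ln (real p)" using assms by (intro ln_mono) (auto simp: Q_def)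
    then show "ln (real n) / 2 \<le> ln (real p)" using assms by (simp add: ln_sqrt)
  qed
  also have "\<dots> \<le> (\<Sum>p\<in>primes_upto n. ln (real p))"
    by (intro sum_mono2) (auto simp: Q_def primes_upto_def dest: prime_ge_1_nat)
  also have "\<dots> \<le> real n * ln 4" by (rule sum_ln_primes_le)
  also have "\<dots> \<le> real n * 2"
    using ln_realpow[of 2 2] ln_2_less_1 by (intro mult_left_mono) auto
  finally have "ln (real n) / 2 * real (card Q) \<le> real n * 2" by simp
  then have 2: "real (card Q) \<le> 4 * real n / ln (real n)" using ln0 by (simp add: field_simps)
  have 3: "sqrt (real n) \<le> 2 * real n / ln (real n)"
  proof -
    have "ln (sqrt (real n)) \<le> sqrt (real n) - 1" using assms by (intro ln_le_minus_one) auto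
    then have "ln (real n) \<le> 2 * sqrt (real n)" using assms by (simp add: ln_sqrt)
    then have "sqrt (real n) * ln (real n) \<le> sqrt (real n) * (2 * sqrt (real n))" by (intro mult_left_mono) auto
    also have "\<dots> = 2 * real n" by simp
    finally show ?thesis using ln0 by (simp add: pos_le_divide_eq)
  qed
  have "real (card (primes_upto n)) \<le> 2 * real n / ln (real n) + 4 * real n / ln (real n)"
    using 1 2 3 m by linarith
  then show ?thesis by (simp add: add_divide_distrib[symmetric])
qed

section \<open>Sets of primes of small relative upper density\<close>

lemma rel_upper_density_count:
  assumes "rel_upper_density P \<le> ereal \<epsilon>" "\<epsilon> > 0"
  obtains n0 where "\<And>n. n \<ge> n0 \<Longrightarrow> real (card {p \<in> P. 1 \<le> p \<and> p \<le> int n}) \<le> 12 * \<epsilon> * real n / ln (real n)"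
proof -
  let ?f = "\<lambda>n. real (card {p \<in> P. 1 \<le> p \<and> p \<le> int n})"
  let ?\<pi> = "\<lambda>n. real (card {p::nat. prime p \<and> p \<le> n})"
  \<comment> \<open>A limsup of at most \<open>\<epsilon>\<close> bounds the ratio eventually only
    by something larger; \<open>2 * \<epsilon>\<close> is taken, and with Chebyshev's 6 it yields
    12.\<close>
  have "limsup (\<lambda>n. ereal (?f n / ?\<pi> n)) < ereal (2 * \<epsilon>)"
    using assms by (intro order.strict_trans1[OF assms(1)[unfolded rel_upper_density_def]]) auto
  then have "eventually (\<lambda>n. ereal (?f n / ?\<pi> n) < ereal (2 * \<epsilon>)) sequentially"
    by (rule Limsup_lessD)
  then obtain N where N: "\<And>n. n \<ge> N \<Longrightarrow> ?f n / ?\<pi> n < 2 * \<epsilon>"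
    unfolding eventually_sequentially by auto
  show thesis
  proof (rule that[of "max N 2"])
    fix n assume n: "max N 2 \<le> n"
    have \<pi>: "?\<pi> n = real (card (primes_upto n))" by (simp add: primes_upto_def)
    have "2 \<in> primes_upto n" using n by (simp add: primes_upto_def)
    then have "0 < card (primes_upto n)" by (auto simp: card_gt_0_iff)
    then have "?f n \<le> 2 * \<epsilon> * real (card (primes_upto n))"
      using N[of n] n unfolding \<pi> by (simp add: field_simps)
    also have "\<dots> \<le> 2 * \<epsilon> * (6 * real n / ln (real n))"
      using prime_count_le[of n] n assms(2) by (intro mult_left_mono) auto
    finally show "?f n \<le> 12 * \<epsilon> * real n / ln (real n)" by simp
  qed
qed

text \<open>Cut into dyadic blocks. Past the threshold each block contributes at most
  \<open>24 * \<epsilon> / (\<eta> * ln x)\<close>, and at most \<open>4 * ln x\<close> blocks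
  occur, so the logarithms cancel. \<open>P\<close> influences only the threshold \<open>T\<close>,
  not the bound.\<close>

lemma sum_inverse_sparse_primes:
  assumes P: "\<And>p. p \<in> P \<Longrightarrow> prime p" and dens: "rel_upper_density P \<le> ereal \<epsilon>" "\<epsilon> > 0" and \<eta>: "\<eta> > 0"
  obtains T where "\<And>x F. x \<ge> 2 \<Longrightarrow> x powr \<eta> \<ge> T \<Longrightarrow> finite F \<Longrightarrow> int ` F \<subseteq> P \<Longrightarrow>
    (\<And>p. p \<in> F \<Longrightarrow> x powr \<eta> \<le> real p \<and> real p \<le> x) \<Longrightarrow> (\<Sum>p\<in>F. 1 / real p) \<le> 100 * \<epsilon> / \<eta>"
proof -
  obtain n0 where n0: "\<And>n. n \<ge> n0 \<Longrightarrow> real (card {p \<in> P. 1 \<le> p \<and> p \<le> int n}) \<le> 12 * \<epsilon> * real n / ln (real n)"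
    using rel_upper_density_count[OF dens] by blast
  have "(\<Sum>p\<in>F. 1 / real p) \<le> 100 * \<epsilon> / \<eta>"
    if x: "x \<ge> 2" "x powr \<eta> \<ge> real n0" and F: "finite F" "int ` F \<subseteq> P"
      "\<And>p. p \<in> F \<Longrightarrow> x powr \<eta> \<le> real p \<and> real p \<le> x" for x F
  proof -
    define e where "e p = nat \<lfloor>log 2 (real p)\<rfloor>" for p
    have lnx: "ln x > 0" "ln 2 \<le> ln x" using x(1) by auto
    have Fp: "prime p" if "p \<in> F" for p using P[of "int p"] F(2) that by auto
    have e: "2 ^ e p \<le> p" "p < 2 ^ Suc (e p)" if "p \<in> F" for p
    proof -
      have p: "p \<ge> 1" using Fp[OF that] prime_ge_1_nat by blast
      then have "real (e p) = of_int \<lfloor>log 2 (real p)\<rfloor>" by (simp add: e_def)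
      then have "real (e p) \<le> log 2 (real p)" "log 2 (real p) < real (Suc (e p))" by linarith+
      then have "2 powr real (e p) \<le> real p" "real p < 2 powr real (Suc (e p))"
        using p by (simp_all add: le_log_iff log_less_iff)
      then have "real (2 ^ e p) \<le> real p" "real p < real (2 ^ Suc (e p))"
        by (simp_all add: powr_realpow[symmetric] powr_add)
      then show "2 ^ e p \<le> p" "p < 2 ^ Suc (e p)" by (simp_all only: of_nat_le_iff of_nat_less_iff)
    qed
    have block: "(\<Sum>p\<in>{p\<in>F. e p = j}. 1 / real p) \<le> 24 * \<epsilon> / (\<eta> * ln x)" if "j \<in> e ` F" for j
    proof -
      let ?B = "{p\<in>F. e p = j}" and ?n = "2 ^ Suc j :: nat"
      from that obtain p where p: "p \<in> F" "j = e p" by auto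
      have "x powr \<eta> \<le> real p" using F(3) p by auto
      also have "\<dots> \<le> real ?n" using e(2)[OF p(1)] p(2) by (simp only: of_nat_le_iff)
      finally have n: "x powr \<eta> \<le> real ?n" .
      then have "real n0 \<le> real ?n" using x(2) by linarith
      then have "n0 \<le> ?n" by (simp only: of_nat_le_iff)
      have "\<eta> * ln x = ln (x powr \<eta>)" using x(1) by (simp add: ln_powr)
      also have "\<dots> \<le> ln (real ?n)" using n x(1) by (intro ln_mono) auto
      finally have lnn: "\<eta> * ln x \<le> ln (real ?n)" .
      have "(\<Sum>p\<in>?B. 1 / real p) \<le> (\<Sum>p\<in>?B. 1 / 2 ^ j)"
      proof (intro sum_mono divide_left_mono)
        fix q assume "q \<in> ?B"
        then have "2 ^ j \<le> q" using e(1) by auto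
        then have "real (2 ^ j) \<le> real q" by (simp only: of_nat_le_iff)
        then show "2 ^ j \<le> real q" by simp
        show "0 < real q * 2 ^ j" using \<open>2 ^ j \<le> real q\<close> by (smt (verit) mult_pos_pos zero_less_power)
      qed simp
      also have "\<dots> = real (card ?B) / 2 ^ j" by simp
      also have "\<dots> \<le> (12 * \<epsilon> * real ?n / ln (real ?n)) / 2 ^ j"
      proof (intro divide_right_mono)
        have "card ?B = card (int ` ?B)" by (simp add: card_image)
        also have "\<dots> \<le> card {p \<in> P. 1 \<le> p \<and> p \<le> int ?n}"
        proof (intro card_mono subsetI)
          show "finite {p \<in> P. 1 \<le> p \<and> p \<le> int ?n}" by (rule finite_subset[of _ "{1..int ?n}"]) auto
          fix q assume "q \<in> int ` ?B"
          then obtain r where r: "q = int r" "r \<in> F" "e r = j" by auto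
          have "r \<le> ?n" using e(2)[OF r(2)] r(3) by simp
          then have "int r \<le> int ?n" by (simp only: of_nat_le_iff)
          then show "q \<in> {p \<in> P. 1 \<le> p \<and> p \<le> int ?n}"
            using r F(2) Fp[OF r(2)] prime_ge_1_nat[of r] by auto
        qed
        finally have "real (card ?B) \<le> real (card {p \<in> P. 1 \<le> p \<and> p \<le> int ?n})" by (rule of_nat_mono)
        then show "real (card ?B) \<le> 12 * \<epsilon> * real ?n / ln (real ?n)"
          using n0[OF \<open>n0 \<le> ?n\<close>] by linarith
      qed simp
      also have "\<dots> = 24 * \<epsilon> / ln (real ?n)" by simp
      also have "\<dots> \<le> 24 * \<epsilon> / (\<eta> * ln x)"
      proof (intro divide_left_mono lnn)
        have pos: "0 < \<eta> * ln x" using \<eta> lnx by simp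
        show "0 < ln (real ?n) * (\<eta> * ln x)"
          by (rule mult_pos_pos[OF order.strict_trans2[OF pos lnn] pos])
      qed (use dens in simp)
      finally show ?thesis .
    qed
    have "e ` F \<subseteq> {..nat \<lfloor>log 2 x\<rfloor>}"
    proof
      fix j assume "j \<in> e ` F"
      then obtain p where p: "p \<in> F" "j = e p" by auto
      have "log 2 (real p) \<le> log 2 x"
        using F(3)[OF p(1)] prime_gt_0_nat[OF Fp[OF p(1)]] by (intro log_mono) auto
      then show "j \<in> {..nat \<lfloor>log 2 x\<rfloor>}" unfolding p(2) e_def by (auto intro!: nat_mono floor_mono)
    qed
    then have "card (e ` F) \<le> nat \<lfloor>log 2 x\<rfloor> + 1" using card_mono[of "{..nat \<lfloor>log 2 x\<rfloor>}" "e ` F"] by simp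
    moreover have "log 2 x \<ge> 1" using x(1) by (simp add: le_log_iff)
    ultimately have "real (card (e ` F)) \<le> 2 * log 2 x" by linarith
    also have "\<dots> = 2 * (ln x / ln 2)" by (simp add: log_def)
    also have "\<dots> \<le> 2 * (ln x / (1 / 2))"
      using ln2_ge_two_thirds lnx by (intro mult_left_mono divide_left_mono) auto
    finally have card: "real (card (e ` F)) \<le> 4 * ln x" by simp
    have "(\<Sum>p\<in>F. 1 / real p) = (\<Sum>j\<in>e ` F. \<Sum>p\<in>{p\<in>F. e p = j}. 1 / real p)"
      by (rule sum.image_gen[OF F(1)])
    also have "\<dots> \<le> (\<Sum>j\<in>e ` F. 24 * \<epsilon> / (\<eta> * ln x))" by (intro sum_mono block)
    also have "\<dots> = real (card (e ` F)) * (24 * \<epsilon> / (\<eta> * ln x))" by simp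
    also have "\<dots> \<le> 4 * ln x * (24 * \<epsilon> / (\<eta> * ln x))"
      using card dens \<eta> lnx by (intro mult_right_mono) auto
    also have "\<dots> = 96 * \<epsilon> / \<eta>" using lnx by simp
    also have "\<dots> \<le> 100 * \<epsilon> / \<eta>" using dens \<eta> by (intro divide_right_mono mult_right_mono) auto
    finally show ?thesis .
  qed
  then show thesis by (rule that)
qed

section \<open>Residue classes in intervals\<close>

text \<open>The number of classes is kept as a parameter because it serves twice in counting:
  \<open>r / M\<close> is the density and \<open>r\<close> bounds the error.\<close>

definition periodic :: "int \<Rightarrow> nat \<Rightarrow> int set \<Rightarrow> bool" where
  "periodic M r Z \<longleftrightarrow> (\<exists>C\<subseteq>{0..<M}. card C = r \<and> Z = {n. n mod M \<in> C})"

text \<open>By the Chinese remainder theorem, residues modulo \<open>M * N\<close> correspond to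
  pairs of residues, so the class counts multiply.\<close>

lemma periodic_Int:
  assumes "coprime M N" "M > 0" "N > 0" "periodic M r Z" "periodic N t W"
  shows "periodic (M * N) (r * t) (Z \<inter> W)"
proof -
  obtain C where C: "C \<subseteq> {0..<M}" "card C = r" "Z = {n. n mod M \<in> C}"
    using assms(4) by (auto simp: periodic_def)
  obtain D where D: "D \<subseteq> {0..<N}" "card D = t" "W = {n. n mod N \<in> D}"
    using assms(5) by (auto simp: periodic_def)
  define F where "F = {c\<in>{0..<M * N}. c mod M \<in> C \<and> c mod N \<in> D}"
  have "bij_betw (\<lambda>c. (c mod M, c mod N)) F (C \<times> D)"
    unfolding bij_betw_def
  proof
    show "inj_on (\<lambda>c. (c mod M, c mod N)) F"
    proof (rule inj_onI)
      fix c d assume cd: "c \<in> F" "d \<in> F" "(c mod M, c mod N) = (d mod M, d mod N)"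
      then have "[c = d] (mod M)" "[c = d] (mod N)" by (auto simp: cong_def)
      then have "[c = d] (mod M * N)" using assms(1) by (simp add: coprime_cong_mult)
      then show "c = d" using cd(1,2) by (simp add: F_def cong_def)
    qed
    show "(\<lambda>c. (c mod M, c mod N)) ` F = C \<times> D"
    proof (intro equalityI subsetI)
      fix y assume "y \<in> C \<times> D"
      then obtain c d where y: "y = (c, d)" "c \<in> C" "d \<in> D" by auto
      obtain x where x: "[x = c] (mod M)" "[x = d] (mod N)"
        using binary_chinese_remainder_int[OF assms(1)] by blast
      have "c mod M = c" "d mod N = d" using y C(1) D(1) by auto
      moreover have "x mod (M * N) mod M = x mod M" "x mod (M * N) mod N = x mod N"
        by (simp_all add: mod_mod_cancel)
      ultimately have "(x mod (M * N)) mod M = c" "(x mod (M * N)) mod N = d"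
        using x by (auto simp: cong_def)
      moreover from this have "x mod (M * N) \<in> F"
        using y assms(2,3) by (simp add: F_def)
      ultimately show "y \<in> (\<lambda>c. (c mod M, c mod N)) ` F"
        using y by force
    qed (auto simp: F_def)
  qed
  then have "card F = r * t" using C D by (metis bij_betw_same_card card_cartesian_product)
  moreover have "Z \<inter> W = {n. n mod (M * N) \<in> F}"
    using assms(2,3) by (auto simp: C D F_def mod_mod_cancel)
  moreover have "F \<subseteq> {0..<M * N}" by (auto simp: F_def)
  ultimately show ?thesis unfolding periodic_def by blast
qed

lemma card_residue_class:
  assumes "0 \<le> c" "c < M" "x \<ge> 0"
  shows "\<bar>real (card {n\<in>{1..\<lfloor>x\<rfloor>}. n mod M = c}) - x / of_int M\<bar> \<le> 1"
proof -
  \<comment> \<open>The interval starts at 1, so the class of 0 begins with \<open>M\<close> and not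
    with 0.\<close>
  define t0 where "t0 = (if c = 0 then 1 else 0 :: int)"
  have M: "M > 0" using assms by simp
  have dm: "(c + M * t) mod M = c" for t using assms by simp
  have "{n\<in>{1..\<lfloor>x\<rfloor>}. n mod M = c} = (\<lambda>t. c + M * t) ` {t0..(\<lfloor>x\<rfloor> - c) div M}"
  proof (intro equalityI subsetI)
    fix n assume "n \<in> {n\<in>{1..\<lfloor>x\<rfloor>}. n mod M = c}"
    then have n: "1 \<le> n" "n \<le> \<lfloor>x\<rfloor>" "n mod M = c" by auto
    have eq: "n = c + M * (n div M)" using n(3) by (metis add.commute mult_div_mod_eq)
    have "n div M \<ge> 0" using n(1) M by (simp add: pos_imp_zdiv_nonneg_iff)
    moreover have "n div M \<noteq> 0" if "c = 0" using eq n(1) that by auto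
    moreover have "n div M \<le> (\<lfloor>x\<rfloor> - c) div M"
    proof -
      have "n div M = (n - c) div M" using eq M by (metis add_diff_cancel_left' nonzero_mult_div_cancel_left less_irrefl)
      also have "\<dots> \<le> (\<lfloor>x\<rfloor> - c) div M" using n M by (intro zdiv_mono1) auto
      finally show ?thesis .
    qed
    ultimately have "n div M \<in> {t0..(\<lfloor>x\<rfloor> - c) div M}" by (auto simp: t0_def)
    with eq show "n \<in> (\<lambda>t. c + M * t) ` {t0..(\<lfloor>x\<rfloor> - c) div M}" by blast
  next
    fix n assume "n \<in> (\<lambda>t. c + M * t) ` {t0..(\<lfloor>x\<rfloor> - c) div M}"
    then obtain t where t: "n = c + M * t" "t0 \<le> t" "t \<le> (\<lfloor>x\<rfloor> - c) div M"
      by (elim imageE) (simp only: atLeastAtMost_iff)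
    have "M * t \<le> M * ((\<lfloor>x\<rfloor> - c) div M)" using t M by simp
    also have "\<dots> \<le> \<lfloor>x\<rfloor> - c"
      using mult_div_mod_eq[of M "\<lfloor>x\<rfloor> - c"] pos_mod_sign[OF M, of "\<lfloor>x\<rfloor> - c"] by linarith
    finally have "n \<le> \<lfloor>x\<rfloor>" using t by simp
    moreover have "1 \<le> n"
    proof (cases "c = 0")
      case True
      then have "M * 1 \<le> M * t" using t M by (intro mult_left_mono) (auto simp: t0_def)
      then show ?thesis using t(1) True M by linarith
    next
      case False
      then have "0 \<le> M * t" using t M by (simp add: t0_def)
      then show ?thesis using t False assms by simp
    qed
    ultimately show "n \<in> {n\<in>{1..\<lfloor>x\<rfloor>}. n mod M = c}" using t dm by auto
  qed
  moreover have "inj_on (\<lambda>t. c + M * t) S" for S using M by (auto simp: inj_on_def)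
  ultimately have card: "card {n\<in>{1..\<lfloor>x\<rfloor>}. n mod M = c} = nat ((\<lfloor>x\<rfloor> - c) div M - t0 + 1)"
    by (simp add: card_image)
  have fl: "(\<lfloor>x\<rfloor> - c) div M = \<lfloor>(x - of_int c) / of_int M\<rfloor>"
    using M floor_divide_real_eq_div[of M "x - of_int c"] by simp
  \<comment> \<open>Without this \<open>nat\<close> could truncate. In the extreme case of a class
    whose representative exceeds \<open>x\<close>, the quotient is -1 and the count is 0.\<close>
  have "(\<lfloor>x\<rfloor> - c) div M - t0 + 1 \<ge> 0"
  proof (cases "c = 0")
    case True
    then show ?thesis using assms M by (simp add: t0_def pos_imp_zdiv_nonneg_iff)
  next
    case False
    have "0 \<le> \<lfloor>x\<rfloor>" using assms(3) by simp
    then have "- M \<le> \<lfloor>x\<rfloor> - c" using assms(2) by linarith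
    then have "(- M) div M \<le> (\<lfloor>x\<rfloor> - c) div M" using M by (intro zdiv_mono1)
    moreover have "(- M) div M = - 1" using M by (simp add: zdiv_zminus1_eq_if)
    ultimately show ?thesis using False by (simp add: t0_def)
  qed
  then have card': "real (card {n\<in>{1..\<lfloor>x\<rfloor>}. n mod M = c}) = of_int \<lfloor>(x - of_int c) / of_int M\<rfloor> - of_int t0 + 1"
    unfolding card fl by simp
  have cM: "0 \<le> of_int c / (of_int M :: real)" "of_int c / (of_int M :: real) < 1"
    using assms by (auto simp: divide_less_eq)
  have "(x - of_int c) / of_int M = x / of_int M - of_int c / of_int M" by (rule diff_divide_distrib)
  then show ?thesis
    unfolding card' t0_def using cM floor_correct[of "(x - of_int c) / of_int M"]
    by (cases "c = 0") (simp; linarith)+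
qed

lemma card_periodic:
  assumes "periodic M r Z" "M > 0" "x \<ge> 0"
  shows "\<bar>real (card {n\<in>{1..\<lfloor>x\<rfloor>}. n \<in> Z}) - x * real r / of_int M\<bar> \<le> real r"
proof -
  obtain C where C: "C \<subseteq> {0..<M}" "card C = r" "Z = {n. n mod M \<in> C}"
    using assms(1) by (auto simp: periodic_def)
  have finC: "finite C" using C(1) by (rule finite_subset) simp
  have fin: "finite {n\<in>{1..\<lfloor>x\<rfloor>}. n mod M = c}" for c
    by (rule finite_subset[of _ "{1..\<lfloor>x\<rfloor>}"]) auto
  have un: "{n\<in>{1..\<lfloor>x\<rfloor>}. n \<in> Z} = (\<Union>c\<in>C. {n\<in>{1..\<lfloor>x\<rfloor>}. n mod M = c})" by (auto simp: C)
  have "card {n\<in>{1..\<lfloor>x\<rfloor>}. n \<in> Z} = (\<Sum>c\<in>C. card {n\<in>{1..\<lfloor>x\<rfloor>}. n mod M = c})"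
    unfolding un by (rule card_UN_disjoint) (use finC fin in blast)+
  then have "real (card {n\<in>{1..\<lfloor>x\<rfloor>}. n \<in> Z}) - x * real r / of_int M
      = (\<Sum>c\<in>C. real (card {n\<in>{1..\<lfloor>x\<rfloor>}. n mod M = c}) - x / of_int M)"
    using C(2) by (simp add: sum_subtractf)
  also have "\<bar>\<dots>\<bar> \<le> (\<Sum>c\<in>C. 1)"
    by (rule order.trans[OF sum_abs], intro sum_mono card_residue_class) (use C assms in auto)
  finally show ?thesis using C(2) by simp
qed

lemma linear_congruence_iff:
  fixes a b M :: int
  assumes "coprime a M" "M > 0"
  obtains r where "0 \<le> r" "r < M" "\<And>n. M dvd a * n + b \<longleftrightarrow> n mod M = r"
proof -
  obtain u where u: "[a * u = 1] (mod M)" using cong_solve_coprime_int[OF assms(1)] by blast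
  define r where "r = (- b * u) mod M"
  have "M dvd a * n + b \<longleftrightarrow> n mod M = r" for n
  proof -
    have "[a * (- b * u) + b = 0] (mod M)"
    proof -
      have "[- b * (a * u) + b = - b * 1 + b] (mod M)" using u by (intro cong_add cong_mult) auto
      then show ?thesis by (simp add: mult.left_commute)
    qed
    then have "M dvd a * n + b \<longleftrightarrow> [a * n + b = a * (- b * u) + b] (mod M)"
      by (metis cong_0_iff cong_sym cong_trans)
    also have "\<dots> \<longleftrightarrow> [n = - b * u] (mod M)"
      using assms(1) by (simp only: cong_add_rcancel cong_mult_lcancel)
    finally show ?thesis by (simp add: cong_def r_def)
  qed
  moreover have "0 \<le> r" "r < M" using assms(2) by (auto simp: r_def)
  ultimately show thesis using that by blast
qed

lemma periodic_linear:
  assumes "coprime a M" "M > 0"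
  shows "periodic M 1 {n. M dvd a * n + b}"
proof -
  obtain r where "0 \<le> r" "r < M" "\<And>n. M dvd a * n + b \<longleftrightarrow> n mod M = r"
    using linear_congruence_iff[OF assms] by blast
  then show ?thesis unfolding periodic_def by (intro exI[of _ "{r}"]) auto
qed

text \<open>Each form has exactly one root modulo \<open>p\<close>. A root common to two forms would
  make \<open>p\<close> divide their determinant \<open>a i * b j - a j * b i\<close>, so the roots
  are distinct.\<close>

lemma periodic_linforms:
  assumes p: "prime p" and I: "finite I"
    and a: "\<And>i. i \<in> I \<Longrightarrow> \<not> p dvd a i"
    and ab: "\<And>i j. i \<in> I \<Longrightarrow> j \<in> I \<Longrightarrow> i < j \<Longrightarrow> \<not> p dvd a i * b j - a j * b i"
  shows "periodic p (card I) {n. \<exists>i\<in>I. p dvd linform a b i n}"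
proof -
  have p0: "p > 0" using p prime_gt_0_int by blast
  have "\<exists>r. 0 \<le> r \<and> r < p \<and> (\<forall>n. p dvd a i * n + b i \<longleftrightarrow> n mod p = r)" if "i \<in> I" for i
  proof -
    have "coprime (a i) p" using p a[OF that] by (metis coprime_commute prime_imp_coprime)
    then show ?thesis using linear_congruence_iff[of "a i" p "b i"] p0 by metis
  qed
  then obtain r where r: "\<And>i. i \<in> I \<Longrightarrow> 0 \<le> r i \<and> r i < p"
    "\<And>i n. i \<in> I \<Longrightarrow> p dvd a i * n + b i \<longleftrightarrow> n mod p = r i" by metis
  have neq: "r i \<noteq> r j" if "i \<in> I" "j \<in> I" "i < j" for i j
  proof
    assume eq: "r i = r j"
    have "p dvd a i * r i + b i" "p dvd a j * r i + b j"
      using r that eq by auto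
    then have "p dvd a i * (a j * r i + b j) - a j * (a i * r i + b i)" by (intro dvd_diff dvd_mult)
    also have "a i * (a j * r i + b j) - a j * (a i * r i + b i) = a i * b j - a j * b i"
      by (simp add: algebra_simps)
    finally show False using ab[OF that] by contradiction
  qed
  have "inj_on r I" by (rule inj_onI) (metis neq linorder_neqE_nat)
  then have "card (r ` I) = card I" by (rule card_image)
  moreover have "r ` I \<subseteq> {0..<p}" using r(1) by auto
  moreover have "{n. \<exists>i\<in>I. p dvd linform a b i n} = {n. n mod p \<in> r ` I}"
    using r(2) by (auto simp: linform_def)
  ultimately show ?thesis unfolding periodic_def by blast
qed

text \<open>Repeated use of the Chinese remainder theorem. The additional modulus \<open>M\<close>
  carries one side condition: none when \<open>M = 1\<close>, or divisibility of a form by a fixed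
  prime.\<close>

lemma periodic_prime_set:
  assumes "finite T" "periodic M 1 Z" "M > 0"
    and "\<And>p. p \<in> T \<Longrightarrow> prime p \<and> coprime M (int p) \<and> periodic (int p) (c p) (W p)"
  shows "periodic (M * int (\<Prod>T)) (\<Prod>p\<in>T. c p) (Z \<inter> (\<Inter>p\<in>T. W p))"
  using assms(1,4)
proof (induction T rule: finite_induct)
  case empty
  then show ?case using assms(2) by simp
next
  case (insert p T)
  have p: "prime p" "coprime M (int p)" "periodic (int p) (c p) (W p)" using insert.prems by auto
  have "coprime (\<Prod>T) p"
    using insert.hyps insert.prems p(1) by (intro prod_coprime_left) (metis insertCI primes_coprime)
  then have "coprime (int (\<Prod>T)) (int p)" by (simp only: coprime_int_iff)
  then have "coprime (M * int (\<Prod>T)) (int p)" using p(2) by simp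
  moreover have "M * int (\<Prod>T) > 0"
    using assms(3) insert.prems prime_gt_0_nat by (auto intro!: mult_pos_pos prod_pos)
  moreover have "int p > 0" using p(1) prime_gt_0_nat by simp
  ultimately have "periodic (M * int (\<Prod>T) * int p) ((\<Prod>p\<in>T. c p) * c p) ((Z \<inter> (\<Inter>p\<in>T. W p)) \<inter> W p)"
    using insert by (intro periodic_Int) auto
  then show ?case using insert.hyps by (simp add: mult_ac Int_ac)
qed

text \<open>The set \<open>I p\<close> of forms sieved at \<open>p\<close> may vary with
  \<open>p\<close>; this allows sieving by all forms at small primes and by a single form at larger
  ones. The error is the number of residue classes, at most \<open>k\<close> per prime.\<close>

lemma card_sieve_condition:
  assumes T: "finite T" and Z: "periodic M 1 Z" "M > 0" and x: "x \<ge> 0"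
    and p: "\<And>p. p \<in> T \<Longrightarrow> prime p \<and> coprime M (int p) \<and> finite (I p) \<and> card (I p) \<le> k"
    and a: "\<And>p i. p \<in> T \<Longrightarrow> i \<in> I p \<Longrightarrow> \<not> int p dvd a i"
    and ab: "\<And>p i j. p \<in> T \<Longrightarrow> i \<in> I p \<Longrightarrow> j \<in> I p \<Longrightarrow> i < j \<Longrightarrow> \<not> int p dvd a i * b j - a j * b i"
  shows "\<bar>real (card {n\<in>{1..\<lfloor>x\<rfloor>}. n \<in> Z \<and> (\<forall>p\<in>T. \<exists>i\<in>I p. int p dvd linform a b i n)})
      - x / of_int M * (\<Prod>p\<in>T. real (card (I p)) / real p)\<bar> \<le> real k ^ card T"
proof -
  define W where "W p = {n. \<exists>i\<in>I p. int p dvd linform a b i n}" for p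
  have per: "periodic (int p) (card (I p)) (W p)" if "p \<in> T" for p
    unfolding W_def using p[OF that] a[OF that] ab[OF that] by (intro periodic_linforms) auto
  have "periodic (M * int (\<Prod>T)) (\<Prod>p\<in>T. card (I p)) (Z \<inter> (\<Inter>p\<in>T. W p))"
    using T Z p per by (intro periodic_prime_set) auto
  moreover have "M * int (\<Prod>T) > 0"
    using Z p prime_gt_0_nat by (auto intro!: mult_pos_pos prod_pos)
  ultimately have "\<bar>real (card {n\<in>{1..\<lfloor>x\<rfloor>}. n \<in> Z \<inter> (\<Inter>p\<in>T. W p)})
      - x * real (\<Prod>p\<in>T. card (I p)) / of_int (M * int (\<Prod>T))\<bar> \<le> real (\<Prod>p\<in>T. card (I p))"
    by (rule card_periodic[OF _ _ x])
  moreover have "{n\<in>{1..\<lfloor>x\<rfloor>}. n \<in> Z \<inter> (\<Inter>p\<in>T. W p)}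
      = {n\<in>{1..\<lfloor>x\<rfloor>}. n \<in> Z \<and> (\<forall>p\<in>T. \<exists>i\<in>I p. int p dvd linform a b i n)}"
    by (auto simp: W_def)
  moreover have "x * real (\<Prod>p\<in>T. card (I p)) / of_int (M * int (\<Prod>T))
      = x / of_int M * (\<Prod>p\<in>T. real (card (I p)) / real p)"
    by (simp add: prod_dividef)
  moreover have "real (\<Prod>p\<in>T. card (I p)) \<le> real k ^ card T"
  proof -
    have "(\<Prod>p\<in>T. card (I p)) \<le> (\<Prod>p\<in>T. k)" using p by (intro prod_mono) auto
    then show ?thesis by (metis of_nat_mono of_nat_power prod_constant)
  qed
  ultimately show ?thesis by simp
qed

section \<open>A sieve with uniform constants\<close>

text \<open>Bounds one factor of the sieve remainder: sort by size and compare the elementary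
  symmetric sums with the terms of the binomial expansion of
  \<open>(1 + k * card Q) ^ m\<close>.\<close>

lemma sum_bounded_subsets_le:
  assumes "finite Q"
  shows "(\<Sum>U\<in>Pow Q. if card U \<le> m then real k ^ card U else 0) \<le> (1 + real k * real (card Q)) ^ m"
proof -
  let ?t = "real k * real (card Q)"
  have "(\<Sum>U\<in>Pow Q. if card U \<le> m then real k ^ card U else 0)
      = (\<Sum>U\<in>Pow Q. \<Sum>i\<le>m. if card U = i then \<Prod>p\<in>U. real k else 0)"
    by (intro sum.cong refl) (auto simp: sum.delta)
  also have "\<dots> = (\<Sum>i\<le>m. esym i (\<lambda>_. real k) Q)"
    unfolding esym_def by (rule sum.swap)
  also have "\<dots> \<le> (\<Sum>i\<le>m. real (m choose i) * ?t ^ i)"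
  proof (rule sum_mono)
    fix i assume i: "i \<in> {..m}"
    have "esym i (\<lambda>_. real k) Q \<le> ?t ^ i / fact i"
      using esym_le_power[OF assms, of "\<lambda>_. real k" i] by (simp add: mult.commute)
    also have "\<dots> \<le> ?t ^ i / 1" by (intro divide_left_mono) auto
    also have "\<dots> \<le> real (m choose i) * ?t ^ i"
    proof -
      have "1 \<le> m choose i" using i by (simp add: Suc_le_eq)
      then have "1 * ?t ^ i \<le> real (m choose i) * ?t ^ i" by (intro mult_right_mono) auto
      then show ?thesis by simp
    qed
    finally show "esym i (\<lambda>_. real k) Q \<le> real (m choose i) * ?t ^ i" .
  qed
  also have "\<dots> = (1 + ?t) ^ m" by (subst add.commute, subst binomial_ring) simp
  finally show ?thesis .
qed

lemma prod_one_minus_ge_exp: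
  fixes g :: "'p \<Rightarrow> real"
  assumes "\<And>p. p \<in> Q \<Longrightarrow> 0 \<le> g p \<and> g p \<le> 1 / 2"
  shows "exp (- 2 * sum g Q) \<le> (\<Prod>p\<in>Q. 1 - g p)"
\<comment> \<open>For infinite \<open>Q\<close> the sum is 0 and the product 1 by convention, and
  the claim reads \<open>1 <= 1\<close>.\<close>
proof (cases "finite Q")
  case True
  have "exp (- 2 * sum g Q) = (\<Prod>p\<in>Q. exp (- 2 * g p))"
    unfolding sum_distrib_left using True by (rule exp_sum)
  also have "\<dots> \<le> (\<Prod>p\<in>Q. 1 - g p)"
  proof (intro prod_mono conjI)
    fix p assume "p \<in> Q"
    then have g: "0 \<le> g p" "g p \<le> 1 / 2" using assms by auto
    have "g p * g p \<le> g p * (1 / 2)" using g by (intro mult_left_mono)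
    then have "- 2 * g p \<le> - g p - 2 * (g p)\<^sup>2" by (simp add: power2_eq_square)
    also have "\<dots> \<le> ln (1 - g p)" using g by (rule ln_one_minus_pos_lower_bound)
    finally show "exp (- 2 * g p) \<le> 1 - g p" using g by (simp add: ln_ge_iff)
  qed simp
  finally show ?thesis .
qed simp

text \<open>Adds up the exponents of \<open>y\<close> contributed by the blocks; what matters is
  that the total stays below \<open>2 * c + 4\<close> for every \<open>J\<close>.\<close>

lemma sum_arith_geometric:
  "(\<Sum>j<J. (c + 2 * real j) / 2 ^ j) = 2 * c + 4 - (2 * c + 4 + 4 * real J) / 2 ^ J"
proof (induction J)
  case (Suc J)
  show ?case by (simp only: sum.lessThan_Suc Suc power_Suc) (simp add: field_simps)
qed simp

text \<open>Quantifying over all data after \<open>K\<close> expresses the uniformity of the sieve.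
  \<open>E p n\<close> stands for the event that \<open>p\<close> removes \<open>n\<close>, so the
  same \<open>K\<close> serves for different conditions and for progressions.\<close>

definition sieve_constant :: "nat \<Rightarrow> nat \<Rightarrow> bool" where
  "sieve_constant k K \<longleftrightarrow> K \<ge> 1 \<and>
    (\<forall>(P :: nat set) (A :: int set) E g X y. finite A \<and> X \<ge> 0 \<and> y \<ge> 2 \<and>
      (\<forall>p\<in>P. prime p \<and> 2 * k \<le> p \<and> real p < y \<and> 0 \<le> g p \<and> g p \<le> real k / real p) \<and>
      (\<forall>T\<subseteq>P. \<bar>real (card {n\<in>A. \<forall>p\<in>T. E p n}) - X * prod g T\<bar> \<le> real k ^ card T) \<longrightarrow>
      real (card {n\<in>A. \<forall>p\<in>P. \<not> E p n}) \<le> 2 * X * (\<Prod>p\<in>P. 1 - g p) + y ^ K \<and>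
      X * (\<Prod>p\<in>P. 1 - g p) / 2 - y ^ K \<le> real (card {n\<in>A. \<forall>p\<in>P. \<not> E p n}))"

text \<open>The primes below \<open>y\<close> are cut into the blocks \<open>[Y (j+1), Y j)\<close> with \<open>Y j = y powr (1/2^j)\<close>.
  Every block carries a bounded amount of \<open>\<Sum>g\<close>, so allowing \<open>B + 2j\<close> prime factors in the \<open>j\<close>-th
  block makes the total truncation error small while all moduli stay below a fixed power of \<open>y\<close>.\<close>
lemma ex_sieve_constant:
  assumes "k \<ge> 1"
  shows "\<exists>K. sieve_constant k K"
proof -
  \<comment> \<open>Bounds \<open>sum g\<close> over one block: \<open>g p <= k/p\<close>, and the
    reciprocals in a block sum to at most 6.\<close>
  define L where "L = 6 * real k"
  \<comment> \<open>Bounds a relative truncation error: \<open>L ^ m / fact m\<close> for the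
    symmetric sum, \<open>exp (- 2 * L)\<close> from below for the product of
    \<open>1 - g p\<close>.\<close>
  define a where "a m = exp (2 * L) * (L ^ m / fact m)" for m :: nat
  have L0: "L \<ge> 0" by (simp add: L_def)
  have a0: "0 \<le> a m" for m using L0 by (simp add: a_def)
  have "summable a"
    unfolding a_def using summable_exp_generic[of L] by (intro summable_mult) (simp add: field_simps)
  \<comment> \<open>The truncation errors sit at the distinct indices \<open>B + 2 * j + 1\<close>,
    so starting far enough out in a convergent series makes their sum at most 1/2. Doubling
    \<open>N\<close> gives an even \<open>B\<close>, as even truncations are required.\<close>
  then obtain N where N: "\<And>n. n \<ge> N \<Longrightarrow> norm (\<Sum>i. a (i + n)) < 1 / 2"
    using suminf_exist_split[of "1/2" a] by auto
  define B where "B = 2 * N"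
  define b where "b j = B + 2 * j" for j :: nat
  \<comment> \<open>The remainder product accounts for \<open>4 * B + 12\<close>, and the factor
    \<open>Suc J <= y ^ 2\<close> for the remaining 2.\<close>
  define K where "K = 4 * B + 14"
  have tail: "(\<Sum>j<J. a (Suc (b j))) \<le> 1 / 2" for J
  proof -
    have "(\<Sum>j<J. a (Suc (b j))) = (\<Sum>i\<in>(\<lambda>j. Suc (2 * j)) ` {..<J}. a (i + B))"
      by (subst sum.reindex) (auto simp: inj_on_def b_def add_ac)
    also have "\<dots> \<le> (\<Sum>i. a (i + B))"
      using \<open>summable a\<close> a0 by (intro sum_le_suminf) (auto simp: summable_iff_shift)
    also have "\<dots> \<le> 1 / 2" using N[of B] by (simp add: B_def)
    finally show ?thesis .
  qed
  have main: "real (card {n\<in>A. \<forall>p\<in>P. \<not> E p n}) \<le> 2 * X * (\<Prod>p\<in>P. 1 - g p) + y ^ K \<and>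
      X * (\<Prod>p\<in>P. 1 - g p) / 2 - y ^ K \<le> real (card {n\<in>A. \<forall>p\<in>P. \<not> E p n})"
    if A: "finite A" and X: "X \<ge> 0" and y: "y \<ge> 2"
      and P: "\<And>p. p \<in> P \<Longrightarrow> prime p \<and> 2 * k \<le> p \<and> real p < y \<and> 0 \<le> g p \<and> g p \<le> real k / real p"
      and count: "\<And>T. T \<subseteq> P \<Longrightarrow> \<bar>real (card {n\<in>A. \<forall>p\<in>T. E p n}) - X * prod g T\<bar> \<le> real k ^ card T"
    for P :: "nat set" and A :: "int set" and E g X y
  proof -
    define Y where "Y j = y powr (1 / 2 ^ j)" for j :: nat
    define Q where "Q j = {p\<in>P. Y (Suc j) \<le> real p \<and> real p < Y j}" for j
    \<comment> \<open>More blocks than needed: \<open>y <= 2 ^ (2 ^ J)\<close>, so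
      \<open>Y J <= 2\<close> and the blocks reach below every prime.\<close>
    define J where "J = nat \<lceil>y\<rceil>"
    have J: "y \<le> real J" "real J < y + 1" "J \<ge> 1" using y unfolding J_def by linarith+
    have Y1: "1 \<le> Y j" for j using y by (simp add: Y_def ge_one_powr_ge_zero)
    have Ysq: "Y (Suc j) = sqrt (Y j)" for j
      using y by (simp add: Y_def powr_half_sqrt[symmetric] powr_powr mult.commute)
    have Ymono: "Y j \<le> Y i" if "i \<le> j" for i j
      unfolding Y_def using y that by (intro powr_mono) (auto intro!: divide_left_mono power_increasing)
    have YJ: "Y J \<le> 2"
    proof -
      have "y \<le> real J" by (rule J)
      also have "\<dots> \<le> 2 ^ J" by (simp add: less_imp_le)
      also have "\<dots> \<le> 2 ^ (2 ^ J)" by (intro power_increasing) (auto simp: less_imp_le)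
      finally have "y \<le> 2 powr (2 ^ J)" by (simp add: powr_realpow[symmetric])
      then have "Y J \<le> (2 powr (2 ^ J)) powr (1 / 2 ^ J)"
        unfolding Y_def using y by (intro powr_mono2) auto
      then show ?thesis by (simp add: powr_powr)
    qed
    have finP: "finite P" by (rule finite_subset[OF _ finite_primes_below[of y]]) (use P in \<open>auto simp: primes_below_def\<close>)
    have finQ: "finite (Q j)" for j using finP by (simp add: Q_def)
    have disj: "Q i \<inter> Q j = {}" if "i < j" for i j
      using Ymono[of "Suc i" j] that by (fastforce simp: Q_def)
    have PQ: "(\<Union>j<J. Q j) = P"
    proof (intro equalityI subsetI)
      fix p assume p: "p \<in> P"
      then have p2: "2 \<le> real p" "real p < y" using P[OF p] prime_ge_2_nat[of p] by auto
      define j where "j = (LEAST j. Y (Suc j) \<le> real p)"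
      have ex: "Y (Suc (J - 1)) \<le> real p" using YJ J(3) p2 by simp
      have j: "Y (Suc j) \<le> real p" "j \<le> J - 1"
        unfolding j_def using ex by (auto intro: LeastI Least_le)
      have "real p < Y j"
      proof (cases j)
        case 0
        then show ?thesis using p2 y by (simp add: Y_def)
      next
        case (Suc i)
        then have "\<not> Y (Suc i) \<le> real p" using not_less_Least[of i "\<lambda>j. Y (Suc j) \<le> real p"] j_def by auto
        then show ?thesis using Suc by simp
      qed
      then have "p \<in> Q j" "j < J" using p j J(3) by (auto simp: Q_def)
      then show "p \<in> (\<Union>j<J. Q j)" by blast
    qed (auto simp: Q_def)
    have g: "0 \<le> g p \<and> g p \<le> 1 / 2" if "p \<in> P" for p
    proof -
      have "real (2 * k) \<le> real p" using P[OF that] by (intro of_nat_mono) auto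
      then have "real k / real p \<le> 1 / 2" using assms by (simp add: field_simps)
      moreover have "0 \<le> g p" "g p \<le> real k / real p" using P[OF that] by auto
      ultimately show ?thesis by linarith
    qed
    have gsum: "sum g (Q j) \<le> L" for j
    proof (cases "Q j = {}")
      case False
      then obtain p where "p \<in> Q j" by auto
      then have "2 \<le> Y j" using P[of p] prime_ge_2_nat[of p] by (auto simp: Q_def)
      then have "(\<Sum>p\<in>{p\<in>primes_below (Y j). sqrt (Y j) \<le> real p}. 1 / real p) \<le> 6"
        by (rule sum_inverse_primes_block_le)
      moreover have "(\<Sum>p\<in>Q j. 1 / real p) \<le> (\<Sum>p\<in>{p\<in>primes_below (Y j). sqrt (Y j) \<le> real p}. 1 / real p)"
      proof (rule sum_mono2)
        show "Q j \<subseteq> {p\<in>primes_below (Y j). sqrt (Y j) \<le> real p}"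
          by (auto simp: Q_def primes_below_def Ysq P)
      qed simp_all
      ultimately have "(\<Sum>p\<in>Q j. 1 / real p) \<le> 6" by linarith
      have "sum g (Q j) \<le> (\<Sum>p\<in>Q j. real k * (1 / real p))"
        using P by (intro sum_mono) (auto simp: Q_def)
      also have "\<dots> \<le> real k * 6"
        unfolding sum_distrib_left[symmetric] using \<open>(\<Sum>p\<in>Q j. 1 / real p) \<le> 6\<close> by (intro mult_left_mono) auto
      finally show ?thesis by (simp add: L_def)
    qed (simp add: L0)
    have small: "(\<Sum>j<J. esym (Suc (b j)) g (Q j) / (\<Prod>p\<in>Q j. 1 - g p)) \<le> 1 / 2"
    proof -
      have "esym (Suc (b j)) g (Q j) / (\<Prod>p\<in>Q j. 1 - g p) \<le> a (Suc (b j))" for j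
      proof -
        have gQ: "0 \<le> g p \<and> g p \<le> 1 / 2" if "p \<in> Q j" for p using g that by (auto simp: Q_def)
        have v: "exp (- 2 * L) \<le> (\<Prod>p\<in>Q j. 1 - g p)"
        proof -
          have "exp (- 2 * L) \<le> exp (- 2 * sum g (Q j))" using gsum[of j] by simp
          also have "\<dots> \<le> (\<Prod>p\<in>Q j. 1 - g p)" by (rule prod_one_minus_ge_exp[OF gQ])
          finally show ?thesis .
        qed
        have "esym (Suc (b j)) g (Q j) \<le> sum g (Q j) ^ Suc (b j) / fact (Suc (b j))"
          using gQ by (intro esym_le_power finQ) auto
        also have "\<dots> \<le> L ^ Suc (b j) / fact (Suc (b j))"
          using gsum[of j] gQ by (intro divide_right_mono power_mono sum_nonneg) auto
        finally have "esym (Suc (b j)) g (Q j) / (\<Prod>p\<in>Q j. 1 - g p)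
            \<le> (L ^ Suc (b j) / fact (Suc (b j))) / exp (- 2 * L)"
          using v gQ L0 by (intro frac_le esym_nonneg) auto
        also have "\<dots> = a (Suc (b j))" by (simp add: a_def exp_minus divide_inverse)
        finally show ?thesis .
      qed
      then have "(\<Sum>j<J. esym (Suc (b j)) g (Q j) / (\<Prod>p\<in>Q j. 1 - g p)) \<le> (\<Sum>j<J. a (Suc (b j)))"
        by (intro sum_mono)
      then show ?thesis using tail[of J] by linarith
    qed
    define R where "R = (\<Prod>j<J. \<Sum>U\<in>Pow (Q j). if card U \<le> Suc (b j) then real k ^ card U else 0)"
    have R0: "0 \<le> R" unfolding R_def by (intro prod_nonneg sum_nonneg) auto
    have R: "R \<le> y ^ (4 * B + 12)"
    proof -
      have "R \<le> (\<Prod>j<J. y powr (2 * ((real B + 1 + 2 * real j) / 2 ^ j)))"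
        unfolding R_def
      proof (intro prod_mono conjI sum_nonneg)
        fix j
        \<comment> \<open>Any prime in the block is at least \<open>2 * k\<close>, so a nonempty
          block forces \<open>k <= Y j / 2\<close>; thus \<open>k\<close> is absorbed and does not
          reappear as a constant factor in every block.\<close>
        have "1 + real k * real (card (Q j)) \<le> Y j ^ 2"
        proof (cases "Q j = {}")
          case True
          then show ?thesis using Y1[of j] by simp
        next
          case False
          then obtain p where p: "p \<in> Q j" by auto
          have p2: "2 \<le> p" "2 * k \<le> p" "real p < Y j" using p P[of p] prime_ge_2_nat[of p] by (auto simp: Q_def)
          have "real (2 * k) \<le> real p" using p2 by (intro of_nat_mono)
          then have k: "real k \<le> Y j / 2" using p2 by simp
          have "Q j \<subseteq> {1..<nat \<lceil>Y j\<rceil>}"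
          proof
            fix q assume "q \<in> Q j"
            then have "2 \<le> q" "real q < Y j" using P[of q] prime_ge_2_nat[of q] by (auto simp: Q_def)
            then show "q \<in> {1..<nat \<lceil>Y j\<rceil>}" by (auto simp: less_ceiling_iff zless_nat_eq_int_zless)
          qed
          then have "card (Q j) \<le> nat \<lceil>Y j\<rceil> - 1" using card_mono[of "{1..<nat \<lceil>Y j\<rceil>}" "Q j"] by simp
          then have c: "real (card (Q j)) \<le> Y j" using Y1[of j] by linarith
          have "real k * real (card (Q j)) \<le> (Y j / 2) * Y j"
            using k c Y1[of j] by (intro mult_mono) auto
          moreover have "2 * 2 \<le> Y j * Y j" using p2 by (intro mult_mono) auto
          ultimately show ?thesis by (simp add: power2_eq_square)
        qed
        then have "(1 + real k * real (card (Q j))) ^ Suc (b j) \<le> (Y j ^ 2) ^ Suc (b j)"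
          by (intro power_mono) auto
        also have "\<dots> = Y j ^ (2 * Suc (b j))" by (simp only: power_mult)
        also have "\<dots> = Y j powr real (2 * Suc (b j))"
          using Y1[of j] by (intro powr_realpow[symmetric]) linarith
        also have "\<dots> = y powr (2 * ((real B + 1 + 2 * real j) / 2 ^ j))"
          unfolding Y_def powr_powr by (rule arg_cong[where f = "\<lambda>t. y powr t"]) (simp add: b_def field_simps)
        finally show "(\<Sum>U\<in>Pow (Q j). if card U \<le> Suc (b j) then real k ^ card U else 0)
            \<le> y powr (2 * ((real B + 1 + 2 * real j) / 2 ^ j))"
          using sum_bounded_subsets_le[OF finQ, of "Suc (b j)" k j] by linarith
      qed auto
      also have "\<dots> = y powr (\<Sum>j<J. 2 * ((real B + 1 + 2 * real j) / 2 ^ j))"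
        using y by (simp add: powr_sum)
      \<comment> \<open>The exponents decay like \<open>j / 2 ^ j\<close>, so the growing truncation
        levels still give a bounded total, namely \<open>2 * (2 * (B + 1) + 4)\<close>.\<close>
      also have "\<dots> \<le> y powr real (4 * B + 12)"
      proof (intro powr_mono)
        have "(\<Sum>j<J. (real B + 1 + 2 * real j) / 2 ^ j) \<le> 2 * (real B + 1) + 4"
          unfolding sum_arith_geometric by simp
        then show "(\<Sum>j<J. 2 * ((real B + 1 + 2 * real j) / 2 ^ j)) \<le> real (4 * B + 12)"
          unfolding sum_distrib_left[symmetric] by simp
      qed (use y in auto)
      also have "\<dots> = y ^ (4 * B + 12)" using y by (intro powr_realpow) auto
      finally show ?thesis .
    qed
    have JR: "real (Suc J) * R \<le> y ^ K"
    proof -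
      have "2 * y \<le> y * y" using y by (intro mult_right_mono) auto
      moreover have "real (Suc J) \<le> 2 * y" using J y by simp
      ultimately have "real (Suc J) \<le> y ^ 2" unfolding power2_eq_square by linarith
      then have "real (Suc J) * R \<le> y ^ 2 * y ^ (4 * B + 12)" using R R0 by (intro mult_mono) auto
      also have "\<dots> = y ^ K" by (simp add: K_def power_add[symmetric] add.commute)
      finally show ?thesis .
    qed
    have "R \<le> real (Suc J) * R" using R0 by (simp add: distrib_right)
    with JR have R': "R \<le> y ^ K" by linarith
    define bad where "bad n = {p. E p n}" for n
    have "\<bar>real (card {n\<in>A. T \<subseteq> bad n}) - X * prod g T\<bar> \<le> real k ^ card T" if "T \<subseteq> (\<Union>j<J. Q j)" for T
    proof -
      have "{n\<in>A. T \<subseteq> bad n} = {n\<in>A. \<forall>p\<in>T. E p n}" by (auto simp: bad_def)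
      then show ?thesis using count[of T] that PQ by simp
    qed
    note BH = brun_hooley[where Q = Q and J = J and b = b and g = g and bad = bad, OF A finQ disj _ this _ X _ small]
    have "{n\<in>A. bad n \<inter> (\<Union>j<J. Q j) = {}} = {n\<in>A. \<forall>p\<in>P. \<not> E p n}"
      unfolding PQ by (auto simp: bad_def)
    moreover have "0 \<le> g p \<and> g p < 1" if "p \<in> Q j" for j p
      using g[of p] that by (auto simp: Q_def)
    moreover have "even (b j)" for j by (simp add: b_def B_def)
    ultimately have
      "real (card {n\<in>A. \<forall>p\<in>P. \<not> E p n}) \<le> 2 * X * (\<Prod>p\<in>P. 1 - g p) + R"
      "X * (\<Prod>p\<in>P. 1 - g p) / 2 - real (Suc J) * R \<le> real (card {n\<in>A. \<forall>p\<in>P. \<not> E p n})"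
      using BH unfolding R_def PQ by simp_all
    then show ?thesis using R' JR by linarith
  qed
  have "sieve_constant k K"
    unfolding sieve_constant_def by (intro conjI[OF _ allI] allI impI; (elim conjE)?)
      (simp add: K_def, rule main, blast+)
  then show ?thesis ..
qed

section \<open>Sieving the linear forms\<close>

lemma eventually_power_ln_le_sqrt:
  "eventually (\<lambda>x. C * ln x ^ k \<le> sqrt x) at_top" 
proof -
  \<comment> \<open>With \<open>s * k <= 1/4\<close>, the bound \<open>ln x <= x powr s / s\<close>
    leaves a factor \<open>x powr (1/4)\<close> to absorb the constant.\<close>
  define s where "s = 1 / (4 * real (Suc k))"
  have s: "s > 0" "s * real k \<le> 1 / 4" by (auto simp: s_def field_simps)
  have "eventually (\<lambda>x. \<bar>C\<bar> / s ^ k * x powr (1 / 4) \<le> x powr (1 / 2)) at_top"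
    by real_asymp
  then show ?thesis
    using eventually_ge_at_top[of 1]
  proof eventually_elim
    case (elim x)
    have "C * ln x ^ k \<le> \<bar>C\<bar> * (x powr s / s) ^ k"
      using elim s ln_powr_bound[of x s]
      by (intro mult_mono power_mono) auto
    also have "\<dots> = \<bar>C\<bar> / s ^ k * x powr (s * real k)"
      using elim by (simp add: power_divide powr_powr[symmetric] powr_realpow)
    also have "\<dots> \<le> \<bar>C\<bar> / s ^ k * x powr (1 / 4)"
      using elim s by (intro mult_left_mono powr_mono) auto
    also have "\<dots> \<le> sqrt x" using elim by (simp add: powr_half_sqrt)
    finally show ?case .
  qed
qed

text \<open>Fixes only data that may influence thresholds (and \<open>card S\<close>). The constants
  \<open>K\<close>, \<open>c\<close>, \<open>d\<close>, \<open>\<eta>\<close> enter the lemmas as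
  variables chosen outside, which keeps them independent of the forms.\<close>

locale linear_forms =
  fixes S :: "int set" and k :: nat and a b :: "nat \<Rightarrow> int"
  assumes finite_S: "finite S" and prime_S: "\<And>p. p \<in> S \<Longrightarrow> prime p" and k_pos: "k \<ge> 1"
    and a_nz: "\<And>i. i \<in> {1..k} \<Longrightarrow> a i \<noteq> 0"
    and coprime_ab: "\<And>i. i \<in> {1..k} \<Longrightarrow> coprime (a i) (b i)"
    and unit: "sigma_unit S (int (fact (2*k)) * (\<Prod>i\<in>{1..k}. a i) *
          (\<Prod>(i,j)\<in>{(i,j). i \<in> {1..k} \<and> j \<in> {1..k} \<and> i < j}. a i * b j - a j * b i))"
    and S_dvd: "\<And>i p. i \<in> {1..k} \<Longrightarrow> p \<in> S \<Longrightarrow> p dvd a i"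
begin

abbreviation L where "L \<equiv> linform a b"

text \<open>A prime outside \<open>S\<close> divides no factor of the \<open>S\<close>-unit. The
  factorial yields \<open>2 * k <= p\<close>, the other factors yield invertible leading
  coefficients and distinct roots.\<close>

lemma outside_S:
  assumes "prime p" "int p \<notin> S"
  shows "2 * k \<le> p" "i \<in> {1..k} \<Longrightarrow> \<not> int p dvd a i"
    "i \<in> {1..k} \<Longrightarrow> j \<in> {1..k} \<Longrightarrow> i < j \<Longrightarrow> \<not> int p dvd a i * b j - a j * b i"
proof -
  let ?D = "{(i,j). i \<in> {1..k} \<and> j \<in> {1..k} \<and> i < j}"
  have nd: "\<not> int p dvd int (fact (2*k)) * (\<Prod>i\<in>{1..k}. a i) * (\<Prod>(i,j)\<in>?D. a i * b j - a j * b i)"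
    using unit assms by (auto simp: sigma_unit_def)
  have fin: "finite ?D" by (rule finite_subset[of _ "{1..k} \<times> {1..k}"]) auto
  have "\<not> int p dvd int (fact (2*k))" using nd by auto
  then have "\<not> p dvd fact (2 * k)" using int_dvd_int_iff by blast
  then show "2 * k \<le> p" using assms(1) by (simp add: prime_dvd_fact_iff)
  show "\<not> int p dvd a i" if "i \<in> {1..k}"
  proof
    assume "int p dvd a i"
    also have "a i dvd (\<Prod>i\<in>{1..k}. a i)" using that by (intro dvd_prodI) auto
    finally show False using nd by auto
  qed
  show "\<not> int p dvd a i * b j - a j * b i" if "i \<in> {1..k}" "j \<in> {1..k}" "i < j"
  proof
    assume "int p dvd a i * b j - a j * b i"
    also have "\<dots> = (\<lambda>(i,j). a i * b j - a j * b i) (i, j)" by simp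
    also have "\<dots> dvd (\<Prod>(i,j)\<in>?D. a i * b j - a j * b i)" using that fin by (intro dvd_prodI) auto
    finally show False using nd by auto
  qed
qed

lemma not_dvd_S:
  assumes "p \<in> S" "i \<in> {1..k}"
  shows "\<not> p dvd L i n"
proof
  assume "p dvd L i n"
  moreover have "p dvd a i * n" using S_dvd assms by simp
  ultimately have "p dvd b i" unfolding linform_def by (metis dvd_add_right_iff)
  then have "is_unit p" using coprime_ab[OF assms(2)] S_dvd[OF assms(2,1)] coprime_common_divisor by blast
  then show False using prime_S[OF assms(1)] not_prime_unit by blast
qed

section \<open>The sifting primes and the density of the sifted set\<close>

definition sift :: "real \<Rightarrow> nat set" where
  "sift z = {p\<in>primes_below z. int p \<notin> S}"

lemma finite_sift [simp]: "finite (sift z)"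
  by (simp add: sift_def)

lemma sift_iff: "p \<in> sift z \<longleftrightarrow> prime p \<and> real p < z \<and> int p \<notin> S"
  by (auto simp: sift_def primes_below_def)

lemma Omega_iff:
  "n \<in> Omega S k a b x z \<longleftrightarrow> n \<in> {1..\<lfloor>x\<rfloor>} \<and> (\<forall>p\<in>sift z. \<forall>i\<in>{1..k}. \<not> int p dvd L i n)"
proof -
  have set_eq: "{p::int. prime p \<and> real_of_int p < z \<and> p \<notin> S} = int ` sift z"
  proof (intro equalityI subsetI)
    fix p :: int assume p: "p \<in> {p::int. prime p \<and> real_of_int p < z \<and> p \<notin> S}"
    then obtain q where "p = int q" using prime_ge_0_int[of p] zero_le_imp_eq_int by blast
    with p show "p \<in> int ` sift z" by (auto simp: sift_iff)
  qed (auto simp: sift_iff)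
  have "coprime (\<Prod>i\<in>{1..k}. L i n) (P_Sigma S z)
      \<longleftrightarrow> (\<forall>p\<in>sift z. coprime (\<Prod>i\<in>{1..k}. L i n) (int p))"
    unfolding P_Sigma_def set_eq
  proof
    assume c: "coprime (\<Prod>i\<in>{1..k}. L i n) (\<Prod>p\<in>int ` sift z. p)"
    show "\<forall>p\<in>sift z. coprime (\<Prod>i\<in>{1..k}. L i n) (int p)"
    proof
      fix p assume "p \<in> sift z"
      then have "int p dvd (\<Prod>p\<in>int ` sift z. p)" by (intro dvd_prodI) auto
      then show "coprime (\<Prod>i\<in>{1..k}. L i n) (int p)" by (rule coprime_divisors[OF dvd_refl _ c])
    qed
  qed (auto intro: prod_coprime_right)
  also have "\<dots> \<longleftrightarrow> (\<forall>p\<in>sift z. \<forall>i\<in>{1..k}. \<not> int p dvd L i n)"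
  proof (intro ball_cong refl)
    fix p assume "p \<in> sift z"
    then have "prime (int p)" by (simp add: sift_iff)
    then have "coprime (\<Prod>i\<in>{1..k}. L i n) (int p) \<longleftrightarrow> \<not> int p dvd (\<Prod>i\<in>{1..k}. L i n)"
      using prime_imp_coprime coprime_commute coprime_absorb_left not_prime_unit by metis
    also have "\<dots> \<longleftrightarrow> (\<forall>i\<in>{1..k}. \<not> int p dvd L i n)"
      using \<open>prime (int p)\<close> by (simp add: prime_dvd_prod_iff)
    finally show "coprime (\<Prod>i\<in>{1..k}. L i n) (int p) \<longleftrightarrow> (\<forall>i\<in>{1..k}. \<not> int p dvd L i n)" .
  qed
  finally show ?thesis by (auto simp: Omega_def le_floor_iff)
qed

lemma finite_Omega [simp]: "finite (Omega S k a b x z)"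
  by (rule finite_subset[of _ "{1..\<lfloor>x\<rfloor>}"]) (auto simp: Omega_iff)

text \<open>Serves three situations: all forms with \<open>M = 1\<close>, for \<open>Omega\<close>;
  a single form at the larger primes, for prime values; and \<open>M\<close> equal to a prime
  divisor of one value.\<close>

lemma sifted_bounds:
  assumes K: "sieve_constant k K" and Z: "periodic M 1 Z" "M > 0" and x: "x \<ge> 0" and y: "y \<ge> 2"
    and P: "P \<subseteq> sift y" and cop: "\<And>p. p \<in> P \<Longrightarrow> coprime M (int p)"
    and I: "\<And>p. p \<in> P \<Longrightarrow> I p \<subseteq> {1..k}"
  defines "N \<equiv> real (card {n\<in>{1..\<lfloor>x\<rfloor>}. n \<in> Z \<and> (\<forall>p\<in>P. \<forall>i\<in>I p. \<not> int p dvd L i n)})"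
    and "V \<equiv> (\<Prod>p\<in>P. 1 - real (card (I p)) / real p)"
  shows "N \<le> 2 * (x / M) * V + y ^ K" "x / M * V / 2 - y ^ K \<le> N"
proof -
  define A where "A = {n\<in>{1..\<lfloor>x\<rfloor>}. n \<in> Z}"
  define E where "E p n \<longleftrightarrow> (\<exists>i\<in>I p. int p dvd L i n)" for p n
  define g where "g p = real (card (I p)) / real p" for p
  have finA: "finite A" unfolding A_def by (rule finite_subset[of _ "{1..\<lfloor>x\<rfloor>}"]) auto
  have finP: "finite P" using P finite_sift by (rule finite_subset)
  have Pp: "prime p \<and> real p < y \<and> int p \<notin> S" if "p \<in> P" for p using that P by (auto simp: sift_iff)
  have cardI: "finite (I p)" "card (I p) \<le> k" if "p \<in> P" for p
    using I[OF that] card_mono[of "{1..k}" "I p"] by (auto intro: finite_subset)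
  have "\<forall>p\<in>P. prime p \<and> 2 * k \<le> p \<and> real p < y \<and> 0 \<le> g p \<and> g p \<le> real k / real p"
    using Pp outside_S(1) cardI by (auto simp: g_def divide_right_mono)
  moreover have "\<forall>T\<subseteq>P. \<bar>real (card {n\<in>A. \<forall>p\<in>T. E p n}) - x / M * prod g T\<bar> \<le> real k ^ card T"
  proof (intro allI impI)
    fix T assume T: "T \<subseteq> P"
    have "{n\<in>A. \<forall>p\<in>T. E p n} = {n\<in>{1..\<lfloor>x\<rfloor>}. n \<in> Z \<and> (\<forall>p\<in>T. \<exists>i\<in>I p. int p dvd linform a b i n)}"
      by (auto simp: A_def E_def)
    moreover have "\<bar>real (card {n\<in>{1..\<lfloor>x\<rfloor>}. n \<in> Z \<and> (\<forall>p\<in>T. \<exists>i\<in>I p. int p dvd linform a b i n)})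
      - x / M * (\<Prod>p\<in>T. real (card (I p)) / real p)\<bar> \<le> real k ^ card T"
    proof (rule card_sieve_condition[OF _ Z x])
      show "finite T" using T finP by (rule finite_subset)
    next
      fix p assume "p \<in> T"
      then have p: "p \<in> P" using T by auto
      show "prime p \<and> coprime M (int p) \<and> finite (I p) \<and> card (I p) \<le> k"
        using Pp[OF p] cop[OF p] cardI[OF p] by auto
      fix i assume "i \<in> I p"
      then have i: "i \<in> {1..k}" using I[OF p] by auto
      show "\<not> int p dvd a i" using outside_S(2) Pp[OF p] i by blast
      fix j assume "j \<in> I p" "i < j"
      then show "\<not> int p dvd a i * b j - a j * b i" using outside_S(3) Pp[OF p] i I[OF p] by blast
    qed
    ultimately show "\<bar>real (card {n\<in>A. \<forall>p\<in>T. E p n}) - x / M * prod g T\<bar> \<le> real k ^ card T"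
      by (simp add: g_def)
  qed
  moreover have "x / M \<ge> 0" using x Z(2) by simp
  ultimately have "real (card {n\<in>A. \<forall>p\<in>P. \<not> E p n}) \<le> 2 * (x / M) * (\<Prod>p\<in>P. 1 - g p) + y ^ K \<and>
      x / M * (\<Prod>p\<in>P. 1 - g p) / 2 - y ^ K \<le> real (card {n\<in>A. \<forall>p\<in>P. \<not> E p n})"
    using K finA y unfolding sieve_constant_def by blast
  moreover have "{n\<in>A. \<forall>p\<in>P. \<not> E p n} = {n\<in>{1..\<lfloor>x\<rfloor>}. n \<in> Z \<and> (\<forall>p\<in>P. \<forall>i\<in>I p. \<not> int p dvd L i n)}"
    by (auto simp: A_def E_def)
  ultimately show "N \<le> 2 * (x / M) * V + y ^ K" "x / M * V / 2 - y ^ K \<le> N"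
    by (simp_all add: N_def V_def g_def)
qed

definition sieve_density :: "real \<Rightarrow> real" where
  "sieve_density z = (\<Prod>p\<in>sift z. 1 - real k / real p)"

lemma sift_factor_pos:
  assumes "p \<in> sift z"
  shows "0 < 1 - real k / real p"
proof -
  have "2 * k \<le> p" using assms outside_S(1) by (auto simp: sift_iff)
  then have "real (2 * k) \<le> real p" by (rule of_nat_mono)
  then show ?thesis using k_pos by (simp add: field_simps)
qed

lemma sieve_density_pos: "0 < sieve_density z"
  unfolding sieve_density_def using sift_factor_pos by (intro prod_pos) auto

text \<open>Bernoulli's inequality compares each factor with \<open>(1 - 1/p) ^ k\<close>, and
  Mertens' product applies to all primes. Every prime of \<open>S\<close> missing from the product
  costs at most a factor 2, which is how \<open>card S\<close> enters.\<close>

lemma sieve_density_upper: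
  assumes "z > 1"
  shows "sieve_density z \<le> 2 ^ (card S * k) / ln z ^ k"
proof -
  define D where "D = {p\<in>primes_below z. int p \<in> S}"
  define w where "w p = 1 - 1 / real p" for p :: nat
  have w: "1 / 2 \<le> w p" "w p \<le> 1" if "prime p" for p
    using prime_ge_2_nat[OF that] by (auto simp: w_def field_simps)
  have split: "(\<Prod>p\<in>primes_below z. w p) = (\<Prod>p\<in>sift z. w p) * (\<Prod>p\<in>D. w p)"
  proof -
    have "primes_below z = sift z \<union> D" "sift z \<inter> D = {}" by (auto simp: sift_def D_def)
    then show ?thesis by (metis D_def finite_sift finite_primes_below finite_Un prod.union_disjoint)
  qed
  have "card D \<le> card S"
  proof -
    have "card D = card (int ` D)" by (simp add: card_image)
    also have "\<dots> \<le> card S" using finite_S by (intro card_mono) (auto simp: D_def)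
    finally show ?thesis .
  qed
  then have "(1 / 2 :: real) ^ card S \<le> (1 / 2) ^ card D" by (intro power_decreasing) auto
  also have "\<dots> = (\<Prod>p\<in>D. 1 / 2)" by simp
  also have "\<dots> \<le> (\<Prod>p\<in>D. w p)" using w by (intro prod_mono) (auto simp: D_def primes_below_def)
  finally have D: "(1 / 2) ^ card S \<le> (\<Prod>p\<in>D. w p)" .
  have s0: "0 \<le> (\<Prod>p\<in>sift z. w p)"
    using w(1) by (intro prod_nonneg) (auto simp: sift_iff intro: order.trans[of 0 "1/2"])
  have "(\<Prod>p\<in>sift z. w p) * (1 / 2) ^ card S \<le> (\<Prod>p\<in>primes_below z. w p)"
    unfolding split by (intro mult_left_mono D s0)
  also have "\<dots> \<le> 1 / ln z" unfolding w_def by (rule mertens_product_le[OF assms])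
  finally have le: "(\<Prod>p\<in>sift z. w p) \<le> 2 ^ card S / ln z"
    by (simp add: power_one_over field_simps)
  have "sieve_density z \<le> (\<Prod>p\<in>sift z. w p ^ k)"
    unfolding sieve_density_def
  proof (intro prod_mono conjI)
    fix p assume p: "p \<in> sift z"
    then show "0 \<le> 1 - real k / real p" using sift_factor_pos by (simp add: less_imp_le)
    have "1 + real k * (- (1 / real p)) \<le> (1 + - (1 / real p)) ^ k"
      using w[of p] p by (intro Bernoulli_inequality) (auto simp: w_def sift_iff)
    then show "1 - real k / real p \<le> w p ^ k" by (simp add: w_def)
  qed
  also have "\<dots> = (\<Prod>p\<in>sift z. w p) ^ k" by (simp add: prod_power_distrib)
  also have "\<dots> \<le> (2 ^ card S / ln z) ^ k" using le s0 by (intro power_mono) auto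
  also have "\<dots> = 2 ^ (card S * k) / ln z ^ k" by (simp add: power_divide power_mult)
  finally show ?thesis .
qed

section \<open>Size of the values, and values that are not square-free\<close>

definition size_bound :: real where
  "size_bound = 1 + (\<Sum>i\<in>{1..k}. \<bar>a i\<bar> + \<bar>b i\<bar>)"

lemma size_bound_ge_1: "1 \<le> size_bound"
  by (simp add: size_bound_def sum_nonneg)

lemma L_le:
  assumes "i \<in> {1..k}" "n \<in> {1..\<lfloor>x\<rfloor>}"
  shows "\<bar>L i n\<bar> \<le> size_bound * x"
proof -
  have n: "1 \<le> n" "real_of_int n \<le> x" using assms(2) by (auto simp: le_floor_iff)
  have x: "1 \<le> x" using n by linarith
  have "\<bar>real_of_int (L i n)\<bar> \<le> \<bar>real_of_int (a i)\<bar> * \<bar>real_of_int n\<bar> + \<bar>real_of_int (b i)\<bar>"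
    by (simp add: linform_def abs_mult[symmetric] abs_triangle_ineq)
  also have "\<dots> \<le> \<bar>real_of_int (a i)\<bar> * x + \<bar>real_of_int (b i)\<bar> * x"
    using n x by (intro add_mono mult_left_mono) (auto simp: mult_left_le intro: order.trans[OF _ mult_left_mono[of 1]])
  also have "\<dots> = (\<bar>a i\<bar> + \<bar>b i\<bar>) * x" by (simp add: distrib_right)
  also have "\<dots> \<le> size_bound * x"
  proof (intro mult_right_mono)
    have "\<bar>a i\<bar> + \<bar>b i\<bar> \<le> (\<Sum>i\<in>{1..k}. \<bar>a i\<bar> + \<bar>b i\<bar>)"
      using member_le_sum[OF assms(1), of "\<lambda>i. \<bar>a i\<bar> + \<bar>b i\<bar>"] by simp
    then show "\<bar>a i\<bar> + \<bar>b i\<bar> \<le> size_bound" unfolding size_bound_def by linarith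
  qed (use x in auto)
  finally show ?thesis by simp
qed

text \<open>A form with nonzero leading coefficient is injective, so small values are rare. With
  \<open>y = 0\<close> this disposes of the possible zero of the form.\<close>

lemma card_L_small:
  fixes y :: real
  assumes "i \<in> {1..k}" "y \<ge> 0"
  shows "real (card {n\<in>{1..\<lfloor>x\<rfloor>}. \<bar>L i n\<bar> \<le> y}) \<le> 2 * y + 1"
proof -
  have inj: "inj_on (L i) X" for X using a_nz[OF assms(1)] by (auto simp: inj_on_def linform_def)
  have "card {n\<in>{1..\<lfloor>x\<rfloor>}. \<bar>L i n\<bar> \<le> y} = card (L i ` {n\<in>{1..\<lfloor>x\<rfloor>}. \<bar>L i n\<bar> \<le> y})"
    by (rule card_image[OF inj, symmetric])
  also have "\<dots> \<le> card {- \<lfloor>y\<rfloor>..\<lfloor>y\<rfloor>}"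
  proof (intro card_mono subsetI)
    fix m assume "m \<in> L i ` {n\<in>{1..\<lfloor>x\<rfloor>}. \<bar>L i n\<bar> \<le> y}"
    then have "\<bar>real_of_int m\<bar> \<le> y" by auto
    then show "m \<in> {- \<lfloor>y\<rfloor>..\<lfloor>y\<rfloor>}" by (simp add: le_floor_iff minus_le_iff) linarith
  qed simp
  finally have "card {n\<in>{1..\<lfloor>x\<rfloor>}. \<bar>L i n\<bar> \<le> y} \<le> nat (2 * \<lfloor>y\<rfloor> + 1)" by simp
  then show ?thesis using assms(2) by linarith
qed

lemma coprime_modulus:
  assumes "prime p" "int p \<notin> S" "i \<in> {1..k}"
  shows "coprime (a i) (int p)"
  using outside_S(2)[OF assms(1,2,3)] assms(1) by (metis coprime_commute prime_imp_coprime prime_int_nat_transfer nat_int prime_nat_int_transfer)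

text \<open>A nonzero value that is not square-free is divisible by \<open>p^2\<close> for a prime
  \<open>p\<close> outside \<open>S\<close>, hence \<open>p >= z\<close>, and \<open>p\<close> is at
  most \<open>sqrt (size_bound * x)\<close>. Each such \<open>p\<close> leaves one class modulo
  \<open>p^2\<close>; the final 1 accounts for a zero of the form.\<close>

lemma card_nonsquarefree:
  assumes i: "i \<in> {1..k}" and z: "z \<ge> 2" and x: "x \<ge> 1"
  shows "real (card {n\<in>Omega S k a b x z. \<not> squarefree (L i n)}) \<le> 2 * x / z + sqrt (size_bound * x) + 1"
proof -
  define N where "N = nat \<lfloor>sqrt (size_bound * x)\<rfloor>"
  define D where "D = {p. prime p \<and> z \<le> real p \<and> p \<le> N \<and> int p \<notin> S}"
  \<comment> \<open>The largest integer strictly below \<open>z\<close>: primes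
    \<open>p >= z\<close> satisfy \<open>p > m\<close>, and \<open>m >= z / 2\<close> because
    \<open>z >= 2\<close>.\<close>
  define m where "m = nat (\<lceil>z\<rceil> - 1)"
  define G where "G p = {n\<in>{1..\<lfloor>x\<rfloor>}. n \<in> {n. (int p)\<^sup>2 dvd a i * n + b i}}" for p
  have Bx: "0 \<le> size_bound * x" using size_bound_ge_1 x by simp
  have m: "m \<ge> 1" "z / 2 \<le> real m" "real m < z" using z unfolding m_def by linarith+
  have finD: "finite D" by (rule finite_subset[of _ "{..N}"]) (auto simp: D_def)
  have finG: "finite (G p)" for p unfolding G_def by (rule finite_subset[of _ "{1..\<lfloor>x\<rfloor>}"]) auto
  have sub: "{n\<in>Omega S k a b x z. \<not> squarefree (L i n)} \<subseteq> {n\<in>{1..\<lfloor>x\<rfloor>}. \<bar>L i n\<bar> \<le> (0::real)} \<union> (\<Union>p\<in>D. G p)"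
  proof
    fix n assume n: "n \<in> {n\<in>Omega S k a b x z. \<not> squarefree (L i n)}"
    then have nx: "n \<in> {1..\<lfloor>x\<rfloor>}" and nd: "\<And>p. p \<in> sift z \<Longrightarrow> \<not> int p dvd L i n"
      using i by (auto simp: Omega_iff)
    show "n \<in> {n\<in>{1..\<lfloor>x\<rfloor>}. \<bar>L i n\<bar> \<le> (0::real)} \<union> (\<Union>p\<in>D. G p)"
    proof (cases "L i n = 0")
      case False
      then obtain q :: int where q: "prime q" "q\<^sup>2 dvd L i n"
        using n squarefree_factorial_semiring[of "L i n"] by auto
      obtain p where p: "q = int p" using prime_ge_0_int[OF q(1)] zero_le_imp_eq_int by blast
      have pd: "int p dvd L i n" using q p by (metis dvd_trans dvd_power zero_less_numeral)
      have "int p \<notin> S" using not_dvd_S[OF _ i] pd by blast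
      moreover have "prime p" using q p by simp
      moreover have "z \<le> real p" using nd[of p] pd calculation by (force simp: sift_iff)
      moreover have "p \<le> N"
      proof -
        have "q\<^sup>2 \<le> \<bar>L i n\<bar>" using q(2) False by (intro zdvd_imp_le) auto
        then have "(real p)\<^sup>2 \<le> \<bar>real_of_int (L i n)\<bar>"
          unfolding p by (metis of_int_abs of_int_le_iff of_int_of_nat_eq of_int_power)
        also have "\<dots> \<le> size_bound * x" using L_le[OF i nx] by simp
        finally have "real p \<le> sqrt (size_bound * x)" by (rule real_le_rsqrt)
        then show ?thesis unfolding N_def by (simp add: le_nat_floor)
      qed
      ultimately have "p \<in> D" by (simp add: D_def)
      moreover have "n \<in> G p" using q p nx by (auto simp: G_def linform_def)
      ultimately show ?thesis by blast
    qed (use nx in auto)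
  qed
  have Gp: "real (card (G p)) \<le> x * (1 / real p ^ 2) + 1" if "p \<in> D" for p
  proof -
    have p: "prime p" "int p \<notin> S" using that by (auto simp: D_def)
    have pos: "(int p)\<^sup>2 > 0" using prime_gt_0_nat[OF p(1)] by simp
    have "periodic ((int p)\<^sup>2) 1 {n. (int p)\<^sup>2 dvd a i * n + b i}"
      using coprime_modulus[OF p i] pos by (intro periodic_linear) auto
    from card_periodic[OF this pos, of x] x
    have "\<bar>real (card (G p)) - x / real p ^ 2\<bar> \<le> 1" by (simp add: G_def)
    then show ?thesis by (simp add: abs_le_iff)
  qed
  have "card {n\<in>Omega S k a b x z. \<not> squarefree (L i n)}
      \<le> card ({n\<in>{1..\<lfloor>x\<rfloor>}. \<bar>L i n\<bar> \<le> (0::real)} \<union> (\<Union>p\<in>D. G p))"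
    using finD finG by (intro card_mono sub finite_UnI finite_UN_I) (auto intro: finite_subset[of _ "{1..\<lfloor>x\<rfloor>}"])
  also have "\<dots> \<le> card {n\<in>{1..\<lfloor>x\<rfloor>}. \<bar>L i n\<bar> \<le> (0::real)} + card (\<Union>p\<in>D. G p)"
    by (rule card_Un_le)
  also have "\<dots> \<le> card {n\<in>{1..\<lfloor>x\<rfloor>}. \<bar>L i n\<bar> \<le> (0::real)} + (\<Sum>p\<in>D. card (G p))"
    using card_UN_le[OF finD] by (intro add_left_mono)
  finally have "real (card {n\<in>Omega S k a b x z. \<not> squarefree (L i n)})
     \<le> real (card {n\<in>{1..\<lfloor>x\<rfloor>}. \<bar>L i n\<bar> \<le> (0::real)}) + (\<Sum>p\<in>D. real (card (G p)))"
    by (simp only: of_nat_le_iff[where 'a = real, symmetric] of_nat_add of_nat_sum)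
  also have "\<dots> \<le> 1 + (\<Sum>p\<in>D. x * (1 / real p ^ 2) + 1)"
    using card_L_small[OF i, of 0 x] Gp by (intro add_mono sum_mono) auto
  also have "\<dots> = 1 + (x * (\<Sum>p\<in>D. 1 / real p ^ 2) + real (card D))"
    by (simp add: sum.distrib sum_distrib_left)
  also have "\<dots> \<le> 1 + (x * (2 / z) + sqrt (size_bound * x))"
  proof (intro add_mono mult_left_mono order.refl)
    have "(\<Sum>p\<in>D. 1 / real p ^ 2) \<le> (\<Sum>p\<in>{m<..N}. 1 / real p ^ 2)"
      using m(3) by (intro sum_mono2) (auto simp: D_def)
    also have "\<dots> \<le> 1 / real m" by (rule sum_inverse_squares_from[OF m(1)])
    also have "\<dots> \<le> 1 / (z / 2)" using m z by (intro divide_left_mono) auto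
    finally show "(\<Sum>p\<in>D. 1 / real p ^ 2) \<le> 2 / z" by simp
    have "card D \<le> card {1..N}" by (intro card_mono) (auto simp: D_def dest: prime_ge_1_nat)
    then have "real (card D) \<le> real N" by simp
    also have "\<dots> \<le> sqrt (size_bound * x)" unfolding N_def using Bx by simp
    finally show "real (card D) \<le> sqrt (size_bound * x)" .
  qed (use x in auto)
  finally show ?thesis by (simp add: mult.commute)
qed

section \<open>Lower bound for \<open>Omega\<close>, prime values, and the lower bound for
  \<open>Omega1\<close>\<close>

lemma periodic_UNIV: "periodic 1 1 UNIV"
  unfolding periodic_def by (intro exI[of _ "{0}"]) auto

lemma Omega_lower:
  assumes "sieve_constant k K" "x \<ge> 0" "z \<ge> 2"
  shows "x * sieve_density z / 2 - z ^ K \<le> real (card (Omega S k a b x z))"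
proof -
  have "Omega S k a b x z = {n\<in>{1..\<lfloor>x\<rfloor>}. n \<in> UNIV \<and> (\<forall>p\<in>sift z. \<forall>i\<in>{1..k}. \<not> int p dvd L i n)}"
    by (auto simp: Omega_iff)
  then show ?thesis
    using sifted_bounds(2)[OF assms(1) periodic_UNIV _ assms(2,3), of "sift z" "\<lambda>_. {1..k}"]
    by (simp add: sieve_density_def)
qed

text \<open>A noncomposite value beyond \<open>y\<close> is prime up to sign, so no prime below
  \<open>y\<close> divides it. Sieve by all forms below \<open>z\<close> and by the
  \<open>i\<close>-th form alone from \<open>z\<close> to \<open>y\<close>; values up to
  \<open>y\<close> are counted trivially. As \<open>S\<close> lies below \<open>z\<close>, the
  second range contains every prime, and ordinary Mertens bounds apply.\<close>

lemma card_noncomposite: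
  assumes K: "sieve_constant k K" and i: "i \<in> {1..k}" and x: "x \<ge> 0"
    and z: "2 \<le> z" "z \<le> y" and zS: "\<And>p. p \<in> S \<Longrightarrow> p < z"
    and d: "0 < d" "d / ln z \<le> (\<Prod>p\<in>primes_below z. 1 - 1 / real p)"
  shows "real (card {n\<in>Omega S k a b x z. \<not> composite (L i n)})
    \<le> 2 * x * sieve_density z * (ln z / (d * ln y)) + y ^ K + (2 * y + 1)"
proof -
  define I where "I p = (if real p < z then {1..k} else {i})" for p
  define rest where "rest = {p\<in>primes_below y. z \<le> real p}"
  define W where "W = (\<Prod>p\<in>rest. 1 - 1 / real p)"
  have y: "y \<ge> 2" using z by simp
  have finr: "finite rest" by (simp add: rest_def)
  have split: "sift y = sift z \<union> rest" "sift z \<inter> rest = {}"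
  proof -
    have "int p \<notin> S" if "z \<le> real p" for p using zS[of "int p"] that by auto
    then show "sift y = sift z \<union> rest" "sift z \<inter> rest = {}"
      using z by (auto simp: sift_iff rest_def primes_below_def)
  qed
  have split': "primes_below y = primes_below z \<union> rest" "primes_below z \<inter> rest = {}"
    using z by (auto simp: rest_def primes_below_def)
  \<comment> \<open>\<open>W\<close> is a quotient of two full Mertens products: the upper bound at
    \<open>y\<close> over the lower bound at \<open>z\<close>.\<close>
  have W: "W \<le> ln z / (d * ln y)"
  proof -
    have W0: "0 \<le> W" unfolding W_def rest_def
      using prime_ge_1_nat by (intro prod_nonneg) (auto simp: primes_below_def divide_le_eq_1)
    have "d / ln z * W \<le> (\<Prod>p\<in>primes_below z. 1 - 1 / real p) * W"
      using d(2) W0 by (rule mult_right_mono)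
    also have "\<dots> = (\<Prod>p\<in>primes_below y. 1 - 1 / real p)"
      unfolding W_def split'(1) using finr split'(2) by (intro prod.union_disjoint[symmetric]) auto
    also have "\<dots> \<le> 1 / ln y" using y by (intro mertens_product_le) auto
    finally have "d / ln z * W \<le> 1 / ln y" .
    moreover have "ln z > 0" "ln y > 0" using z y by auto
    ultimately show ?thesis using d(1) by (simp add: field_simps)
  qed
  have prod: "(\<Prod>p\<in>sift y. 1 - real (card (I p)) / real p) = sieve_density z * W"
  proof -
    have "(\<Prod>p\<in>sift z. 1 - real (card (I p)) / real p) = sieve_density z"
      unfolding sieve_density_def by (intro prod.cong) (auto simp: I_def sift_iff)
    moreover have "(\<Prod>p\<in>rest. 1 - real (card (I p)) / real p) = W"
      unfolding W_def by (intro prod.cong) (auto simp: I_def rest_def)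
    ultimately show ?thesis unfolding split(1) using finr split(2) by (simp add: prod.union_disjoint)
  qed
  define T where "T = {n\<in>{1..\<lfloor>x\<rfloor>}. n \<in> UNIV \<and> (\<forall>p\<in>sift y. \<forall>j\<in>I p. \<not> int p dvd L j n)}"
  define U where "U = {n\<in>{1..\<lfloor>x\<rfloor>}. \<bar>L i n\<bar> \<le> y}"
  have fin: "finite T" "finite U"
    unfolding T_def U_def by (auto intro: finite_subset[of _ "{1..\<lfloor>x\<rfloor>}"])
  have "real (card T) \<le> 2 * (x / of_int 1) * (\<Prod>p\<in>sift y. 1 - real (card (I p)) / real p) + y ^ K"
    unfolding T_def using i
    by (intro sifted_bounds(1)[OF K periodic_UNIV _ x y]) (auto simp: I_def split: if_splits)
  also have "\<dots> = 2 * x * sieve_density z * W + y ^ K" unfolding prod by simp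
  also have "\<dots> \<le> 2 * x * sieve_density z * (ln z / (d * ln y)) + y ^ K"
    using W x sieve_density_pos[of z] by (intro add_right_mono mult_left_mono) auto
  finally have T: "real (card T) \<le> 2 * x * sieve_density z * (ln z / (d * ln y)) + y ^ K" .
  have U: "real (card U) \<le> 2 * y + 1" unfolding U_def using card_L_small[OF i, of y x] y by simp
  have "{n\<in>Omega S k a b x z. \<not> composite (L i n)} \<subseteq> T \<union> U"
  proof
    fix n assume "n \<in> {n\<in>Omega S k a b x z. \<not> composite (L i n)}"
    then have n: "n \<in> {1..\<lfloor>x\<rfloor>}" "\<And>p j. p \<in> sift z \<Longrightarrow> j \<in> {1..k} \<Longrightarrow> \<not> int p dvd L j n"
      "\<not> composite (L i n)" by (auto simp: Omega_iff)
    show "n \<in> T \<union> U"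
    proof (cases "\<bar>L i n\<bar> \<le> y")
      case False
      then have big: "real_of_int \<bar>L i n\<bar> > y" by simp
      then have "\<bar>L i n\<bar> > 1" using y by linarith
      then have pr: "prime \<bar>L i n\<bar>" using n(3) by (auto simp: composite_def)
      have "\<not> int p dvd L j n" if "p \<in> sift y" "j \<in> I p" for p j
      proof (cases "real p < z")
        case True
        then show ?thesis using that n(2) by (auto simp: I_def sift_iff)
      next
        case False
        show ?thesis
        proof
          assume "int p dvd L j n"
          then have "int p dvd \<bar>L i n\<bar>" using that False by (simp add: I_def)
          moreover have "prime (int p)" using that by (simp add: sift_iff)
          ultimately have "int p = \<bar>L i n\<bar>" using pr primes_dvd_imp_eq by blast
          then have "real p = real_of_int \<bar>L i n\<bar>" by (metis of_int_of_nat_eq)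
          then show False using big that by (simp add: sift_iff)
        qed
      qed
      then show ?thesis using n(1) by (auto simp: T_def)
    qed (use n(1) in \<open>auto simp: U_def\<close>)
  qed
  then have "card {n\<in>Omega S k a b x z. \<not> composite (L i n)} \<le> card (T \<union> U)"
    using fin by (intro card_mono) auto
  also have "\<dots> \<le> card T + card U" by (rule card_Un_le)
  finally have "real (card {n\<in>Omega S k a b x z. \<not> composite (L i n)}) \<le> real (card T) + real (card U)"
    by (metis of_nat_add of_nat_mono)
  then show ?thesis using T U by linarith
qed

text \<open>With \<open>V\<close> the density, \<open>Omega\<close> has about
  \<open>x * V / 2\<close> elements and noncomposite values take at most \<open>x * V / 4\<close>.
  Writing \<open>Q = c * x / ln z ^ k <= x * V\<close>, repeated prime factors and all terms of
  order \<open>sqrt x\<close> take \<open>Q / 16\<close> each, so \<open>Q / 8\<close>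
  remains.\<close>

lemma Omega1_lower:
  assumes K: "sieve_constant k K"
    and c: "0 < c" "\<And>z Q. z \<ge> 2 \<Longrightarrow> Q \<subseteq> primes_below z \<Longrightarrow> (\<And>p. p \<in> Q \<Longrightarrow> 2 * k \<le> p) \<Longrightarrow>
      c / ln z ^ k \<le> (\<Prod>p\<in>Q. 1 - real k / real p)"
    and d: "0 < d" "\<And>z. z \<ge> 2 \<Longrightarrow> d / ln z \<le> (\<Prod>p\<in>primes_below z. 1 - 1 / real p)"
    and \<eta>: "0 < \<eta>" "\<eta> \<le> 1 / (2 * real K)" "\<eta> \<le> d / (16 * real k * real K)"
  shows "\<exists>z1\<ge>2. \<forall>x z. z1 \<le> z \<and> z \<le> x powr \<eta> \<longrightarrow> c / 8 * x / ln z ^ k \<le> real (card (Omega1 S k a b x z))"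
proof -
  have K1: "K \<ge> 1" using K by (simp add: sieve_constant_def)
  \<comment> \<open>Collects the coefficients of \<open>sqrt x\<close>: 1 from the lower bound for
    \<open>Omega\<close>, and for each form \<open>sqrt size_bound\<close> plus 5.\<close>
  define F where "F = 1 + 5 * real k + real k * sqrt size_bound"
  have ev: "eventually (\<lambda>t. 32 * real k / c * ln t ^ k \<le> sqrt t \<and> 16 * F / c * ln t ^ k \<le> sqrt t
      \<and> (\<forall>p\<in>S. real_of_int p < t)) at_top"
    using finite_S by (intro eventually_conj eventually_power_ln_le_sqrt eventually_ball_finite ballI eventually_gt_at_top) auto
  then obtain t0 where t0: "\<And>t. t \<ge> t0 \<Longrightarrow> 32 * real k / c * ln t ^ k \<le> sqrt t"
    "\<And>t. t \<ge> t0 \<Longrightarrow> 16 * F / c * ln t ^ k \<le> sqrt t"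
    "\<And>t p. t \<ge> t0 \<Longrightarrow> p \<in> S \<Longrightarrow> real_of_int p < t"
    unfolding eventually_at_top_linorder by blast
  define z1 where "z1 = max t0 (2 ^ (2 * K))"
  have z1: "z1 \<ge> t0" "z1 \<ge> 2 ^ (2 * K)" by (auto simp: z1_def)
  have "(2::real) ^ 1 \<le> 2 ^ (2 * K)" using K1 by (intro power_increasing) auto
  then have z12: "z1 \<ge> 2" using z1 by simp
  have "c / 8 * x / ln z ^ k \<le> real (card (Omega1 S k a b x z))" if z: "z1 \<le> z" "z \<le> x powr \<eta>" for x z
  \<comment> \<open>\<open>x\<close> ranges over all reals; for \<open>x <= 0\<close> the claimed
    lower bound is not positive.\<close>
  proof (cases "x \<le> 0")
    case True
    have "ln z ^ k \<ge> 0" using z z12 by simp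
    then have "c / 8 * x / ln z ^ k \<le> 0" using True c(1) by (simp add: divide_nonpos_nonneg mult_nonneg_nonpos)
    then show ?thesis by simp
  next
    case False
    then have x0: "x > 0" by simp
    have z2: "z \<ge> 2" using z z12 by simp
    have x1: "x \<ge> 1"
    proof (rule ccontr)
      assume "\<not> x \<ge> 1"
      then have "x powr \<eta> \<le> 1 powr \<eta>" using x0 \<eta> by (intro powr_mono2) auto
      then show False using z z2 by simp
    qed
    \<comment> \<open>This exponent makes the sieve remainder \<open>y ^ K\<close> equal to
      \<open>sqrt x\<close>.\<close>
    define \<delta> where "\<delta> = 1 / (2 * real K)"
    define y where "y = x powr \<delta>"
    have \<delta>: "\<eta> \<le> \<delta>" "\<delta> \<le> 1 / 2" using \<eta>(2) K1 by (auto simp: \<delta>_def field_simps)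
    have zy: "z \<le> y" using z(2) powr_mono[OF \<delta>(1) x1] by (simp add: y_def)
    have yx: "y \<le> sqrt x" using powr_mono[OF \<delta>(2) x1] x0 by (simp add: y_def powr_half_sqrt)
    have sx: "1 \<le> sqrt x" "sqrt x * sqrt x = x" using x1 by auto
    have zx: "z \<le> x"
    proof -
      have "sqrt x * 1 \<le> sqrt x * sqrt x" using sx by (intro mult_left_mono) auto
      then show ?thesis using zy yx sx by linarith
    qed
    have yK: "y ^ K = sqrt x"
    proof -
      have "y ^ K = x powr (\<delta> * real K)"
        using x0 by (simp add: y_def powr_realpow[symmetric] powr_powr)
      also have "\<delta> * real K = 1 / 2" using K1 by (simp add: \<delta>_def)
      finally show ?thesis using x0 by (simp add: powr_half_sqrt)
    qed
    have lnz: "ln z > 0" "ln z \<le> ln x" using z2 zx by auto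
    have lnzx: "ln z \<le> \<eta> * ln x"
    proof -
      have "ln z \<le> ln (x powr \<eta>)" using z z2 by (intro ln_mono) auto
      then show ?thesis using x0 by (simp add: ln_powr)
    qed
    have ratio: "ln z / (d * ln y) \<le> 1 / (8 * real k)"
    proof -
      have lny: "ln y = \<delta> * ln x" using x0 by (simp add: y_def ln_powr)
      have "ln z * (8 * real k) \<le> \<eta> * ln x * (8 * real k)" using lnzx by (intro mult_right_mono) auto
      also have "\<dots> \<le> d / (16 * real k * real K) * ln x * (8 * real k)"
        using \<eta>(3) lnz by (intro mult_right_mono) auto
      also have "\<dots> = d * ln y" unfolding lny \<delta>_def using k_pos K1 by (simp add: field_simps)
      finally have "ln z * (8 * real k) \<le> d * ln y" .
      moreover have "0 < d * ln y" unfolding lny using d(1) lnz K1 by (simp add: \<delta>_def)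
      ultimately show ?thesis using k_pos by (simp add: field_simps)
    qed
    define V where "V = sieve_density z"
    have V: "c / ln z ^ k \<le> V"
      unfolding V_def sieve_density_def using z2 outside_S(1) by (intro c(2)) (auto simp: sift_def primes_below_def)
    have V0: "V > 0" unfolding V_def by (rule sieve_density_pos)
    define NS where "NS i = {n\<in>Omega S k a b x z. \<not> squarefree (L i n)}" for i
    define NC where "NC i = {n\<in>Omega S k a b x z. \<not> composite (L i n)}" for i
    have NS: "real (card (NS i)) \<le> 2 * x / z + sqrt (size_bound * x) + 1" if "i \<in> {1..k}" for i
      unfolding NS_def by (rule card_nonsquarefree[OF that z2 x1])
    have NC: "real (card (NC i)) \<le> x * V / (4 * real k) + sqrt x + (2 * sqrt x + 1)" if "i \<in> {1..k}" for i
    proof -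
      have "real (card (NC i)) \<le> 2 * x * V * (ln z / (d * ln y)) + y ^ K + (2 * y + 1)"
        unfolding NC_def V_def using t0(3)[of z] z z1
        by (intro card_noncomposite[OF K that _ z2 zy _ d(1) d(2)[OF z2]]) (use x0 in auto)
      also have "2 * x * V * (ln z / (d * ln y)) \<le> 2 * x * V * (1 / (8 * real k))"
        using ratio V0 x0 by (intro mult_left_mono) auto
      finally show ?thesis using yK yx by (simp add: mult.commute)
    qed
    have sub: "Omega S k a b x z \<subseteq> Omega1 S k a b x z \<union> (\<Union>i\<in>{1..k}. NS i \<union> NC i)"
    proof
      fix n assume n: "n \<in> Omega S k a b x z"
      \<comment> \<open>Only genuinely square-free values are kept, with 1 as the unit
        factor.\<close>
      have "sigma_squarefree S m" if "squarefree m" for m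
        unfolding sigma_squarefree_def sigma_unit_def using that not_prime_unit
        by (intro exI[of _ 1] exI[of _ m]) auto
      then show "n \<in> Omega1 S k a b x z \<union> (\<Union>i\<in>{1..k}. NS i \<union> NC i)"
        using n by (auto simp: Omega1_def NS_def NC_def)
    qed
    have fin1: "finite (Omega1 S k a b x z)" unfolding Omega1_def by simp
    have finN: "finite (NS i)" "finite (NC i)" for i by (simp_all add: NS_def NC_def)
    have "card (Omega S k a b x z) \<le> card (Omega1 S k a b x z) + (\<Sum>i\<in>{1..k}. card (NS i) + card (NC i))"
    proof -
      have "card (Omega S k a b x z) \<le> card (Omega1 S k a b x z \<union> (\<Union>i\<in>{1..k}. NS i \<union> NC i))"
        using fin1 finN by (intro card_mono sub) auto
      also have "\<dots> \<le> card (Omega1 S k a b x z) + card (\<Union>i\<in>{1..k}. NS i \<union> NC i)" by (rule card_Un_le)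
      also have "card (\<Union>i\<in>{1..k}. NS i \<union> NC i) \<le> (\<Sum>i\<in>{1..k}. card (NS i \<union> NC i))" by (intro card_UN_le) auto
      also have "\<dots> \<le> (\<Sum>i\<in>{1..k}. card (NS i) + card (NC i))" by (intro sum_mono card_Un_le)
      finally show ?thesis by simp
    qed
    then have "real (card (Omega S k a b x z)) \<le> real (card (Omega1 S k a b x z))
        + (\<Sum>i\<in>{1..k}. real (card (NS i)) + real (card (NC i)))"
      by (simp only: of_nat_le_iff[where 'a = real, symmetric] of_nat_add of_nat_sum)
    also have "(\<Sum>i\<in>{1..k}. real (card (NS i)) + real (card (NC i)))
        \<le> (\<Sum>i\<in>{1..k}. (2 * x / z + sqrt (size_bound * x) + 1) + (x * V / (4 * real k) + sqrt x + (2 * sqrt x + 1)))"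
      using NS NC by (intro sum_mono add_mono) auto
    also have "\<dots> = real k * (2 * x / z) + x * V / 4 + real k * (sqrt size_bound * sqrt x + 3 * sqrt x + 2)"
      using k_pos by (simp add: real_sqrt_mult field_simps)
    also have "\<dots> \<le> real k * (2 * x / z) + x * V / 4 + real k * (sqrt size_bound * sqrt x + 3 * sqrt x + 2 * sqrt x)"
      using sx by (intro add_left_mono mult_left_mono) auto
    also have "\<dots> = 2 * real k * x / z + x * V / 4 + (F - 1) * sqrt x"
      by (simp add: F_def algebra_simps)
    finally have 1: "real (card (Omega S k a b x z)) \<le> real (card (Omega1 S k a b x z))
       + (2 * real k * x / z + x * V / 4 + (F - 1) * sqrt x)" by simp
    have 2: "x * V / 2 - sqrt x \<le> real (card (Omega S k a b x z))"
    proof -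
      have "z ^ K \<le> y ^ K" using zy z2 by (intro power_mono) auto
      then show ?thesis using Omega_lower[OF K _ z2, of x] x0 yK by (simp add: V_def)
    qed
    define Q where "Q = c * x / ln z ^ k"
    have 3: "Q \<le> x * V" unfolding Q_def using mult_left_mono[OF V, of x] x0 by (simp add: mult.commute)
    have lk: "0 < ln z ^ k" "ln z ^ k \<le> ln x ^ k" using lnz by (auto intro: power_mono)
    have 4: "F * sqrt x \<le> Q / 16"
    proof -
      have F0: "0 \<le> F" using size_bound_ge_1 by (simp add: F_def)
      have "16 * F / c * ln z ^ k \<le> 16 * F / c * ln x ^ k"
        using lk F0 c(1) by (intro mult_left_mono) auto
      also have "\<dots> \<le> sqrt x" using t0(2)[of x] z z1 zx by simp
      finally have "16 * F / c * ln z ^ k * sqrt x \<le> sqrt x * sqrt x" using sx by (intro mult_right_mono) auto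
      then show ?thesis unfolding Q_def sx(2) using lk(1) c(1) by (simp add: field_simps)
    qed
    \<comment> \<open>This requires \<open>z\<close> itself, and not just \<open>x\<close>, to be
      large.\<close>
    have 5: "2 * real k * x / z \<le> Q / 16"
    proof -
      have "32 * real k / c * ln z ^ k \<le> sqrt z" using t0(1)[of z] z z1 by simp
      also have "\<dots> \<le> z"
      proof -
        have "sqrt z * 1 \<le> sqrt z * sqrt z" using z2 by (intro mult_left_mono) auto
        then show ?thesis using z2 by simp
      qed
      finally have "32 * real k / c * ln z ^ k * x \<le> z * x" using x0 by (intro mult_right_mono) auto
      then show ?thesis unfolding Q_def using lk(1) c(1) z2 by (simp add: field_simps)
    qed
    have "Q / 8 \<le> real (card (Omega1 S k a b x z))"
      using 1 2 3 4 5 unfolding left_diff_distrib by linarith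
    then show ?thesis by (simp add: Q_def)
  qed
  then show ?thesis using z12 by blast
qed

section \<open>Values divisible by a prime of a sparse set\<close>

lemma card_prime_divisor:
  assumes K: "sieve_constant k K" and i: "i \<in> {1..k}" and p: "prime p" "int p \<notin> S" "y \<le> real p"
    and y: "y \<ge> 2" and x: "x \<ge> 0"
  shows "real (card {n\<in>{1..\<lfloor>x\<rfloor>}. int p dvd L i n \<and> (\<forall>q\<in>sift y. \<forall>j\<in>{1..k}. \<not> int q dvd L j n)})
    \<le> 2 * x * sieve_density y * (1 / real p) + y ^ K"
proof -
  have p0: "int p > 0" using p(1) prime_gt_0_nat by simp
  have per: "periodic (int p) 1 {n. int p dvd a i * n + b i}"
    by (rule periodic_linear[OF coprime_modulus[OF p(1,2) i] p0])
  \<comment> \<open>All sifting primes lie below \<open>y <= p\<close>, so the modulus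
    \<open>p\<close> is coprime to them and the main term gains the factor \<open>1 / p\<close> in
    full.\<close>
  have cop: "coprime (int p) (int q)" if "q \<in> sift y" for q
  proof -
    have "prime q" "q \<noteq> p" using that p(3) by (auto simp: sift_iff)
    then have "coprime p q" using p(1) primes_coprime by blast
    then show ?thesis by simp
  qed
  have "{n\<in>{1..\<lfloor>x\<rfloor>}. int p dvd L i n \<and> (\<forall>q\<in>sift y. \<forall>j\<in>{1..k}. \<not> int q dvd L j n)}
    = {n\<in>{1..\<lfloor>x\<rfloor>}. n \<in> {n. int p dvd a i * n + b i} \<and> (\<forall>q\<in>sift y. \<forall>j\<in>{1..k}. \<not> int q dvd L j n)}"
    by (auto simp: linform_def)
  then show ?thesis
    using sifted_bounds(1)[OF K per p0 x y subset_refl cop, of "\<lambda>_. {1..k}"]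
    by (simp add: sieve_density_def mult_ac)
qed

text \<open>A union bound over the forms and the admissible primes. The main terms carry the sum of
  \<open>1/q\<close>, and hypothesis \<open>\<epsilon>\<close> makes them at most
  \<open>Q / 4\<close>; the remainders total at most \<open>k * size_bound * x / sqrt z\<close>,
  again at most \<open>Q / 4\<close>. Since \<open>Q\<close> is a lower bound for the size of
  \<open>Omega1\<close>, at most half of it is lost.\<close>

lemma half_avoid_sparse_primes:
  assumes K: "sieve_constant k K" and \<eta>: "0 < \<eta>" "\<eta> \<le> 1 / 2" and c: "0 < c"
    and lower: "\<And>x z. z1 \<le> z \<Longrightarrow> z \<le> x powr \<eta> \<Longrightarrow> c * x / ln z ^ k \<le> real (card (Omega1 S k a b x z))"
    and P: "\<And>p. p \<in> P \<Longrightarrow> prime p" and dens: "rel_upper_density P \<le> ereal \<epsilon>" "\<epsilon> > 0"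
    and \<epsilon>: "real k * (2 * 2 ^ (card S * k) * (2 * real K / \<eta>) ^ k * (100 * \<epsilon> / \<eta>)) \<le> c / 4"
  shows "\<exists>x0\<ge>2. \<forall>x\<ge>x0. 2 * real (card {n \<in> Omega1 S k a b x (x powr \<eta>).
           \<forall>p\<in>P. \<not> p dvd (\<Prod>i\<in>{1..k}. L i n)}) \<ge> real (card (Omega1 S k a b x (x powr \<eta>)))"
proof -
  have K1: "K \<ge> 1" using K by (simp add: sieve_constant_def)
  obtain T where T: "\<And>x F. x \<ge> 2 \<Longrightarrow> x powr \<eta> \<ge> T \<Longrightarrow> finite F \<Longrightarrow> int ` F \<subseteq> P \<Longrightarrow>
    (\<And>p. p \<in> F \<Longrightarrow> x powr \<eta> \<le> real p \<and> real p \<le> x) \<Longrightarrow> (\<Sum>p\<in>F. 1 / real p) \<le> 100 * \<epsilon> / \<eta>"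
    using sum_inverse_sparse_primes[OF P dens \<eta>(1)] by blast
  obtain t0 where t0: "\<And>t. t \<ge> t0 \<Longrightarrow> 4 * real k * size_bound / (c * \<eta> ^ k) * ln t ^ k \<le> sqrt t"
    using eventually_power_ln_le_sqrt[of "4 * real k * size_bound / (c * \<eta> ^ k)" k]
    unfolding eventually_at_top_linorder by blast
  \<comment> \<open>\<open>T\<close> serves the sum over sparse primes, \<open>t0\<close> the
    remainder terms, \<open>z1\<close> the lower bound for \<open>Omega1\<close>,
    \<open>size_bound\<close> ensures \<open>U <= x\<close>, and \<open>2 ^ (2 * K)\<close> ensures
    \<open>y >= 2\<close>.\<close>
  define W where "W = Max {T, t0, z1, size_bound, 2 ^ (2 * K), 2}"
  have W: "T \<le> W" "t0 \<le> W" "z1 \<le> W" "size_bound \<le> W" "2 ^ (2 * K) \<le> W" "2 \<le> W"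
    by (simp_all add: W_def)
  define x0 where "x0 = max 2 (W powr (1 / \<eta>))"
  have "2 * real (card {n \<in> Omega1 S k a b x (x powr \<eta>). \<forall>p\<in>P. \<not> p dvd (\<Prod>i\<in>{1..k}. L i n)})
      \<ge> real (card (Omega1 S k a b x (x powr \<eta>)))" if "x \<ge> x0" for x
  proof -
    have x2: "x \<ge> 2" using that by (simp add: x0_def)
    define z where "z = x powr \<eta>"
    \<comment> \<open>A smaller level than for prime values: now \<open>y ^ K = sqrt z\<close>,
      affordable once per prime in \<open>F\<close>.\<close>
    define y where "y = x powr (\<eta> / (2 * real K))"
    have zW: "W \<le> z"
    proof -
      have "(W powr (1 / \<eta>)) powr \<eta> \<le> x powr \<eta>"
        using that \<eta> by (intro powr_mono2) (auto simp: x0_def)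
      then show ?thesis using \<eta> W(6) by (simp add: z_def powr_powr)
    qed
    have z2: "z \<ge> 2" using zW W by linarith
    have yz: "y = z powr (1 / (2 * real K))" by (simp add: y_def z_def powr_powr)
    have y2: "y \<ge> 2"
    proof -
      have "(2::real) ^ (2 * K) = 2 powr (2 * real K)" by (simp add: powr_realpow[symmetric])
      then have "(2 powr (2 * real K)) powr (1 / (2 * real K)) \<le> y"
        unfolding yz using zW W(5) by (intro powr_mono2) auto
      then show ?thesis using K1 by (simp add: powr_powr)
    qed
    have y_le_z: "y \<le> z"
    proof -
      have "z powr (1 / (2 * real K)) \<le> z powr 1" using z2 K1 by (intro powr_mono) (auto simp: field_simps)
      then show ?thesis using z2 by (simp add: yz)
    qed
    have yK: "y ^ K = sqrt z"
    proof -
      have "y ^ K = z powr (1 / (2 * real K) * real K)"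
        using z2 by (simp add: yz powr_realpow[symmetric] powr_powr)
      also have "1 / (2 * real K) * real K = 1 / 2" using K1 by simp
      finally show ?thesis using z2 by (simp add: powr_half_sqrt)
    qed
    have lnx: "ln x > 0" using x2 by simp
    have lnz: "ln z = \<eta> * ln x" using x2 by (simp add: z_def ln_powr)
    have lny: "ln y = \<eta> / (2 * real K) * ln x" using x2 by (simp add: y_def ln_powr)
    \<comment> \<open>The cofactor of \<open>q\<close> has a prime factor of size at least
      \<open>z\<close>, so \<open>q\<close> is at most \<open>size_bound * x / z\<close>. The same
      number bounds \<open>card F\<close>.\<close>
    define U where "U = size_bound * x / z"
    have U0: "0 \<le> U" using size_bound_ge_1 x2 z2 by (simp add: U_def)
    have Ux: "U \<le> x"
    proof -
      have "size_bound * x \<le> z * x" using zW W x2 by (intro mult_right_mono) linarith+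
      then show ?thesis using z2 by (simp add: U_def field_simps)
    qed
    define F where "F = {q. prime q \<and> int q \<in> P \<and> int q \<notin> S \<and> z \<le> real q \<and> real q \<le> U}"
    have Fsub: "F \<subseteq> {1..nat \<lfloor>U\<rfloor>}" by (auto simp: F_def le_nat_floor dest: prime_ge_1_nat)
    then have finF: "finite F" by (rule finite_subset) simp
    have cardF: "real (card F) \<le> U"
    proof -
      have "card F \<le> nat \<lfloor>U\<rfloor>" using card_mono[OF _ Fsub] by simp
      then show ?thesis using U0 by linarith
    qed
    have sumF: "(\<Sum>q\<in>F. 1 / real q) \<le> 100 * \<epsilon> / \<eta>"
      using zW W(1) Ux by (intro T[OF x2 _ finF]) (auto simp: F_def z_def[symmetric])
    define G where "G i q = {n\<in>{1..\<lfloor>x\<rfloor>}. int q dvd L i n \<and> (\<forall>r\<in>sift y. \<forall>j\<in>{1..k}. \<not> int r dvd L j n)}" for i q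
    have finG: "finite (G i q)" for i q unfolding G_def by (rule finite_subset[of _ "{1..\<lfloor>x\<rfloor>}"]) auto
    define good where "good = {n \<in> Omega1 S k a b x z. \<forall>p\<in>P. \<not> p dvd (\<Prod>i\<in>{1..k}. L i n)}"
    have fin1: "finite (Omega1 S k a b x z)" unfolding Omega1_def by simp
    have sub: "Omega1 S k a b x z \<subseteq> good \<union> (\<Union>i\<in>{1..k}. \<Union>q\<in>F. G i q)"
    proof
      fix n assume n: "n \<in> Omega1 S k a b x z"
      then have nx: "n \<in> {1..\<lfloor>x\<rfloor>}" and ns: "\<And>p j. p \<in> sift z \<Longrightarrow> j \<in> {1..k} \<Longrightarrow> \<not> int p dvd L j n"
        and comp: "\<And>j. j \<in> {1..k} \<Longrightarrow> composite (L j n)" by (auto simp: Omega1_def Omega_iff)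
      show "n \<in> good \<union> (\<Union>i\<in>{1..k}. \<Union>q\<in>F. G i q)"
      proof (cases "n \<in> good")
        case False
        then obtain p where p: "p \<in> P" "p dvd (\<Prod>i\<in>{1..k}. L i n)" using n by (auto simp: good_def)
        then obtain i where i: "i \<in> {1..k}" "p dvd L i n" using P by (auto simp: prime_dvd_prod_iff)
        have big: "\<exists>r. q = int r \<and> prime r \<and> z \<le> real r \<and> q \<notin> S" if "prime q" "q dvd L i n" for q
        proof -
          from that(1) obtain r where r: "q = int r" using prime_ge_0_int zero_le_imp_eq_int by blast
          moreover have "q \<notin> S" using not_dvd_S i that by blast
          moreover have "prime r" using r that by simp
          moreover have "r \<notin> sift z" using ns i that r by blast
          ultimately show ?thesis by (auto simp: sift_iff)
        qed
        obtain q where q: "p = int q" "prime q" "z \<le> real q" "p \<notin> S" using big[OF P[OF p(1)] i(2)] by blast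
        obtain m where m: "L i n = int q * m" using i(2) q(1) by (auto elim: dvdE)
        have L1: "\<bar>L i n\<bar> > 1" "\<not> prime \<bar>L i n\<bar>" using comp[OF i(1)] by (auto simp: composite_def)
        \<comment> \<open>Here compositeness enters: a cofactor of modulus 1 would make the value
          prime up to sign.\<close>
        have "\<bar>m\<bar> \<noteq> 1" using L1(2) q(2) m by (auto simp: abs_mult)
        then have "\<not> is_unit m" by simp
        moreover have m0: "m \<noteq> 0" using m L1(1) by auto
        ultimately obtain l where l: "prime l" "l dvd m" using prime_divisor_exists by blast
        obtain r where r: "l = int r" "z \<le> real r" using big[OF l(1)] l(2) m by auto
        have "l \<le> \<bar>m\<bar>" using l(2) m0 by (intro zdvd_imp_le) auto
        then have "real_of_int l \<le> real_of_int \<bar>m\<bar>" by (simp only: of_int_le_iff)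
        then have zm: "z \<le> \<bar>real_of_int m\<bar>" using r by simp
        have "real q * z \<le> real q * \<bar>real_of_int m\<bar>" using zm by (intro mult_left_mono) auto
        also have "\<dots> = \<bar>real_of_int (L i n)\<bar>" by (simp add: m abs_mult)
        also have "\<dots> \<le> size_bound * x" using L_le[OF i(1) nx] by simp
        finally have "real q \<le> U" using z2 by (simp add: U_def field_simps)
        then have "q \<in> F" using q p by (simp add: F_def)
        moreover have "sift y \<subseteq> sift z" using y_le_z by (auto simp: sift_iff)
        then have "n \<in> G i q" using nx ns i q(1) by (auto simp: G_def)
        ultimately show ?thesis using i(1) by blast
      qed simp
    qed
    have "card (Omega1 S k a b x z) \<le> card good + (\<Sum>i\<in>{1..k}. \<Sum>q\<in>F. card (G i q))"
    proof -
      have "card (Omega1 S k a b x z) \<le> card (good \<union> (\<Union>i\<in>{1..k}. \<Union>q\<in>F. G i q))"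
        using fin1 finF finG by (intro card_mono sub) (auto simp: good_def)
      also have "\<dots> \<le> card good + card (\<Union>i\<in>{1..k}. \<Union>q\<in>F. G i q)" by (rule card_Un_le)
      also have "card (\<Union>i\<in>{1..k}. \<Union>q\<in>F. G i q) \<le> (\<Sum>i\<in>{1..k}. card (\<Union>q\<in>F. G i q))" by (intro card_UN_le) auto
      also have "\<dots> \<le> (\<Sum>i\<in>{1..k}. \<Sum>q\<in>F. card (G i q))" by (intro sum_mono card_UN_le finF)
      finally show ?thesis by simp
    qed
    then have 1: "real (card (Omega1 S k a b x z)) \<le> real (card good) + (\<Sum>i\<in>{1..k}. \<Sum>q\<in>F. real (card (G i q)))"
      by (simp only: of_nat_le_iff[where 'a = real, symmetric] of_nat_add of_nat_sum)
    define Q where "Q = c * x / ln x ^ k"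
    have "(\<Sum>i\<in>{1..k}. \<Sum>q\<in>F. real (card (G i q)))
      \<le> (\<Sum>i\<in>{1..k}. \<Sum>q\<in>F. 2 * x * sieve_density y * (1 / real q) + y ^ K)"
      unfolding G_def using y_le_z x2 by (intro sum_mono card_prime_divisor[OF K _ _ _ _ y2]) (auto simp: F_def)
    also have "\<dots> = real k * (2 * x * sieve_density y * (\<Sum>q\<in>F. 1 / real q)) + real k * (real (card F) * sqrt z)"
      by (simp add: sum.distrib sum_distrib_left yK algebra_simps)
    also have "\<dots> \<le> Q / 4 + Q / 4"
    proof (rule add_mono)
      have "sieve_density y \<le> 2 ^ (card S * k) / ln y ^ k" using y2 by (intro sieve_density_upper) auto
      \<comment> \<open>The power of \<open>2 * K / \<eta>\<close> is the price of sifting only to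
        \<open>y\<close>, since \<open>ln y = \<eta> / (2 * K) * ln x\<close>.\<close>
      also have "\<dots> = 2 ^ (card S * k) * (2 * real K / \<eta>) ^ k / ln x ^ k"
        using lnx \<eta>(1) K1 by (simp add: lny power_mult_distrib power_divide)
      finally have D: "sieve_density y \<le> 2 ^ (card S * k) * (2 * real K / \<eta>) ^ k / ln x ^ k" .
      have "real k * (2 * x * sieve_density y * (\<Sum>q\<in>F. 1 / real q))
        \<le> real k * (2 * x * (2 ^ (card S * k) * (2 * real K / \<eta>) ^ k / ln x ^ k) * (100 * \<epsilon> / \<eta>))"
        using D sumF x2 lnx \<eta> K1 by (intro mult_left_mono mult_mono sum_nonneg) auto
      also have "\<dots> = real k * (2 * 2 ^ (card S * k) * (2 * real K / \<eta>) ^ k * (100 * \<epsilon> / \<eta>)) * (x / ln x ^ k)"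
        by (simp add: mult_ac)
      also have "\<dots> \<le> c / 4 * (x / ln x ^ k)"
        using \<epsilon> x2 lnx by (intro mult_right_mono) auto
      finally show "real k * (2 * x * sieve_density y * (\<Sum>q\<in>F. 1 / real q)) \<le> Q / 4" by (simp add: Q_def)
    next
      have "real k * (real (card F) * sqrt z) \<le> real k * (U * sqrt z)"
        using cardF z2 by (intro mult_left_mono mult_right_mono) auto
      also have "\<dots> = real k * size_bound * x / sqrt z"
        using z2 real_sqrt_mult_self[of z] by (simp add: U_def field_simps)
      also have "\<dots> \<le> Q / 4"
      proof -
        have "4 * real k * size_bound / (c * \<eta> ^ k) * ln z ^ k \<le> sqrt z" using t0 zW W by simp
        then have "4 * real k * size_bound / c * ln x ^ k \<le> sqrt z"
          using \<eta>(1) by (simp add: lnz power_mult_distrib)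
        then have "4 * real k * size_bound / c * ln x ^ k * x \<le> sqrt z * x"
          using x2 by (intro mult_right_mono) auto
        moreover have "0 < ln x ^ k" "0 < sqrt z" using lnx z2 by auto
        ultimately show ?thesis using c by (simp add: Q_def field_simps)
      qed
      finally show "real k * (real (card F) * sqrt z) \<le> Q / 4" .
    qed
    finally have 2: "(\<Sum>i\<in>{1..k}. \<Sum>q\<in>F. real (card (G i q))) \<le> Q / 2" by simp
    have 3: "Q \<le> real (card (Omega1 S k a b x z))"
    proof -
      have "ln z ^ k \<le> ln x ^ k" unfolding lnz using lnx \<eta> by (intro power_mono mult_left_le_one_le) auto
      moreover have "0 < ln z" using z2 by simp
      ultimately have "Q \<le> c * x / ln z ^ k"
        unfolding Q_def using c x2 lnx by (intro divide_left_mono) auto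
      also have "\<dots> \<le> real (card (Omega1 S k a b x z))"
        using zW W by (intro lower) (auto simp: z_def)
      finally show ?thesis .
    qed
    show ?thesis using 1 2 3 unfolding good_def z_def by linarith
  qed
  moreover have "x0 \<ge> 2" by (simp add: x0_def)
  ultimately show ?thesis by blast
qed

end

section \<open>Choice of the constants and conclusion\<close>

theorem theorem4p1:
  fixes k s :: nat
  assumes "k \<ge> 1"
  shows "\<exists>\<eta> c1 \<epsilon> :: real.
    \<eta> \<in> {0<..1/2} \<and> c1 \<in> {0<..1/2} \<and> \<epsilon> \<in> {0<..1/2} \<and>
    (\<forall>(S::int set) (a::nat \<Rightarrow> int) (b::nat \<Rightarrow> int).
       finite S \<and> card S = s \<and> (\<forall>p\<in>S. prime p) \<and>
       (\<forall>i\<in>{1..k}. a i \<noteq> 0 \<and> gcd (a i) (b i) = 1) \<and>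
       (\<forall>i\<in>{1..k}. \<forall>j\<in>{1..k}. i < j \<longrightarrow> a i * b j - a j * b i \<noteq> 0) \<and>
       sigma_unit S (int (fact (2*k)) * (\<Prod>i\<in>{1..k}. a i) *
          (\<Prod>(i,j)\<in>{(i,j). i \<in> {1..k} \<and> j \<in> {1..k} \<and> i < j}. a i * b j - a j * b i)) \<and>
       (\<forall>i\<in>{1..k}. \<forall>p\<in>S. p dvd a i)
     \<longrightarrow>
       (\<exists>z1::real. z1 \<ge> 2 \<and>
          (\<forall>x z::real. z1 \<le> z \<and> z \<le> x powr \<eta> \<longrightarrow>
             real (card (Omega1 S k a b x z)) \<ge> c1 * x / (ln z) ^ k)) \<and>
       (\<forall>P::int set. (\<forall>p\<in>P. prime p) \<and> rel_upper_density P \<le> ereal \<epsilon> \<longrightarrow>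
          (\<exists>x0::real. x0 \<ge> 2 \<and> (\<forall>x::real. x \<ge> x0 \<longrightarrow>
             2 * real (card {n \<in> Omega1 S k a b x (x powr \<eta>).
                    \<forall>p\<in>P. \<not> p dvd (\<Prod>i\<in>{1..k}. linform a b i n)})
             \<ge> real (card (Omega1 S k a b x (x powr \<eta>)))))))"
proof -
  obtain K where K: "sieve_constant k K" using ex_sieve_constant[OF assms] by blast
  then have K1: "K \<ge> 1" by (simp add: sieve_constant_def)
  obtain c' where c': "0 < c'" "\<And>z Q. z \<ge> 2 \<Longrightarrow> Q \<subseteq> primes_below z \<Longrightarrow> (\<And>p. p \<in> Q \<Longrightarrow> 2 * k \<le> p) \<Longrightarrow>
    c' / ln z ^ k \<le> (\<Prod>p\<in>Q. 1 - real k / real p)"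
    using mertens_product_ge[OF assms] by blast
  \<comment> \<open>The case \<open>k = 1\<close> is the lower bound for the ordinary Mertens
    product, used when a single form is sieved.\<close>
  obtain d where d: "0 < d" "\<And>z Q. z \<ge> 2 \<Longrightarrow> Q \<subseteq> primes_below z \<Longrightarrow> (\<And>p. p \<in> Q \<Longrightarrow> 2 * 1 \<le> p) \<Longrightarrow>
    d / ln z ^ 1 \<le> (\<Prod>p\<in>Q. 1 - real 1 / real p)"
    using mertens_product_ge[of 1] by blast
  have d': "d / ln z \<le> (\<Prod>p\<in>primes_below z. 1 - 1 / real p)" if "z \<ge> 2" for z
    using d(2)[OF that subset_refl] prime_ge_2_nat by (simp add: primes_below_def)
  \<comment> \<open>Capping at 4 brings \<open>c1 = c / 8\<close> into the required range.\<close>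
  define c where "c = min c' 4"
  have c: "0 < c" "c / 8 \<le> 1 / 2" using c'(1) by (auto simp: c_def)
  have c_prod: "c / ln z ^ k \<le> (\<Prod>p\<in>Q. 1 - real k / real p)"
    if "z \<ge> 2" "Q \<subseteq> primes_below z" "\<And>p. p \<in> Q \<Longrightarrow> 2 * k \<le> p" for z Q
  proof -
    have "c / ln z ^ k \<le> c' / ln z ^ k" using that(1) by (intro divide_right_mono) (auto simp: c_def)
    also have "\<dots> \<le> (\<Prod>p\<in>Q. 1 - real k / real p)" by (rule c'(2)[OF that])
    finally show ?thesis .
  qed
  \<comment> \<open>The first bound keeps \<open>z\<close> below the level whose sieve remainder is
    \<open>sqrt x\<close>; the second limits prime values to \<open>x * V / (4 * k)\<close> per
    form, up to lower-order terms.\<close>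
  define \<eta> where "\<eta> = min (1 / (2 * real K)) (d / (16 * real k * real K))"
  have \<eta>: "0 < \<eta>" "\<eta> \<le> 1 / (2 * real K)" "\<eta> \<le> d / (16 * real k * real K)"
    using d(1) K1 assms by (auto simp: \<eta>_def)
  have "1 / (2 * real K) \<le> 1 / 2" using K1 by (simp add: field_simps)
  then have \<eta>_half: "\<eta> \<le> 1 / 2" using \<eta>(2) by linarith
  \<comment> \<open>The factor of \<open>\<epsilon>\<close> in the smallness condition of (b), with
    \<open>s\<close> for the size of \<open>S\<close>. The target \<open>c / 32\<close> is a quarter
    of \<open>c1\<close>.\<close>
  define M where "M = real k * (2 * 2 ^ (s * k) * (2 * real K / \<eta>) ^ k * (100 / \<eta>))"
  have M: "M > 0" unfolding M_def using assms \<eta>(1) K1 by (intro mult_pos_pos zero_less_power divide_pos_pos) auto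
  define \<epsilon> where "\<epsilon> = min (1 / 2) (c / 32 / M)"
  have \<epsilon>: "0 < \<epsilon>" "\<epsilon> \<le> 1 / 2" "\<epsilon> \<le> c / 32 / M" using c M by (auto simp: \<epsilon>_def)
  have \<epsilon>M: "real k * (2 * 2 ^ (s * k) * (2 * real K / \<eta>) ^ k * (100 * \<epsilon> / \<eta>)) \<le> c / 8 / 4"
  proof -
    have "\<epsilon> * M \<le> c / 32" using \<epsilon>(3) M by (simp add: field_simps)
    then show ?thesis by (simp add: M_def mult_ac)
  qed
  show ?thesis
  proof (rule exI[of _ \<eta>], rule exI[of _ "c / 8"], rule exI[of _ \<epsilon>], intro conjI allI impI, goal_cases)
    case 1 show ?case using \<eta>(1) \<eta>_half by simp
  next
    case 2 show ?case using c by simp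
  next
    case 3 show ?case using \<epsilon> by simp
  next
    case (4 S a b)
    then interpret linear_forms S k a b
      using assms by unfold_locales (auto simp: coprime_iff_gcd_eq_1)
    show ?case using Omega1_lower[OF K c(1) c_prod d(1) d' \<eta>] by blast
  next
    case (5 S a b P)
    then interpret linear_forms S k a b
      using assms by unfold_locales (auto simp: coprime_iff_gcd_eq_1)
    obtain z1 where z1: "\<And>x z. z1 \<le> z \<Longrightarrow> z \<le> x powr \<eta> \<Longrightarrow> c / 8 * x / ln z ^ k \<le> real (card (Omega1 S k a b x z))"
      using Omega1_lower[OF K c(1) c_prod d(1) d' \<eta>] by blast
    show ?case
      using half_avoid_sparse_primes[OF K \<eta>(1) \<eta>_half _ z1, where P = P and \<epsilon> = \<epsilon>] c(1) 5 \<epsilon>M \<epsilon>(1) by auto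
  qed
qed

end
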